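(* Let $n\ge 2$ be an integer, $q$ a prime power, and let $A\in \operatorname{GL}(n,q)$ be diagonalisable (over the algebraic closure $\overline{\mathbb F}_q$). Let $\tau$ be the multiplicative order of $A$ and $t$ the multiplicative order of $\det A\in\mathbb F_q^*$. Let $E_{n,q}(A)$ denote the number of quadruples $(x_1,x_2,x_3,x_4)$ of integers with $1\le x_1,x_2,x_3,x_4\le \tau$ such that $$A^{x_1}+A^{x_2}=A^{x_3}+A^{x_4}.$$ Then $$E_{n,q}(A)\ll \tau^3\min\left\{t\,\tau^{-1/n^2},\ t^{n/(n-1)}\tau^{-1/(n(n-1))}\right\}.$$ If moreover the characteristic polynomial of $A$ is irreducible over $\mathbb F_q$, then $$E_{n,q}(A)\ll t\,\tau^{3-1/n}.$$ The implied constants depend only on $n$.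
   Context: $\operatorname{GL}(n,q)$ is the group of invertible $n\times n$ matrices over the finite field $\mathbb F_q$ of $q$ elements. The multiplicative order of $A$ is the least integer $\tau\ge1$ with $A^\tau$ equal to the identity matrix. $U\ll V$ means $|U|\le cV$ for a constant $c>0$. *)

theory Defs
  imports
    Complex_Main
    "HOL-Combinatorics.Permutations"
    "HOL-Algebra.Algebraic_Closure"
    "Jordan_Normal_Form.Matrix"
begin

text \<open>
  Finite fields are HOL-Algebra records, not types of class \<open>{field, finite}\<close>: a field given by a
  type cannot be quantified inside a formula, so a constant \<open>c\<close> bound by an existential would
  depend on it (hence on \<open>q\<close>). With records, \<open>\<exists>c. \<forall>R\<close> expresses uniformity in \<open>q\<close>. Since every
  finite field is isomorphic to one with carrier in \<open>nat\<close>, for each infinite carrier type one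
  constant serves all finite fields.

  The matrix operations of \<open>Jordan_Normal_Form\<close> need type-class arithmetic on the entries, so only
  its type \<open>'a mat\<close> (with \<open>carrier_mat\<close>, \<open>mat\<close>, \<open>$$\<close>, \<open>map_mat\<close>) is used; the operations are those
  of the coefficient record.
\<close>

definition mat_ring :: "nat \<Rightarrow> ('a, 'b) ring_scheme \<Rightarrow> 'a mat ring" where
  "mat_ring n R =
     \<lparr> carrier = {A \<in> carrier_mat n n. \<forall>i<n. \<forall>j<n. A $$ (i, j) \<in> carrier R},
       monoid.mult = (\<lambda>A B. mat n n (\<lambda>(i, j). \<Oplus>\<^bsub>R\<^esub>k\<in>{..<n}. A $$ (i, k) \<otimes>\<^bsub>R\<^esub> B $$ (k, j))),
       one = mat n n (\<lambda>(i, j). if i = j then \<one>\<^bsub>R\<^esub> else \<zero>\<^bsub>R\<^esub>),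
       zero = mat n n (\<lambda>_. \<zero>\<^bsub>R\<^esub>),
       add = (\<lambda>A B. mat n n (\<lambda>(i, j). A $$ (i, j) \<oplus>\<^bsub>R\<^esub> B $$ (i, j))) \<rparr>"

definition GL :: "nat \<Rightarrow> ('a, 'b) ring_scheme \<Rightarrow> 'a mat monoid" where
  "GL n R = units_of (mat_ring n R)"

definition mat_det :: "nat \<Rightarrow> ('a, 'b) ring_scheme \<Rightarrow> 'a mat \<Rightarrow> 'a" where
  "mat_det n R A =
     (\<Oplus>\<^bsub>R\<^esub>p\<in>{p. p permutes {..<n}}.
        (if evenperm p then \<one>\<^bsub>R\<^esub> else \<ominus>\<^bsub>R\<^esub> \<one>\<^bsub>R\<^esub>) \<otimes>\<^bsub>R\<^esub> finprod R (\<lambda>i. A $$ (i, p i)) {..<n})"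

text \<open>The determinant of \<open>X \<cdot> I - A\<close>, taken over the polynomial ring \<open>R[X]\<close>.\<close>

definition mat_char_poly :: "nat \<Rightarrow> ('a, 'b) ring_scheme \<Rightarrow> 'a mat \<Rightarrow> 'a list" where
  "mat_char_poly n R A =
     mat_det n (poly_ring R)
       (mat n n (\<lambda>(i, j).
          (if i = j then X\<^bsub>R\<^esub> else \<zero>\<^bsub>poly_ring R\<^esub>)
            \<ominus>\<^bsub>poly_ring R\<^esub> ring.poly_of_const R (A $$ (i, j))))"

definition mat_diagonalisable :: "nat \<Rightarrow> ('a, 'b) ring_scheme \<Rightarrow> 'a mat \<Rightarrow> bool" where
  "mat_diagonalisable n L A \<longleftrightarrow>
     (\<exists>P \<in> carrier (GL n L).
        let D = inv\<^bsub>mat_ring n L\<^esub> P \<otimes>\<^bsub>mat_ring n L\<^esub> A \<otimes>\<^bsub>mat_ring n L\<^esub> P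
        in \<forall>i<n. \<forall>j<n. i \<noteq> j \<longrightarrow> D $$ (i, j) = \<zero>\<^bsub>L\<^esub>)"

text \<open>\<open>ring.indexed_const R\<close> is the library's embedding of \<open>R\<close> into \<open>field.alg_closure R\<close>.\<close>

definition diagonalisable_over_closure :: "nat \<Rightarrow> ('a, 'b) ring_scheme \<Rightarrow> 'a mat \<Rightarrow> bool" where
  "diagonalisable_over_closure n R A \<longleftrightarrow>
     mat_diagonalisable n (field.alg_closure R) (map_mat (ring.indexed_const R) A)"

definition mat_order :: "nat \<Rightarrow> ('a, 'b) ring_scheme \<Rightarrow> 'a mat \<Rightarrow> nat" where
  "mat_order n R A = group.ord (GL n R) A"

definition det_order :: "nat \<Rightarrow> ('a, 'b) ring_scheme \<Rightarrow> 'a mat \<Rightarrow> nat" where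
  "det_order n R A = group.ord (mult_of R) (mat_det n R A)"

definition energy :: "nat \<Rightarrow> ('a, 'b) ring_scheme \<Rightarrow> 'a mat \<Rightarrow> nat" where
  "energy n R A =
     card {(x1, x2, x3, x4).
             {x1, x2, x3, x4} \<subseteq> {1..mat_order n R A} \<and>
             A [^]\<^bsub>mat_ring n R\<^esub> (x1::nat) \<oplus>\<^bsub>mat_ring n R\<^esub> A [^]\<^bsub>mat_ring n R\<^esub> (x2::nat)
             = A [^]\<^bsub>mat_ring n R\<^esub> (x3::nat) \<oplus>\<^bsub>mat_ring n R\<^esub> A [^]\<^bsub>mat_ring n R\<^esub> (x4::nat)}"

end

theory Submission
  imports Defs "HOL-Computational_Algebra.Primes"
begin

text \<open>
  Let \<open>\<lambda>\<^sub>1, \<dots>, \<lambda>\<^sub>n\<close> be the eigenvalues of \<open>A\<close>. Dividing by \<open>A ^ x\<^sub>1\<close>, the energy is at most \<open>\<tau>\<close> times the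
  number of pairs \<open>(y, z)\<close> modulo \<open>\<tau>\<close> for which some \<open>w\<close> satisfies
  \<open>1 + \<lambda>\<^sub>i ^ y = \<lambda>\<^sub>i ^ z + \<lambda>\<^sub>i ^ w\<close> for all \<open>i\<close> in a chosen set \<open>S\<close> of indices. Taking the product over \<open>S\<close>,
  \<open>(\<Prod>i\<in>S. 1 - \<lambda>\<^sub>i ^ z + \<lambda>\<^sub>i ^ y)\<close> is a power of \<open>\<Prod>i\<in>S. \<lambda>\<^sub>i\<close>, so it takes few values if that product has
  small order. Fix \<open>z\<close> with no \<open>\<lambda>\<^sub>i ^ z\<close> equal to \<open>1\<close> and one such value \<open>s\<close>. Let \<open>g\<close>, of order \<open>r\<close>, generate
  the group spanned by the \<open>\<lambda>\<^sub>i\<close> with \<open>i \<in> S\<close>. By Dirichlet's theorem on simultaneous approximation there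
  is \<open>0 < k < r\<close> with \<open>\<lambda>\<^sub>i ^ k = g ^ e\<^sub>i\<close> and \<open>\<bar>e\<^sub>i\<bar>\<close> of size \<open>r ^ (1 - 1/card S)\<close>. Along a progression
  \<open>y = c + k j\<close> the condition is a polynomial equation of degree \<open>\<Sum>\<bar>e\<^sub>i\<bar>\<close> in \<open>g ^ j\<close>, and this bounds the
  number of \<open>y\<close>.

  If the characteristic polynomial is irreducible, all \<open>\<lambda>\<^sub>i\<close> have order \<open>\<tau>\<close> and \<open>S\<close> is the set of all
  indices. Otherwise the eigenvalues whose order is below the inverse of the desired saving are discarded;
  their orders are so small that the order of \<open>\<Prod>i\<in>S. \<lambda>\<^sub>i\<close> grows only slightly and \<open>r\<close> stays large.
\<close>

section \<open>Elements of maximal order and root counting\<close>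

text \<open>If \<open>(x \<otimes> y) [^] k\<close> is trivial, raising it to the power
  \<open>ord y\<close> removes \<open>y\<close>, so \<open>ord x\<close> divides
  \<open>k * ord y\<close> and, by coprimality, \<open>k\<close>. The roles of \<open>x\<close> and
  \<open>y\<close> are symmetric.\<close>

lemma (in comm_group) ord_mult_coprime:
  assumes x: "x \<in> carrier G" and y: "y \<in> carrier G" and cop: "coprime (ord x) (ord y)"
  shows "ord (x \<otimes> y) = ord x * ord y"
proof (rule dvd_antisym)
  show "ord (x \<otimes> y) dvd ord x * ord y"
    by (rule abelian_ord_mul_divides[OF x y])
  define k where "k = ord (x \<otimes> y)"
  have one: "x [^] k \<otimes> y [^] k = \<one>"
    using pow_ord_eq_1[of "x \<otimes> y"] x y pow_mult_distrib[OF m_comm[OF x y] x y, of k] unfolding k_def by simp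
  have pow: "x [^] (k * l) \<otimes> y [^] (k * l) = \<one>" for l :: nat
  proof -
    have "(x [^] k \<otimes> y [^] k) [^] l = (x [^] k) [^] l \<otimes> (y [^] k) [^] l"
      using x y by (intro pow_mult_distrib m_comm) auto
    then show ?thesis using one x y by (simp add: nat_pow_pow)
  qed
  have "ord x dvd k * ord y"
  proof -
    have "y [^] (k * ord y) = \<one>" using y by (simp add: pow_eq_id)
    then have "x [^] (k * ord y) = \<one>" using pow[of "ord y"] x y by simp
    then show ?thesis using pow_eq_id x y by blast
  qed
  then have 1: "ord x dvd k"
    using cop by (simp add: coprime_dvd_mult_left_iff)
  have "ord y dvd k * ord x"
  proof -
    have "x [^] (k * ord x) = \<one>" using x by (simp add: pow_eq_id)
    then have "y [^] (k * ord x) = \<one>" using pow[of "ord x"] x y by simp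
    then show ?thesis using pow_eq_id x y by blast
  qed
  then have 2: "ord y dvd k"
    using cop by (simp add: coprime_dvd_mult_left_iff coprime_commute)
  show "ord x * ord y dvd k"
    using divides_mult[OF 1 2 cop] .
qed

text \<open>Orders in the \<open>N\<close>-torsion are bounded by \<open>N\<close>, so some
  \<open>g\<close> there has maximal order. If \<open>ord x\<close> did not divide
  \<open>ord g\<close>, some prime \<open>p\<close> would occur to a higher power in
  \<open>ord x\<close>, and replacing the \<open>p\<close>-part of \<open>g\<close> by that of
  \<open>x\<close> would give a larger order.\<close>

lemma (in comm_group) exists_ord_exponent:
  assumes N: "N > 0"
  shows "\<exists>g\<in>carrier G. ord g > 0 \<and> g [^] (N::nat) = \<one> \<and> (\<forall>x\<in>carrier G. x [^] N = \<one> \<longrightarrow> ord x dvd ord g)"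
proof -
  define H where "H = {x \<in> carrier G. x [^] N = \<one>}"
  have H_ord: "ord x dvd N" "ord x > 0" if "x \<in> H" for x
    using that N unfolding H_def by (auto simp: pow_eq_id intro: Nat.gr0I)
  have "\<one> \<in> H" by (simp add: H_def)
  moreover have "\<forall>x. x \<in> H \<longrightarrow> ord x < Suc N"
    using H_ord N by (auto intro: dvd_imp_le simp: less_Suc_eq_le)
  ultimately have "\<exists>g. g \<in> H \<and> (\<forall>x. x \<in> H \<longrightarrow> ord x \<le> ord g)"
    by (rule Lattices_Big.ex_has_greatest_nat)
  then obtain g where g: "g \<in> H" and gmax: "\<And>x. x \<in> H \<Longrightarrow> ord x \<le> ord g" by blast
  have gc: "g \<in> carrier G" using g by (simp add: H_def)
  have "ord x dvd ord g" if x: "x \<in> carrier G" and xN: "x [^] N = \<one>" for x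
  proof (rule ccontr)
    have xH: "x \<in> H" using x xN by (simp add: H_def)
    assume nd: "\<not> ord x dvd ord g"
    have nz: "ord x \<noteq> 0" "ord g \<noteq> 0" using H_ord xH g by auto
    obtain p where p: "Factorial_Ring.prime p" "multiplicity p (ord x) > multiplicity p (ord g)"
      using multiplicity_le_imp_dvd[OF nz(1), of "ord g"] nd by (meson not_le)
    define a where "a = multiplicity p (ord x)"
    define b where "b = multiplicity p (ord g)"
    have pu: "p \<noteq> 0" "\<not> p dvd 1" using p(1) by auto
    obtain u where u: "ord x = p ^ a * u"
      unfolding a_def using multiplicity_dvd[of p "ord x"] by blast
    obtain v where v: "ord g = p ^ b * v" and pv: "\<not> p dvd v"
      unfolding b_def using multiplicity_decompose'[of "ord g" p] nz pu by auto
    \<comment> \<open>\<open>x'\<close> has order \<open>p ^ a\<close>, and \<open>g'\<close> has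
      order \<open>v\<close>, which is prime to \<open>p\<close>. Their product has order
      \<open>p ^ a * v\<close>, larger than \<open>ord g = p ^ b * v\<close>.\<close>
    define x' where "x' = x [^] u"
    define g' where "g' = g [^] (p ^ b)"
    have c': "x' \<in> carrier G" "g' \<in> carrier G" using x gc by (auto simp: x'_def g'_def)
    have u0: "u > 0" using u nz by (auto intro: Nat.gr0I)
    have pb0: "p ^ b > 0" using pu by simp
    have ox: "ord x' = p ^ a" unfolding x'_def using ord_pow[OF x, of u] u u0 by simp
    have og: "ord g' = v" unfolding g'_def using ord_pow[OF gc, of "p^b"] v pb0 by simp
    have "coprime (p ^ a) v" using prime_imp_coprime[OF p(1) pv] by simp
    then have "ord (x' \<otimes> g') = p ^ a * v"
      using ord_mult_coprime[OF c'] ox og by simp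
    moreover have "x' \<otimes> g' \<in> H"
    proof -
      have "x' [^] N = \<one>" "g' [^] N = \<one>"
        using dvd_mult_left[of "p ^ a" u N] dvd_mult_right[of "p ^ b" v N] H_ord(1)[OF xH] H_ord(1)[OF g] u v c'
        by (simp_all add: pow_eq_id ox og)
      then show ?thesis using c' pow_mult_distrib[OF m_comm[OF c'] c', of N] by (simp add: H_def)
    qed
    ultimately have "p ^ a * v \<le> p ^ b * v" using gmax v by metis
    moreover have "v > 0" using v nz by (auto intro: Nat.gr0I)
    moreover have "p ^ b < p ^ a" using p(2) prime_gt_1_nat[OF p(1)] by (simp add: a_def b_def)
    ultimately show False by simp
  qed
  then show ?thesis
    using g gc H_ord[OF g] by (auto simp: H_def)
qed

text \<open>Here, as in \<open>det_order\<close>, \<open>mult_of\<close> is the constant of \<open>Ring_Divisibility\<close>, which hides the one of \<open>Multiplicative_Group\<close>.\<close>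

lemma (in field) comm_group_mult_of: "comm_group (mult_of R)"
proof (rule comm_groupI)
  fix x assume x: "x \<in> carrier (mult_of R)"
  then have "x \<in> Units R" by (simp add: field_Units)
  then have "inv x \<in> Units R" "inv x \<otimes> x = \<one>" by (simp_all add: Units_inv_Units Units_l_inv)
  then show "\<exists>y\<in>carrier (mult_of R). y \<otimes>\<^bsub>mult_of R\<^esub> x = \<one>\<^bsub>mult_of R\<^esub>"
    by (intro bexI[of _ "inv x"]) (simp_all add: field_Units)
qed (auto simp: m_ac dest: integral)

text \<open>Passes from the multiset \<open>roots\<close>, which counts multiplicities, to the set
  of distinct roots.\<close>

lemma (in field) card_roots_le_degree:
  assumes p: "p \<in> carrier (poly_ring R)" and nz: "p \<noteq> []"
  shows "finite {x \<in> carrier R. eval p x = \<zero>}" and "card {x \<in> carrier R. eval p x = \<zero>} \<le> degree p"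
proof -
  have eq: "{x \<in> carrier R. eval p x = \<zero>} = {x. is_root p x}"
    using nz by (auto simp: is_root_def)
  show "finite {x \<in> carrier R. eval p x = \<zero>}"
    unfolding eq by (rule finite_number_of_roots[OF p])
  have "{x. is_root p x} = set_mset (roots p)"
    using roots_mem_iff_is_root[OF p] by auto
  then have "card {x. is_root p x} \<le> size (roots p)"
    unfolding size_multiset_overloaded_eq by (simp only: card_eq_sum, intro sum_mono) (simp add: Suc_le_eq)
  then show "card {x \<in> carrier R. eval p x = \<zero>} \<le> degree p"
    unfolding eq using size_roots_le_degree[OF p] by simp
qed

section \<open>Simultaneous Diophantine approximation\<close>

text \<open>Pigeonhole principle: cut the residues modulo \<open>r\<close> into at most
  \<open>m\<close> intervals of length \<open>M\<close> in each coordinate. There are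
  \<open>m ^ card S < r\<close> boxes for \<open>r\<close> multipliers, so two multipliers share a
  box, and their difference serves as \<open>k\<close>.\<close>

lemma dirichlet_simultaneous:
  fixes a :: "'i \<Rightarrow> nat" and r m M :: nat
  assumes S: "finite S" and r: "m ^ card S < r" "r \<le> m * M"
  shows "\<exists>k e. 0 < k \<and> k < r \<and> (\<forall>i\<in>S. int (k * a i) mod int r = e i mod int r \<and> \<bar>e i\<bar> < int M)"
proof -
  have r0: "r > 0" and M0: "M > 0" using r by (auto intro: Nat.gr0I)
  define f where "f = (\<lambda>k. \<lambda>i\<in>S. (k * a i mod r) div M)"
  have "f ` {..<r} \<subseteq> S \<rightarrow>\<^sub>E {..<m}"
  proof (intro image_subsetI PiE_I)
    fix k i assume "i \<in> S"
    have "k * a i mod r < m * M" using r(2) r0 by (meson mod_less_divisor less_le_trans)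
    then show "f k i \<in> {..<m}" using \<open>i \<in> S\<close> by (simp add: f_def less_mult_imp_div_less)
  qed (simp add: f_def)
  then have "card (f ` {..<r}) \<le> card (S \<rightarrow>\<^sub>E {..<m})"
    using S by (intro card_mono finite_PiE) auto
  also have "\<dots> = m ^ card S" using S by (simp add: card_PiE)
  finally have "card (f ` {..<r}) < card {..<r}" using r(1) by simp
  then have "\<not> inj_on f {..<r}" using pigeonhole by blast
  then obtain k1 k2 where k: "k1 < k2" "k2 < r" "f k1 = f k2"
    unfolding inj_on_def by (metis lessThan_iff linorder_neqE_nat)
  \<comment> \<open>Differences of least residues, hence signed integers; two residues in the same
    interval differ by less than \<open>M\<close>.\<close>
  define e where "e = (\<lambda>i. int (k2 * a i mod r) - int (k1 * a i mod r))"
  show ?thesis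
  proof (intro exI conjI ballI)
    show "0 < k2 - k1" "k2 - k1 < r" using k by auto
    fix i assume i: "i \<in> S"
    have "int ((k2 - k1) * a i) = int (k2 * a i) - int (k1 * a i)"
      using k(1) by (simp add: of_nat_diff algebra_simps)
    then show "int ((k2 - k1) * a i) mod int r = e i mod int r"
      unfolding e_def by (simp add: zmod_int mod_diff_eq)
    define u v where "u = k2 * a i mod r" and "v = k1 * a i mod r"
    define w where "w = u div M * M"
    have "u div M = v div M" using fun_cong[OF k(3), of i] i by (simp add: f_def u_def v_def)
    then have uv: "u = w + u mod M" "v = w + v mod M" unfolding w_def by (metis div_mult_mod_eq)+
    have "u mod M < M" "v mod M < M" using M0 by auto
    then have "\<bar>int u - int v\<bar> < int M" using uv by linarith
    then show "\<bar>e i\<bar> < int M" by (simp add: e_def u_def v_def)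
  qed
qed

section \<open>Products of twisted binomials\<close>

lemma (in field) binomial_poly:
  assumes "a \<in> carrier R" "b \<in> carrier R" "b \<noteq> \<zero>" "d > 0"
  shows "\<exists>p\<in>carrier (poly_ring R). p \<noteq> [] \<and> degree p = d \<and> (\<forall>x\<in>carrier R. eval p x = a \<oplus> b \<otimes> x [^] d)"
proof (intro bexI conjI ballI)
  \<comment> \<open>Coefficient lists start with the leading coefficient, so this is
    \<open>b X ^ d + a\<close>.\<close>
  define p where "p = monom b (d - 1) @ [a]"
  show "p \<noteq> []" by (simp add: p_def)
  show "degree p = d" using assms by (simp add: p_def monom_def)
  show "p \<in> carrier (poly_ring R)"
    using assms unfolding univ_poly_carrier[symmetric] polynomial_def p_def monom_def by auto
  fix x assume x: "x \<in> carrier R"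
  have "eval p x = eval (monom b (d - 1)) x \<otimes> x [^] (1::nat) \<oplus> eval [a] x"
    unfolding p_def using assms x by (subst eval_append) (auto simp: monom_def)
  also have "eval (monom b (d - 1)) x = b \<otimes> x [^] (d - 1)"
    using eval_monom assms x by simp
  also have "b \<otimes> x [^] (d - 1) \<otimes> x [^] (1::nat) = b \<otimes> x [^] d"
    using assms x by (simp add: m_assoc flip: nat_pow_Suc)
  finally show "eval p x = a \<oplus> b \<otimes> x [^] d"
    using assms x by (simp add: a_comm)
qed

text \<open>The element \<open>h\<close> is \<open>g\<close> raised to \<open>d\<close> or to \<open>-d\<close>; the power \<open>N\<close> of \<open>g ^ j\<close> clears the denominator in
  the second case.\<close>

lemma (in field) twisted_binomial_poly:
  assumes a: "a \<in> carrier R" "a \<noteq> \<zero>" and b: "b \<in> carrier R" "b \<noteq> \<zero>" and ab: "d = 0 \<Longrightarrow> a \<oplus> b \<noteq> \<zero>"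
    and g: "g \<in> carrier R" and h: "h \<in> carrier R" "h = g [^] d \<or> h \<otimes> g [^] d = \<one>"
  shows "\<exists>p\<in>carrier (poly_ring R). \<exists>N\<le>d. p \<noteq> [] \<and> degree p = d \<and> eval p \<zero> \<noteq> \<zero> \<and>
           (\<forall>j::nat. eval p (g [^] j) = (a \<oplus> b \<otimes> h [^] j) \<otimes> (g [^] j) [^] (N::nat))"
proof (cases "d = 0")
  case True
  then have "h = \<one>" using h by auto
  then show ?thesis
    using a b g ab[OF True] True
    by (intro bexI[of _ "[a \<oplus> b]"] exI[of _ 0]) (auto simp: univ_poly_carrier[symmetric] polynomial_def)
next
  case False
  show ?thesis
  proof (cases "h = g [^] d")
    case True
    obtain p where p: "p \<in> carrier (poly_ring R)" "p \<noteq> []" "degree p = d"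
        "\<And>x. x \<in> carrier R \<Longrightarrow> eval p x = a \<oplus> b \<otimes> x [^] d"
      using binomial_poly[OF a(1) b, of d] False by blast
    have "eval p (g [^] j) = (a \<oplus> b \<otimes> h [^] j) \<otimes> (g [^] j) [^] (0::nat)" for j :: nat
      using p(4)[of "g [^] j"] a b g True by (simp add: nat_pow_pow mult.commute)
    moreover have "eval p \<zero> \<noteq> \<zero>" using p(4)[of \<zero>] False a b by (simp add: nat_pow_zero)
    ultimately show ?thesis using p by blast
  next
    case neq: False
    then have hg: "h \<otimes> g [^] d = \<one>" using h by auto
    \<comment> \<open>Here \<open>h\<close> is the inverse of \<open>g [^] d\<close>, and the
      reversed binomial is used: \<open>a + b x ^ (-d)\<close> times \<open>x ^ d\<close> is
      \<open>b + a x ^ d\<close>.\<close>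
    obtain p where p: "p \<in> carrier (poly_ring R)" "p \<noteq> []" "degree p = d"
        "\<And>x. x \<in> carrier R \<Longrightarrow> eval p x = b \<oplus> a \<otimes> x [^] d"
      using binomial_poly[OF b(1) a, of d] False by blast
    have "eval p (g [^] j) = (a \<oplus> b \<otimes> h [^] j) \<otimes> (g [^] j) [^] d" for j :: nat
    proof -
      have "h [^] j \<otimes> (g [^] j) [^] d = (h \<otimes> g [^] d) [^] j"
        using g h by (simp add: nat_pow_distrib nat_pow_pow mult.commute)
      also have "\<dots> = \<one>" by (simp add: hg)
      finally have "h [^] j \<otimes> (g [^] j) [^] d = \<one>" .
      then show ?thesis
        using p(4)[of "g [^] j"] a b g h by (simp add: l_distr m_assoc a_comm)
    qed
    moreover have "eval p \<zero> \<noteq> \<zero>" using p(4)[of \<zero>] False a b by (simp add: nat_pow_zero)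
    ultimately show ?thesis using p by blast
  qed
qed

text \<open>The polynomials of the single factors are multiplied and their denominators' exponents
  added. Nonvanishing at zero is carried through the induction because it later distinguishes
  \<open>p\<close> from a monomial.\<close>

lemma (in field) prod_twisted_binomials_poly:
  assumes "finite S" and g: "g \<in> carrier R"
    and "\<And>i. i \<in> S \<Longrightarrow> a i \<in> carrier R - {\<zero>}" "\<And>i. i \<in> S \<Longrightarrow> b i \<in> carrier R - {\<zero>}"
    and "\<And>i. i \<in> S \<Longrightarrow> d i = 0 \<Longrightarrow> a i \<oplus> b i \<noteq> \<zero>"
    and "\<And>i. i \<in> S \<Longrightarrow> h i \<in> carrier R" "\<And>i. i \<in> S \<Longrightarrow> h i = g [^] d i \<or> h i \<otimes> g [^] d i = \<one>"
  shows "\<exists>p\<in>carrier (poly_ring R). \<exists>N\<le>sum d S. p \<noteq> [] \<and> degree p = sum d S \<and> eval p \<zero> \<noteq> \<zero> \<and>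
           (\<forall>j::nat. eval p (g [^] j) = (\<Otimes>i\<in>S. a i \<oplus> b i \<otimes> h i [^] j) \<otimes> (g [^] j) [^] (N::nat))"
  using assms
proof (induction S rule: finite_induct)
  case empty
  then show ?case
    by (intro bexI[of _ "[\<one>]"] exI[of _ 0]) (auto simp: univ_poly_carrier[symmetric] polynomial_def)
next
  case (insert i S)
  obtain p N where p: "p \<in> carrier (poly_ring R)" "N \<le> sum d S" "p \<noteq> []" "degree p = sum d S" "eval p \<zero> \<noteq> \<zero>"
     "\<And>j::nat. eval p (g [^] j) = (\<Otimes>i\<in>S. a i \<oplus> b i \<otimes> h i [^] j) \<otimes> (g [^] j) [^] (N::nat)"
    using insert.IH insert.prems by auto
  obtain q M where q: "q \<in> carrier (poly_ring R)" "M \<le> d i" "q \<noteq> []" "degree q = d i" "eval q \<zero> \<noteq> \<zero>"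
     "\<And>j::nat. eval q (g [^] j) = (a i \<oplus> b i \<otimes> h i [^] j) \<otimes> (g [^] j) [^] (M::nat)"
    using twisted_binomial_poly[of "a i" "b i" "d i" g "h i"] insert.prems by auto
  have pq: "polynomial (carrier R) p" "polynomial (carrier R) q" "set p \<subseteq> carrier R" "set q \<subseteq> carrier R"
    using p q by (auto simp: univ_poly_carrier polynomial_incl)
  have closed: "q \<otimes>\<^bsub>poly_ring R\<^esub> p \<in> carrier (poly_ring R)"
    using poly_mult_closed[OF carrier_is_subring pq(2,1)] by (simp add: univ_poly_mult univ_poly_carrier)
  have deg: "degree (q \<otimes>\<^bsub>poly_ring R\<^esub> p) = sum d (insert i S)"
    using poly_mult_degree_eq[OF carrier_is_subring pq(2,1)] insert.hyps p q by (simp add: univ_poly_mult)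
  have ev: "eval (q \<otimes>\<^bsub>poly_ring R\<^esub> p) x = eval q x \<otimes> eval p x" if "x \<in> carrier R" for x
    using eval_poly_mult[OF pq(4,3) that] by (simp add: univ_poly_mult)
  have ev0: "eval (q \<otimes>\<^bsub>poly_ring R\<^esub> p) \<zero> \<noteq> \<zero>"
    using ev[of \<zero>] p(5) q(5) eval_in_carrier[OF pq(3)] eval_in_carrier[OF pq(4)] integral[of "eval q \<zero>" "eval p \<zero>"] by auto
  have "eval (q \<otimes>\<^bsub>poly_ring R\<^esub> p) (g [^] j) = (\<Otimes>i\<in>insert i S. a i \<oplus> b i \<otimes> h i [^] j) \<otimes> (g [^] j) [^] (M + N)" for j :: nat
  proof -
    have c: "(\<lambda>i. a i \<oplus> b i \<otimes> h i [^] j) \<in> S \<rightarrow> carrier R" "a i \<oplus> b i \<otimes> h i [^] j \<in> carrier R"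
      using insert.prems by auto
    have "eval (q \<otimes>\<^bsub>poly_ring R\<^esub> p) (g [^] j) = (a i \<oplus> b i \<otimes> h i [^] j) \<otimes> (g [^] j) [^] M \<otimes>
       ((\<Otimes>i\<in>S. a i \<oplus> b i \<otimes> h i [^] j) \<otimes> (g [^] j) [^] N)"
      using ev[of "g [^] j"] p(6)[of j] q(6)[of j] g by simp
    also have "\<dots> = ((a i \<oplus> b i \<otimes> h i [^] j) \<otimes> (\<Otimes>i\<in>S. a i \<oplus> b i \<otimes> h i [^] j)) \<otimes> ((g [^] j) [^] M \<otimes> (g [^] j) [^] N)"
      using c g finprod_closed[OF c(1)] by (simp add: m_ac)
    also have "(a i \<oplus> b i \<otimes> h i [^] j) \<otimes> (\<Otimes>i\<in>S. a i \<oplus> b i \<otimes> h i [^] j) = (\<Otimes>i\<in>insert i S. a i \<oplus> b i \<otimes> h i [^] j)"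
      using finprod_insert[OF insert.hyps(1,2) c] by simp
    finally show ?thesis using g by (simp add: nat_pow_mult)
  qed
  moreover have "M + N \<le> sum d (insert i S)" using p q insert.hyps by simp
  moreover have "q \<otimes>\<^bsub>poly_ring R\<^esub> p \<noteq> []" using ev0 by auto
  ultimately show ?case using closed deg ev0 by blast
qed

text \<open>The product equals \<open>s\<close> at \<open>j\<close> iff \<open>g ^ j\<close> is a root of \<open>p - s X ^ N\<close>. This polynomial is nonzero: \<open>p\<close> has a
  nonzero constant term and positive degree, so it is not a monomial. If some binomial with \<open>d i = 0\<close>
  vanishes, so does the whole product, which then never equals \<open>s\<close>.\<close>

lemma (in field) card_twisted_binomials_le:
  assumes S: "finite S" and g: "g \<in> carrier (mult_of R)" and r: "r = group.ord (mult_of R) g" "r > 0"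
    and a: "\<And>i. i \<in> S \<Longrightarrow> a i \<in> carrier R - {\<zero>}" and b: "\<And>i. i \<in> S \<Longrightarrow> b i \<in> carrier R - {\<zero>}"
    and h: "\<And>i. i \<in> S \<Longrightarrow> h i \<in> carrier R" "\<And>i. i \<in> S \<Longrightarrow> h i = g [^] d i \<or> h i \<otimes> g [^] d i = \<one>"
    and d: "sum d S > 0" and s: "s \<in> carrier R" "s \<noteq> \<zero>"
  shows "card {j. j < r \<and> (\<Otimes>i\<in>S. a i \<oplus> b i \<otimes> h i [^] j) = s} \<le> sum d S" (is "card ?J \<le> _")
proof (cases "\<exists>i\<in>S. d i = 0 \<and> a i \<oplus> b i = \<zero>")
  case True
  then obtain i where i: "i \<in> S" "d i = 0" "a i \<oplus> b i = \<zero>" by blast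
  have "h i = \<one>" using h[OF i(1)] i(2) by auto
  then have "(\<Otimes>i\<in>S. a i \<oplus> b i \<otimes> h i [^] j) = \<zero>" for j :: nat
    using i a b h S by (intro finprod_zero bexI[of _ i]) (auto simp: Pi_iff)
  then have J: "?J = {}" using s by simp
  show ?thesis unfolding J by simp
next
  case False
  interpret M: comm_group "mult_of R" by (rule comm_group_mult_of)
  have gR: "g \<in> carrier R" using g by simp
  obtain p N where p: "p \<in> carrier (poly_ring R)" "N \<le> sum d S" "p \<noteq> []" "degree p = sum d S" "eval p \<zero> \<noteq> \<zero>"
     "\<And>j::nat. eval p (g [^] j) = (\<Otimes>i\<in>S. a i \<oplus> b i \<otimes> h i [^] j) \<otimes> (g [^] j) [^] (N::nat)"
    using prod_twisted_binomials_poly[of S g a b d h, OF S gR a b _ h] False by blast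
  define m where "m = monom s N"
  define q where "q = p \<ominus>\<^bsub>poly_ring R\<^esub> m"
  interpret UP: domain "poly_ring R" by (rule univ_poly_is_domain[OF carrier_is_subring])
  have m: "m \<in> carrier (poly_ring R)"
    unfolding m_def using monom_is_polynomial[OF carrier_is_subring, of s N] s by (simp add: univ_poly_carrier)
  have degm: "degree m = N" by (simp add: m_def monom_def)
  have evm: "eval m x = s \<otimes> x [^] N" if "x \<in> carrier R" for x
    unfolding m_def using eval_monom s that by simp
  have q: "q \<in> carrier (poly_ring R)" unfolding q_def using p m by simp
  have evq: "eval q x = eval p x \<ominus> s \<otimes> x [^] N" if "x \<in> carrier R" for x
  proof -
    interpret E: ring_hom_ring "poly_ring R" R "\<lambda>p. eval p x"
      by (rule eval_ring_hom[OF carrier_is_subring that])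
    show ?thesis unfolding q_def a_minus_def using p m evm[OF that] by simp
  qed
  have qnz: "q \<noteq> []"
  proof
    assume "q = []"
    then have "p = m" unfolding q_def using p m by (simp add: univ_poly_zero flip: UP.r_right_minus_eq)
    then have "eval m \<zero> \<noteq> \<zero>" "N > 0" using p d degm by auto
    then show False using evm[of \<zero>] s by (simp add: nat_pow_zero)
  qed
  have "degree q \<le> sum d S"
  proof -
    have "degree (\<ominus>\<^bsub>poly_ring R\<^esub> m) = N"
      using univ_poly_a_inv_degree[OF carrier_is_subring m] degm by simp
    then show ?thesis using poly_add_degree[of p "\<ominus>\<^bsub>poly_ring R\<^esub> m"] p
      unfolding q_def a_minus_def by (simp add: univ_poly_add)
  qed
  \<comment> \<open>Since \<open>g\<close> has order \<open>r\<close>, the powers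
    \<open>g [^] j\<close> with \<open>j < r\<close> are distinct, so counting \<open>j\<close>
    amounts to counting roots of \<open>q\<close>.\<close>
  have sub: "(\<lambda>j. g [^] j) ` ?J \<subseteq> {x \<in> carrier R. eval q x = \<zero>}"
    using evq p(6) gR s by (auto simp: r_neg a_minus_def)
  have inj: "inj_on (\<lambda>j. g [^] j) ?J"
    using M.ord_inj[OF g] r by (auto simp: nat_pow_mult_of inj_on_def)
  have "card ?J = card ((\<lambda>j. g [^] j) ` ?J)" by (rule card_image[OF inj, symmetric])
  also have "\<dots> \<le> card {x \<in> carrier R. eval q x = \<zero>}"
    by (rule card_mono[OF card_roots_le_degree(1)[OF q qnz] sub])
  also have "\<dots> \<le> degree q" by (rule card_roots_le_degree(2)[OF q qnz])
  finally show ?thesis using \<open>degree q \<le> sum d S\<close> by simp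
qed

section \<open>Counting along progressions\<close>

lemma bij_betw_add_mod:
  assumes "N > (0::nat)" shows "bij_betw (\<lambda>c. (c + a) mod N) {..<N} {..<N}"
proof -
  have "inj_on (\<lambda>c. (c + a) mod N) {..<N}"
  proof (rule inj_onI)
    fix c d assume cd: "c \<in> {..<N}" "d \<in> {..<N}" "(c + a) mod N = (d + a) mod N"
    then have "int N dvd (int c + int a) - (int d + int a)"
      by (metis mod_eq_dvd_iff of_nat_add zmod_int)
    then have "int c mod int N = int d mod int N" by (simp add: mod_eq_dvd_iff)
    then show "c = d" using cd by simp
  qed
  moreover have "(\<lambda>c. (c + a) mod N) ` {..<N} \<subseteq> {..<N}" using assms by auto
  ultimately show ?thesis by (simp add: bij_betw_def endo_inj_surj)
qed

text \<open>Double counting: for each fixed \<open>j\<close>, the shift by \<open>k * j\<close>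
  permutes the residues modulo \<open>N\<close>, so every element of \<open>Y\<close> is hit by
  exactly one \<open>c\<close>.\<close>

lemma card_progression_average:
  assumes N: "N > (0::nat)" and Y: "Y \<subseteq> {..<N}"
  shows "r * card Y = (\<Sum>c<N. card {j. j < r \<and> (c + k * j) mod N \<in> Y})"
proof -
  have eq: "card {j. j < (n::nat) \<and> P j} = (\<Sum>j<n. if P j then 1 else 0)" for P n
    by (simp add: sum.If_cases Int_def conj_commute)
  have "(\<Sum>c<N. card {j. j < r \<and> (c + k * j) mod N \<in> Y}) = (\<Sum>c<N. \<Sum>j<r. if (c + k * j) mod N \<in> Y then 1 else 0)"
    by (simp add: eq)
  also have "\<dots> = (\<Sum>j<r. \<Sum>c<N. if (c + k * j) mod N \<in> Y then 1 else 0)" by (rule sum.swap)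
  also have "\<dots> = (\<Sum>j<r. \<Sum>c<N. if c \<in> Y then 1 else 0)"
    by (intro sum.cong refl sum.reindex_bij_betw[OF bij_betw_add_mod[OF N], of "\<lambda>c. if c \<in> Y then 1 else 0"])
  also have "(\<Sum>c<N. if c \<in> Y then 1 else 0) = card Y"
    using Y by (simp add: sum.If_cases Int_absorb1)
  finally show ?thesis by simp
qed

section \<open>Products of powers and a common generator\<close>

lemma (in comm_monoid) finprod_nat_pow:
  assumes "f \<in> A \<rightarrow> carrier G"
  shows "(\<Otimes>i\<in>A. f i [^] (n::nat)) = finprod G f A [^] n"
proof (induction n)
  case (Suc n)
  then show ?case using assms by (simp add: finprod_multf Pi_iff)
qed simp

text \<open>Some \<open>g\<close> has as its order the exponent of the \<open>r\<close>-torsion,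
  which is \<open>r\<close> because every \<open>lam i\<close> lies there. Its \<open>r\<close>
  distinct powers are roots of \<open>X ^ r - 1\<close>, hence all the roots, and each
  \<open>lam i\<close> is one of them.\<close>

lemma (in field) obtain_common_generator:
  assumes S: "finite S" and lam: "\<And>i. i \<in> S \<Longrightarrow> lam i \<in> carrier (mult_of R)"
    and ord: "\<And>i. i \<in> S \<Longrightarrow> group.ord (mult_of R) (lam i) > 0"
    and r: "r = Lcm ((\<lambda>i. group.ord (mult_of R) (lam i)) ` S)"
  obtains g a where "g \<in> carrier (mult_of R)" "group.ord (mult_of R) g = r" "r > 0" "\<And>i. i \<in> S \<Longrightarrow> lam i = g [^] (a i :: nat)"
proof -
  interpret M: comm_group "mult_of R" by (rule comm_group_mult_of)
  have "0 \<notin> (\<lambda>i. M.ord (lam i)) ` S" using ord by force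
  then have r0: "r > 0" unfolding r using S by (intro Nat.gr0I) (simp add: Lcm_0_iff)
  obtain g where g: "g \<in> carrier (mult_of R)" "M.ord g > 0" "g [^]\<^bsub>mult_of R\<^esub> r = \<one>\<^bsub>mult_of R\<^esub>"
    and gx: "\<And>x. x \<in> carrier (mult_of R) \<Longrightarrow> x [^]\<^bsub>mult_of R\<^esub> r = \<one>\<^bsub>mult_of R\<^esub> \<Longrightarrow> M.ord x dvd M.ord g"
    using M.exists_ord_exponent[OF r0] by blast
  have lr: "M.ord (lam i) dvd r" if "i \<in> S" for i using that by (simp add: r)
  have lr': "lam i [^]\<^bsub>mult_of R\<^esub> r = \<one>\<^bsub>mult_of R\<^esub>" if "i \<in> S" for i
    using M.pow_eq_id[OF lam[OF that]] lr[OF that] by blast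
  have "M.ord g dvd r" using M.pow_eq_id[OF g(1)] g(3) by blast
  moreover have "r dvd M.ord g"
    unfolding r using gx[OF lam lr'] by (intro Lcm_least) auto
  ultimately have og: "M.ord g = r" by (rule dvd_antisym)
  define q where "q = poly_add (monom \<one> r) [\<ominus> \<one>]"
  have mon: "polynomial (carrier R) (monom \<one> r)" "polynomial (carrier R) [\<ominus> \<one>]" "set (monom \<one> r) \<subseteq> carrier R"
    using monom_is_polynomial[OF carrier_is_subring, of \<one> r] by (auto simp: monom_def polynomial_def)
  have q: "q \<in> carrier (poly_ring R)"
    unfolding q_def using poly_add_closed[OF carrier_is_subring mon(1,2)] by (simp add: univ_poly_carrier)
  have dq: "degree q = r" unfolding q_def
    using poly_add_degree_eq[OF carrier_is_subring mon(1,2)] r0 by (simp add: monom_def)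
  have qnz: "q \<noteq> []" using dq r0 by auto
  have evq: "eval q x = x [^] r \<ominus> \<one>" if "x \<in> carrier R" for x
    unfolding q_def using that mon by (subst eval_poly_add) (auto simp: eval_monom a_minus_def)
  define Z where "Z = {x \<in> carrier R. eval q x = \<zero>}"
  have Z: "finite Z" "card Z \<le> r"
    unfolding Z_def using card_roots_le_degree[OF q qnz] dq by auto
  have inj: "inj_on (\<lambda>j. g [^] j) {..<r}"
    using M.ord_inj[OF g(1)] r0 by (auto simp: nat_pow_mult_of inj_on_def og)
  have "(\<lambda>j. g [^] j) ` {..<r} \<subseteq> Z"
  proof clarsimp
    fix j :: nat
    have "(g [^] j) [^] r = (g [^] r) [^] j" using g by (simp add: nat_pow_pow mult.commute)
    then have "(g [^] j) [^] r = \<one>" using g by (simp add: nat_pow_mult_of)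
    then show "g [^] j \<in> Z" using g evq[of "g [^] j"] by (simp add: Z_def)
  qed
  moreover have "card ((\<lambda>j. g [^] j) ` {..<r}) = r" using inj by (simp add: card_image)
  \<comment> \<open>A subset of \<open>Z\<close> with \<open>r\<close> elements is all of
    \<open>Z\<close>, since \<open>Z\<close> has at most \<open>r\<close>.\<close>
  ultimately have Zeq: "(\<lambda>j. g [^] j) ` {..<r} = Z" using Z by (intro card_seteq) auto
  have "lam i \<in> Z" if "i \<in> S" for i
    using lam[OF that] lr'[OF that] evq[of "lam i"] by (simp add: Z_def nat_pow_mult_of)
  then have "\<exists>j. lam i = g [^] (j::nat)" if "i \<in> S" for i using that Zeq by blast
  then obtain a where "\<And>i. i \<in> S \<Longrightarrow> lam i = g [^] (a i :: nat)" by metis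
  then show thesis using that g(1) og r0 by blast
qed

text \<open>Averaging over the progressions \<open>c + k j\<close>, where \<open>k\<close> comes from Dirichlet's theorem applied to the
  discrete logarithms of the \<open>lam i\<close>.\<close>

lemma (in field) card_product_eq_le:
  assumes S: "finite S" and lam: "\<And>i. i \<in> S \<Longrightarrow> lam i \<in> carrier (mult_of R)"
    and N: "N > 0" "\<And>i. i \<in> S \<Longrightarrow> lam i [^] N = \<one>"
    and r: "r = Lcm ((\<lambda>i. group.ord (mult_of R) (lam i)) ` S)"
    and m: "m ^ card S < r" "r \<le> m * M"
    and alpha: "\<And>i. i \<in> S \<Longrightarrow> \<alpha> i \<in> carrier R - {\<zero>}" and s: "s \<in> carrier R" "s \<noteq> \<zero>"
  shows "r * card {y. y < N \<and> (\<Otimes>i\<in>S. \<alpha> i \<oplus> lam i [^] y) = s} \<le> N * (card S * M)" (is "_ * card ?Y \<le> _")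
proof -
  interpret M: comm_group "mult_of R" by (rule comm_group_mult_of)
  have lamc: "lam i \<in> carrier R" "lam i \<noteq> \<zero>" if "i \<in> S" for i using lam[OF that] by auto
  have ordN: "M.ord (lam i) dvd N" if "i \<in> S" for i
    using M.pow_eq_id[OF lam[OF that], of N] N(2)[OF that] by (simp add: nat_pow_mult_of)
  have ordpos: "M.ord (lam i) > 0" if "i \<in> S" for i
    using ordN[OF that] N(1) by (auto intro: Nat.gr0I)
  obtain g a where g: "g \<in> carrier (mult_of R)" "M.ord g = r" "r > 0" and ga: "\<And>i. i \<in> S \<Longrightarrow> lam i = g [^] (a i :: nat)"
    using obtain_common_generator[OF S lam ordpos r] by blast
  have gc: "g \<in> carrier R" using g by simp
  have gpow: "g [^] n = \<one> \<longleftrightarrow> r dvd n" for n :: nat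
    using M.pow_eq_id[OF g(1), of n] g(2) by (simp add: nat_pow_mult_of)
  obtain k e where k: "0 < k" "k < r" and e: "\<And>i. i \<in> S \<Longrightarrow> int (k * a i) mod int r = e i mod int r"
      "\<And>i. i \<in> S \<Longrightarrow> \<bar>e i\<bar> < int M"
    using dirichlet_simultaneous[OF S m] by blast
  define d where "d i = nat \<bar>e i\<bar>" for i
  define h where "h i = lam i [^] k" for i
  have h_eq: "h i = g [^] (k * a i)" if "i \<in> S" for i
    using ga[OF that] gc by (simp add: h_def nat_pow_pow mult.commute)
  \<comment> \<open>The sign of \<open>e i\<close> decides which alternative holds:
    \<open>h i\<close> equals \<open>g\<close> raised to the signed exponent \<open>e i\<close>, and
    \<open>d i\<close> is its absolute value.\<close>
  have hd: "h i = g [^] d i \<or> h i \<otimes> g [^] d i = \<one>" if i: "i \<in> S" for i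
  proof (cases "e i \<ge> 0")
    case True
    then have "int (k * a i) mod int r = int (d i) mod int r" using e(1)[OF i] by (simp add: d_def)
    then have "(k * a i) mod r = d i mod r" by (simp only: of_nat_eq_iff flip: zmod_int)
    moreover have "g [^] n = g [^] (n mod r)" for n :: nat
    proof -
      have "g [^] n = g [^] (r * (n div r)) \<otimes> g [^] (n mod r)"
        using gc by (simp add: nat_pow_mult)
      also have "g [^] (r * (n div r)) = \<one>" by (simp add: gpow)
      finally show ?thesis using gc by simp
    qed
    ultimately show ?thesis using h_eq[OF i] by metis
  next
    case False
    have "int r dvd int (k * a i) - e i" using e(1)[OF i] by (simp add: mod_eq_dvd_iff)
    also have "int (k * a i) - e i = int (k * a i + d i)" using False by (simp add: d_def)
    finally have "r dvd k * a i + d i" by (simp only: of_nat_dvd_iff)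
    then show ?thesis using h_eq[OF i] gpow[of "k * a i + d i"] gc by (simp add: nat_pow_mult)
  qed
  \<comment> \<open>If all exponents vanished, \<open>k\<close> would be a common multiple of the
    orders, hence of \<open>r\<close>, contradicting \<open>0 < k < r\<close>. The root count needs
    this positive degree.\<close>
  have "sum d S > 0"
  proof (rule Nat.gr0I)
    assume "sum d S = 0"
    then have "h i = \<one>" if "i \<in> S" for i using hd[OF that] S that lamc by (auto simp: h_def)
    then have "M.ord (lam i) dvd k" if "i \<in> S" for i
      using M.pow_eq_id[OF lam[OF that], of k] that by (simp add: h_def nat_pow_mult_of)
    then have "r dvd k" unfolding r by (intro Lcm_least) auto
    then show False using k by (simp add: nat_dvd_not_less)
  qed
  have dM: "sum d S \<le> card S * M"
    using e(2) by (intro sum_bounded_above[where 'a = nat, simplified]) (force simp: d_def)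
  \<comment> \<open>Along a progression with step \<open>k\<close>, the powers of
    \<open>lam i\<close> become a constant times \<open>h i [^] j\<close>, which is the situation of
    twisted binomials. Reduction modulo \<open>N\<close> is harmless because
    \<open>lam i [^] N = \<one>\<close>.\<close>
  have each: "card {j. j < r \<and> (c + k * j) mod N \<in> ?Y} \<le> card S * M" for c
  proof -
    have pw: "lam i [^] ((c + k * j) mod N) = lam i [^] c \<otimes> h i [^] j" if "i \<in> S" for i j
    proof -
      have "lam i [^] (c + k * j) = lam i [^] (N * ((c + k * j) div N)) \<otimes> lam i [^] ((c + k * j) mod N)"
        using lamc[OF that] by (simp add: nat_pow_mult)
      also have "lam i [^] (N * ((c + k * j) div N)) = \<one>"
        using lamc[OF that] N(2)[OF that] by (simp flip: nat_pow_pow)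
      finally show ?thesis using lamc[OF that] by (simp add: h_def nat_pow_pow nat_pow_mult)
    qed
    have "(\<Otimes>i\<in>S. \<alpha> i \<oplus> lam i [^] ((c + k * j) mod N)) = (\<Otimes>i\<in>S. \<alpha> i \<oplus> lam i [^] c \<otimes> h i [^] j)" for j
      using pw alpha lamc by (intro finprod_cong) (auto simp: h_def simp_implies_def)
    then have "{j. j < r \<and> (c + k * j) mod N \<in> ?Y} = {j. j < r \<and> (\<Otimes>i\<in>S. \<alpha> i \<oplus> lam i [^] c \<otimes> h i [^] j) = s}"
      using N(1) by auto
    moreover have "card {j. j < r \<and> (\<Otimes>i\<in>S. \<alpha> i \<oplus> lam i [^] c \<otimes> h i [^] j) = s} \<le> sum d S"
    proof (rule card_twisted_binomials_le[OF S g(1) g(2)[symmetric] g(3) alpha _ _ hd \<open>sum d S > 0\<close> s])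
      show "lam i [^] c \<in> carrier R - {\<zero>}" if "i \<in> S" for i
        using mult_of.nat_pow_closed[OF lam[OF that], of c] by (simp add: nat_pow_mult_of)
      show "h i \<in> carrier R" if "i \<in> S" for i using lamc[OF that] by (simp add: h_def)
    qed
    ultimately show ?thesis using dM by simp
  qed
  have "?Y \<subseteq> {..<N}" by auto
  then have "r * card ?Y = (\<Sum>c<N. card {j. j < r \<and> (c + k * j) mod N \<in> ?Y})"
    by (rule card_progression_average[OF N(1)])
  also have "\<dots> \<le> (\<Sum>c<N. card S * M)" by (intro sum_mono each)
  finally show ?thesis by simp
qed

section \<open>Counting pairs of exponents\<close>

lemma card_dvd_below:
  assumes "m dvd N" "N > (0::nat)"
  shows "card {z. z < N \<and> m dvd z} = N div m"
proof -
  have m: "m > 0" using assms by (auto intro: Nat.gr0I)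
  have "{z. z < N \<and> m dvd z} = (\<lambda>j. m * j) ` {..<N div m}"
  proof (intro equalityI subsetI)
    fix z assume "z \<in> {z. z < N \<and> m dvd z}"
    then obtain j where "z = m * j" "m * j < m * (N div m)" using assms by (auto elim: dvdE)
    then show "z \<in> (\<lambda>j. m * j) ` {..<N div m}" by auto
  next
    fix z assume "z \<in> (\<lambda>j. m * j) ` {..<N div m}"
    then obtain j where j: "z = m * j" "j < N div m" by auto
    then have "m * j < m * (N div m)" using m by simp
    then show "z \<in> {z. z < N \<and> m dvd z}" using j assms by simp
  qed
  then show ?thesis using m by (simp add: card_image inj_on_def)
qed

text \<open>The first summand counts all \<open>y\<close> for those \<open>z\<close> at which some
  \<open>1 - lam i ^ z\<close> vanishes. For every other \<open>z\<close>, the product over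
  \<open>S\<close> of \<open>1 - lam i ^ z + lam i ^ y\<close> is a power of the product of the
  \<open>lam i\<close>, so it has at most \<open>t\<close> values, and
  \<open>card_product_eq_le\<close> bounds the \<open>y\<close> for each value.\<close>

lemma (in field) card_pairs_le:
  assumes S: "finite S" and lam: "\<And>i. i \<in> S \<Longrightarrow> lam i \<in> carrier (mult_of R)"
    and N: "N > 0" "\<And>i. i \<in> S \<Longrightarrow> lam i [^] N = \<one>"
    and r: "r = Lcm ((\<lambda>i. group.ord (mult_of R) (lam i)) ` S)"
    and m: "m ^ card S < r" "r \<le> m * M"
    and t: "t = group.ord (mult_of R) (finprod R lam S)"
  shows "r * card {(y, z). y < N \<and> z < N \<and> (\<exists>w::nat. \<forall>i\<in>S. \<one> \<oplus> lam i [^] y = lam i [^] z \<oplus> lam i [^] w)}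
     \<le> r * N * (\<Sum>i\<in>S. N div group.ord (mult_of R) (lam i)) + N * t * N * (card S * M)" (is "_ * card ?W \<le> _")
proof -
  interpret M: comm_group "mult_of R" by (rule comm_group_mult_of)
  have lamc: "lam i \<in> carrier R" "lam i \<noteq> \<zero>" if "i \<in> S" for i using lam[OF that] by auto
  have lamF: "lam \<in> S \<rightarrow> carrier R" using lamc by auto
  have ordN: "M.ord (lam i) dvd N" if "i \<in> S" for i
    using M.pow_eq_id[OF lam[OF that], of N] N(2)[OF that] by (simp add: nat_pow_mult_of)
  define p where "p = finprod R lam S"
  define P where "P = (\<lambda>w. p [^] w) ` {..<t}"
  have pN: "p [^] N = \<one>"
    unfolding p_def finprod_nat_pow[OF lamF, symmetric] using N(2) by (intro finprod_one_eqI)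
  have pc: "p \<in> carrier R" unfolding p_def by (rule finprod_closed[OF lamF])
  have p: "p \<in> carrier (mult_of R)"
    using pc pN N(1) by (auto simp: nat_pow_zero)
  have "t dvd N" using M.pow_eq_id[OF p, of N] pN unfolding t p_def by (simp add: nat_pow_mult_of)
  then have t0: "t > 0" using N(1) by (auto intro: Nat.gr0I)
  have pt: "p [^] t = \<one>" using M.pow_eq_id[OF p, of t] t p_def by (simp add: nat_pow_mult_of)
  have pP: "p [^] w \<in> P" for w :: nat
  proof -
    have "p [^] w = p [^] (t * (w div t)) \<otimes> p [^] (w mod t)"
      using pc by (simp add: nat_pow_mult)
    also have "p [^] (t * (w div t)) = \<one>" using pt pc by (simp flip: nat_pow_pow)
    finally show ?thesis using t0 pc by (auto simp: P_def)
  qed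
  have Pnz: "s \<in> carrier R" "s \<noteq> \<zero>" if sP: "s \<in> P" for s
  proof -
    obtain w where "s = p [^] (w::nat)" using sP by (auto simp: P_def)
    then show "s \<in> carrier R" "s \<noteq> \<zero>"
      using mult_of.nat_pow_closed[OF p, of w] by (auto simp: nat_pow_mult_of)
  qed
  have cardP: "card P \<le> t" "finite P" unfolding P_def using card_image_le[of "{..<t}"] by auto
  \<comment> \<open>\<open>B\<close> holds the exceptional \<open>z\<close>, where a binomial
    degenerates; \<open>Y z s\<close> is the fibre of the product over the value
    \<open>s\<close>.\<close>
  define B where "B = {z. z < N \<and> (\<exists>i\<in>S. lam i [^] z = \<one>)}"
  define Y where "Y z s = {y. y < N \<and> (\<Otimes>i\<in>S. (\<one> \<ominus> lam i [^] z) \<oplus> lam i [^] y) = s}" for z :: nat and s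
  have finY: "finite (Y z s)" for z s by (simp add: Y_def)
  have finB: "finite B" by (simp add: B_def)
  have "B = (\<Union>i\<in>S. {z. z < N \<and> M.ord (lam i) dvd z})"
    unfolding B_def using M.pow_eq_id[OF lam] by (auto simp: nat_pow_mult_of)
  then have "card B \<le> (\<Sum>i\<in>S. card {z. z < N \<and> M.ord (lam i) dvd z})"
    using card_UN_le[OF S] by simp
  also have "\<dots> = (\<Sum>i\<in>S. N div M.ord (lam i))"
    using card_dvd_below[OF ordN N(1)] by (intro sum.cong) auto
  finally have cardB: "card B \<le> (\<Sum>i\<in>S. N div M.ord (lam i))" .
  have sub: "?W \<subseteq> ({..<N} \<times> B) \<union> (\<Union>z\<in>{..<N} - B. \<Union>s\<in>P. Y z s \<times> {z})"
  proof
    fix x assume "x \<in> ?W"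
    then obtain y z w where x: "x = (y, z)" and yz: "y < N" "z < N"
      and w: "\<And>i. i \<in> S \<Longrightarrow> \<one> \<oplus> lam i [^] y = lam i [^] z \<oplus> lam i [^] (w::nat)" by blast
    show "x \<in> ({..<N} \<times> B) \<union> (\<Union>z\<in>{..<N} - B. \<Union>s\<in>P. Y z s \<times> {z})"
    proof (cases "z \<in> B")
      case True
      then show ?thesis using x yz by simp
    next
      case False
      then have zB: "z \<in> {..<N} - B" using yz by simp
      have "(\<one> \<ominus> lam i [^] z) \<oplus> lam i [^] y = lam i [^] w" if i: "i \<in> S" for i
      proof -
        have "(\<one> \<ominus> lam i [^] z) \<oplus> lam i [^] y = (\<one> \<oplus> lam i [^] y) \<ominus> lam i [^] z"
          using lamc[OF i] by (simp add: a_minus_def a_ac)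
        also have "\<dots> = (lam i [^] z \<oplus> lam i [^] w) \<ominus> lam i [^] z" using w[OF i] by simp
        also have "\<dots> = lam i [^] w" using lamc[OF i] by (simp add: a_minus_def a_ac r_neg r_neg2 r_neg1)
        finally show ?thesis .
      qed
      then have "(\<Otimes>i\<in>S. (\<one> \<ominus> lam i [^] z) \<oplus> lam i [^] y) = (\<Otimes>i\<in>S. lam i [^] w)"
        using lamc by (intro finprod_cong) (auto simp: simp_implies_def)
      also have "\<dots> = p [^] w" unfolding p_def by (rule finprod_nat_pow[OF lamF])
      finally have "y \<in> Y z (p [^] w)" using yz by (simp add: Y_def)
      then show ?thesis using x zB pP[of w] by blast
    qed
  qed
  have rY: "r * card (Y z s) \<le> N * (card S * M)" if z: "z \<in> {..<N} - B" and s: "s \<in> P" for z s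
  proof -
    have al: "\<one> \<ominus> lam i [^] z \<in> carrier R - {\<zero>}" if "i \<in> S" for i
      using z that lamc[OF that] by (auto simp: B_def)
    show ?thesis
      unfolding Y_def by (rule card_product_eq_le[OF S lam N r m al Pnz[OF s]])
  qed
  have finU: "finite (({..<N} \<times> B) \<union> (\<Union>z\<in>{..<N} - B. \<Union>s\<in>P. Y z s \<times> {z}))"
    using finY finB cardP(2) by auto
  have "card ?W \<le> card (({..<N} \<times> B) \<union> (\<Union>z\<in>{..<N} - B. \<Union>s\<in>P. Y z s \<times> {z}))"
    by (rule card_mono[OF finU sub])
  also have "\<dots> \<le> card ({..<N} \<times> B) + card (\<Union>z\<in>{..<N} - B. \<Union>s\<in>P. Y z s \<times> {z})"
    by (rule card_Un_le)
  also have "card (\<Union>z\<in>{..<N} - B. \<Union>s\<in>P. Y z s \<times> {z}) \<le> (\<Sum>z\<in>{..<N} - B. card (\<Union>s\<in>P. Y z s \<times> {z}))"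
    by (rule card_UN_le) simp
  also have "\<dots> \<le> (\<Sum>z\<in>{..<N} - B. \<Sum>s\<in>P. card (Y z s \<times> {z}))"
    by (intro sum_mono card_UN_le cardP)
  finally have "card ?W \<le> N * card B + (\<Sum>z\<in>{..<N} - B. \<Sum>s\<in>P. card (Y z s))"
    by (simp add: card_cartesian_product)
  then have "r * card ?W \<le> r * (N * card B) + (\<Sum>z\<in>{..<N} - B. \<Sum>s\<in>P. r * card (Y z s))"
    unfolding sum_distrib_left[symmetric] distrib_left[symmetric] by (rule mult_le_mono2)
  also have "(\<Sum>z\<in>{..<N} - B. \<Sum>s\<in>P. r * card (Y z s)) \<le> (\<Sum>z\<in>{..<N} - B. \<Sum>s\<in>P. N * (card S * M))"
    by (intro sum_mono rY)
  also have "\<dots> = card ({..<N} - B) * (card P * (N * (card S * M)))" by simp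
  also have "\<dots> \<le> N * (t * (N * (card S * M)))"
    using cardP card_mono[of "{..<N}" "{..<N} - B"] by (intro mult_le_mono) auto
  also have "r * (N * card B) \<le> r * (N * (\<Sum>i\<in>S. N div M.ord (lam i)))" using cardB by simp
  finally show ?thesis by (simp add: mult.assoc)
qed

section \<open>Choice of parameters and the real-valued bound\<close>

text \<open>Take the largest \<open>m\<close> with \<open>m ^ q < r\<close>. Then
  \<open>r ^ (1/q) \<le> m + 1 \<le> 2 m\<close>, and \<open>M = r div m + 1\<close> is at most
  \<open>2 r / m\<close>; the two factors 2 give the constant 4.\<close>

lemma exists_dirichlet_parameters:
  assumes r: "r > (1::nat)" and q: "q > 0"
  shows "\<exists>m M. m ^ q < r \<and> r \<le> m * M \<and> real M \<le> 4 * (real r * real r powr (- 1 / real q))"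
proof -
  have bound: "m ^ q < r \<Longrightarrow> m < r" for m :: nat
    by (metis One_nat_def Suc_leI q le_less_trans linorder_not_less not_gr0 power_0_left self_le_power zero_le)
  then have "\<forall>m. m ^ q < r \<longrightarrow> m < r" by blast
  moreover have "1 ^ q < r" using r by simp
  ultimately have "\<exists>m. m ^ q < r \<and> (\<forall>k. k ^ q < r \<longrightarrow> k \<le> m)"
    using Lattices_Big.ex_has_greatest_nat[of "\<lambda>m. m ^ q < r" 1 "\<lambda>m. m" r] by blast
  then obtain m where m: "m ^ q < r" and mm: "\<And>k. k ^ q < r \<Longrightarrow> k \<le> m" by blast
  have m1: "m \<ge> 1" using mm[of 1] r by simp
  have "r \<le> (m + 1) ^ q" using mm[of "m + 1"] by (cases "(m + 1) ^ q < r") auto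
  then have "real r \<le> (real m + 1) ^ q" by (metis of_nat_1 of_nat_add of_nat_le_iff of_nat_power)
  then have "real r powr (1 / real q) \<le> ((real m + 1) ^ q) powr (1 / real q)"
    by (intro powr_mono2) auto
  also have "\<dots> = real m + 1"
    using q by (simp add: powr_powr flip: powr_realpow)
  finally have rt: "real r powr (1 / real q) \<le> 2 * real m" using m1 by simp
  define M where "M = r div m + 1"
  have "r = m * (r div m) + r mod m" by simp
  also have "\<dots> \<le> m * (r div m) + m" using m1 by (intro add_left_mono less_imp_le mod_less_divisor) auto
  finally have rM: "r \<le> m * M" by (simp add: M_def)
  have "real M \<le> real r / real m + 1" unfolding M_def by (simp add: of_nat_div_le_of_nat)
  also have "1 \<le> real r / real m" using bound[OF m] m1 by simp
  finally have M2: "real M \<le> 2 * (real r / real m)" by simp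
  have "real r powr (- 1 / real q) = 1 / real r powr (1 / real q)"
    by (simp add: powr_minus_divide)
  moreover have "1 / real m \<le> 2 / real r powr (1 / real q)"
    using rt m1 r by (simp add: field_simps)
  ultimately have "1 / real m \<le> 2 * real r powr (- 1 / real q)" by simp
  then have "real r * (1 / real m) \<le> real r * (2 * real r powr (- 1 / real q))"
    by (intro mult_left_mono) auto
  then have "real M \<le> 4 * (real r * real r powr (- 1 / real q))" using M2 by simp
  then show ?thesis using m rM by blast
qed

lemma (in field) card_pairs_bound:
  assumes S: "finite S" "S \<noteq> {}" and lam: "\<And>i. i \<in> S \<Longrightarrow> lam i \<in> carrier (mult_of R)"
    and N: "N > 0" "\<And>i. i \<in> S \<Longrightarrow> lam i [^] N = \<one>"
    and r: "r = Lcm ((\<lambda>i. group.ord (mult_of R) (lam i)) ` S)"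
    and t: "t = group.ord (mult_of R) (finprod R lam S)"
  shows "real (card {(y, z). y < N \<and> z < N \<and> (\<exists>w::nat. \<forall>i\<in>S. \<one> \<oplus> lam i [^] y = lam i [^] z \<oplus> lam i [^] w)})
     \<le> real N ^ 2 * ((\<Sum>i\<in>S. 1 / real (group.ord (mult_of R) (lam i)))
          + 4 * real (card S) * real t * real r powr (- 1 / real (card S)))" (is "real (card ?W) \<le> _")
proof -
  interpret M: comm_group "mult_of R" by (rule comm_group_mult_of)
  have ordN: "M.ord (lam i) dvd N" if "i \<in> S" for i
    using M.pow_eq_id[OF lam[OF that], of N] N(2)[OF that] by (simp add: nat_pow_mult_of)
  have ordpos: "M.ord (lam i) > 0" if "i \<in> S" for i
    using ordN[OF that] N(1) by (auto intro: Nat.gr0I)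
  have rN: "r dvd N" unfolding r using ordN by (intro Lcm_least) auto
  then have r0: "r > 0" using N(1) by (auto intro: Nat.gr0I)
  have q: "card S > 0" using S by (simp add: card_gt_0_iff)
  show ?thesis
  proof (cases "r = 1")
    \<comment> \<open>All orders are 1 here, so the sum of reciprocals equals \<open>card S\<close>,
      which is at least 1, and the trivial bound \<open>N ^ 2\<close> suffices. The parameters
      \<open>m\<close> and \<open>M\<close> exist only for \<open>r > 1\<close>.\<close>
    case True
    have "M.ord (lam i) = 1" if "i \<in> S" for i
    proof -
      have "M.ord (lam i) dvd r" unfolding r using that by simp
      then show ?thesis using True by simp
    qed
    then have sum: "(\<Sum>i\<in>S. 1 / real (M.ord (lam i))) = real (card S)" by simp
    have "?W \<subseteq> {..<N} \<times> {..<N}" by auto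
    then have "card ?W \<le> card ({..<N} \<times> {..<N})" by (intro card_mono) auto
    then have "real (card ?W) \<le> real N ^ 2 * 1"
      by (simp add: card_cartesian_product power2_eq_square flip: of_nat_mult)
    also have "\<dots> \<le> real N ^ 2 * ((\<Sum>i\<in>S. 1 / real (M.ord (lam i))) + 4 * real (card S) * real t * real r powr (- 1 / real (card S)))"
      unfolding sum using q by (intro mult_left_mono add_increasing2) (auto simp: Suc_le_eq)
    finally show ?thesis .
  next
    case False
    then have "r > 1" using r0 by simp
    then obtain m M where m: "m ^ card S < r" "r \<le> m * M" "real M \<le> 4 * (real r * real r powr (- 1 / real (card S)))"
      using exists_dirichlet_parameters[OF _ q] by blast
    have "real (r * card ?W) \<le> real (r * N * (\<Sum>i\<in>S. N div M.ord (lam i)) + N * t * N * (card S * M))"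
      using card_pairs_le[OF S(1) lam N r m(1,2) t] by (simp only: of_nat_le_iff)
    also have "\<dots> = real r * real N * (\<Sum>i\<in>S. real N / real (M.ord (lam i))) + real N * real t * real N * real (card S) * real M"
      using ordN by (simp add: real_of_nat_div)
    also have "\<dots> \<le> real r * real N * (\<Sum>i\<in>S. real N / real (M.ord (lam i)))
        + real N * real t * real N * real (card S) * (4 * (real r * real r powr (- 1 / real (card S))))"
      by (intro add_left_mono mult_left_mono m) auto
    also have "(\<Sum>i\<in>S. real N / real (M.ord (lam i))) = real N * (\<Sum>i\<in>S. 1 / real (M.ord (lam i)))"
      by (simp add: sum_distrib_left)
    finally have "real r * real (card ?W) \<le> real r * (real N ^ 2 * ((\<Sum>i\<in>S. 1 / real (M.ord (lam i)))
          + 4 * real (card S) * real t * real r powr (- 1 / real (card S))))"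
      by (simp add: algebra_simps power2_eq_square)
    then show ?thesis using r0 by simp
  qed
qed

section \<open>Matrices over a ring record\<close>

text \<open>Induction on \<open>I\<close>: the functions on \<open>insert x I\<close> are
  partitioned into the sets \<open>U k\<close> according to their value \<open>k\<close> at
  \<open>x\<close>, and \<open>f x k\<close> is pulled out of each part.\<close>

lemma (in cring) finprod_finsum_distrib:
  assumes "finite I" "finite K" "\<And>i k. i \<in> I \<Longrightarrow> k \<in> K \<Longrightarrow> f i k \<in> carrier R"
  shows "(\<Otimes>i\<in>I. \<Oplus>k\<in>K. f i k) = (\<Oplus>\<phi>\<in>I \<rightarrow>\<^sub>E K. \<Otimes>i\<in>I. f i (\<phi> i))"
  using assms
proof (induction I rule: finite_induct)
  case empty
  then show ?case by simp
next
  case (insert x I)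
  define U where "U k = (\<lambda>\<phi>. \<phi>(x := k)) ` (I \<rightarrow>\<^sub>E K)" for k
  have cl: "(\<Otimes>i\<in>insert x I. f i (\<phi> i)) \<in> carrier R" if "\<phi> \<in> insert x I \<rightarrow>\<^sub>E K" for \<phi>
    using that insert.prems by (intro finprod_closed) auto
  have cl': "(\<Otimes>i\<in>I. f i (\<phi> i)) \<in> carrier R" if "\<phi> \<in> I \<rightarrow>\<^sub>E K" for \<phi>
    using that insert.prems by (intro finprod_closed) auto
  have Un: "(insert x I \<rightarrow>\<^sub>E K) = (\<Union>k\<in>K. U k)"
    unfolding PiE_insert_eq U_def by auto
  have finU: "finite (U k)" for k using insert by (auto simp: U_def intro!: finite_PiE)
  have disj: "pairwise (\<lambda>i j. disjnt (U i) (U j)) K"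
    by (auto simp: pairwise_def disjnt_def U_def fun_upd_def fun_eq_iff) metis
  have inj: "inj_on (\<lambda>\<phi>. \<phi>(x := k)) (I \<rightarrow>\<^sub>E K)" for k
  proof (rule inj_onI)
    fix \<phi> \<psi> assume "\<phi> \<in> I \<rightarrow>\<^sub>E K" "\<psi> \<in> I \<rightarrow>\<^sub>E K" "\<phi>(x := k) = \<psi>(x := k)"
    then show "\<phi> = \<psi>"
      using insert.hyps(2) by (metis PiE_arb fun_upd_triv fun_upd_upd)
  qed
  have "(\<Oplus>\<phi>\<in>insert x I \<rightarrow>\<^sub>E K. \<Otimes>i\<in>insert x I. f i (\<phi> i)) = (\<Oplus>k\<in>K. \<Oplus>\<phi>\<in>U k. \<Otimes>i\<in>insert x I. f i (\<phi> i))"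
    unfolding Un using finU disj insert.prems(1) cl by (intro add.finprod_UN_disjoint) (auto simp: Un)
  also have "\<dots> = (\<Oplus>k\<in>K. f x k \<otimes> (\<Oplus>\<phi>\<in>I \<rightarrow>\<^sub>E K. \<Otimes>i\<in>I. f i (\<phi> i)))"
  proof (intro finsum_cong' refl)
    fix k assume k: "k \<in> K"
    have sub: "\<phi>(x := k) \<in> insert x I \<rightarrow>\<^sub>E K" if "\<phi> \<in> I \<rightarrow>\<^sub>E K" for \<phi>
      using that k by (auto simp: PiE_iff extensional_def)
    have "(\<Oplus>\<phi>\<in>U k. \<Otimes>i\<in>insert x I. f i (\<phi> i)) = (\<Oplus>\<phi>\<in>I \<rightarrow>\<^sub>E K. \<Otimes>i\<in>insert x I. f i ((\<phi>(x := k)) i))"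
    proof -
      have Uk: "(\<lambda>\<phi>. \<Otimes>i\<in>insert x I. f i (\<phi> i)) \<in> U k \<rightarrow> carrier R"
        using cl k unfolding Un by (intro Pi_I) blast
      show ?thesis unfolding U_def
        by (rule add.finprod_reindex[of "\<lambda>\<phi>. \<Otimes>i\<in>insert x I. f i (\<phi> i)", OF Uk[unfolded U_def] inj])
    qed
    also have "\<dots> = (\<Oplus>\<phi>\<in>I \<rightarrow>\<^sub>E K. f x k \<otimes> (\<Otimes>i\<in>I. f i (\<phi> i)))"
    proof (intro finsum_cong' refl)
      fix \<phi> assume phi: "\<phi> \<in> I \<rightarrow>\<^sub>E K"
      have "(\<Otimes>i\<in>insert x I. f i ((\<phi>(x := k)) i)) = f x ((\<phi>(x := k)) x) \<otimes> (\<Otimes>i\<in>I. f i ((\<phi>(x := k)) i))"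
        using insert sub[OF phi] by (intro finprod_insert) (auto simp: PiE_iff)
      also have "(\<Otimes>i\<in>I. f i ((\<phi>(x := k)) i)) = (\<Otimes>i\<in>I. f i (\<phi> i))"
        using insert phi by (intro finprod_cong') auto
      finally show "(\<Otimes>i\<in>insert x I. f i ((\<phi>(x := k)) i)) = f x k \<otimes> (\<Otimes>i\<in>I. f i (\<phi> i))" by simp
    qed (use cl' insert.prems k in auto)
    also have "\<dots> = f x k \<otimes> (\<Oplus>\<phi>\<in>I \<rightarrow>\<^sub>E K. \<Otimes>i\<in>I. f i (\<phi> i))"
      using insert k cl' by (intro finsum_rdistr[symmetric] finite_PiE) auto
    finally show "(\<Oplus>\<phi>\<in>U k. \<Otimes>i\<in>insert x I. f i (\<phi> i)) = f x k \<otimes> (\<Oplus>\<phi>\<in>I \<rightarrow>\<^sub>E K. \<Otimes>i\<in>I. f i (\<phi> i))" .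
  qed (use cl' insert.prems in \<open>auto intro!: finsum_closed\<close>)
  also have "\<dots> = (\<Oplus>k\<in>K. f x k) \<otimes> (\<Oplus>\<phi>\<in>I \<rightarrow>\<^sub>E K. \<Otimes>i\<in>I. f i (\<phi> i))"
    using insert.prems cl' by (intro finsum_ldistr[symmetric]) (auto intro!: finsum_closed)
  also have "\<dots> = (\<Oplus>k\<in>K. f x k) \<otimes> (\<Otimes>i\<in>I. \<Oplus>k\<in>K. f i k)"
    using insert by simp
  also have "\<dots> = (\<Otimes>i\<in>insert x I. \<Oplus>k\<in>K. f i k)"
    using insert by (intro finprod_insert[symmetric]) (auto intro!: finsum_closed)
  finally show ?case by simp
qed

lemma mat_ring_mult_index:
  "i < n \<Longrightarrow> j < n \<Longrightarrow> (A \<otimes>\<^bsub>mat_ring n R\<^esub> B) $$ (i, j) = (\<Oplus>\<^bsub>R\<^esub>k\<in>{..<n}. A $$ (i, k) \<otimes>\<^bsub>R\<^esub> B $$ (k, j))"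
  by (simp add: mat_ring_def)

lemma mat_ring_add_index:
  "i < n \<Longrightarrow> j < n \<Longrightarrow> (A \<oplus>\<^bsub>mat_ring n R\<^esub> B) $$ (i, j) = A $$ (i, j) \<oplus>\<^bsub>R\<^esub> B $$ (i, j)"
  by (simp add: mat_ring_def)

lemma mat_ring_one_index:
  "i < n \<Longrightarrow> j < n \<Longrightarrow> \<one>\<^bsub>mat_ring n R\<^esub> $$ (i, j) = (if i = j then \<one>\<^bsub>R\<^esub> else \<zero>\<^bsub>R\<^esub>)"
  by (simp add: mat_ring_def)

lemma mat_ring_carrier:
  "A \<in> carrier (mat_ring n R) \<longleftrightarrow> A \<in> carrier_mat n n \<and> (\<forall>i<n. \<forall>j<n. A $$ (i, j) \<in> carrier R)"
  by (simp add: mat_ring_def)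

lemma mat_ring_entry: "A \<in> carrier (mat_ring n R) \<Longrightarrow> i < n \<Longrightarrow> j < n \<Longrightarrow> A $$ (i, j) \<in> carrier R"
  by (simp add: mat_ring_carrier)

lemma mat_ring_eqI:
  assumes "A \<in> carrier (mat_ring n R)" "B \<in> carrier (mat_ring n R)"
    and "\<And>i j. i < n \<Longrightarrow> j < n \<Longrightarrow> A $$ (i, j) = B $$ (i, j)"
  shows "A = B"
  using assms by (intro eq_matI) (auto simp: mat_ring_carrier)

lemma (in ring) finsum_delta:
  assumes "finite S" "i \<in> S" "f \<in> S \<rightarrow> carrier R" "\<And>k. k \<in> S \<Longrightarrow> k \<noteq> i \<Longrightarrow> f k = \<zero>"
  shows "finsum R f S = f i"
proof -
  have "finsum R f S = (\<Oplus>k\<in>S. if i = k then f k else \<zero>)"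
    using assms by (intro finsum_cong') auto
  also have "\<dots> = f i" using assms by (intro add.finprod_singleton) auto
  finally show ?thesis .
qed

text \<open>Provides units, inverses and powers of matrices. Associativity is an exchange of two
  finite sums.\<close>

lemma (in ring) mat_ring_monoid: "monoid (mat_ring n R)"
proof (rule monoidI)
  show m_closed: "A \<otimes>\<^bsub>mat_ring n R\<^esub> B \<in> carrier (mat_ring n R)"
    if "A \<in> carrier (mat_ring n R)" "B \<in> carrier (mat_ring n R)" for A B
    using that unfolding mat_ring_carrier
    by (auto simp: mat_ring_mult_index intro!: finsum_closed) (simp add: mat_ring_def)
  show one_closed: "\<one>\<^bsub>mat_ring n R\<^esub> \<in> carrier (mat_ring n R)"
    by (simp add: mat_ring_def)
  fix A B C assume ABC: "A \<in> carrier (mat_ring n R)" "B \<in> carrier (mat_ring n R)" "C \<in> carrier (mat_ring n R)"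
  note e = mat_ring_entry[OF ABC(1)] mat_ring_entry[OF ABC(2)] mat_ring_entry[OF ABC(3)]
  show "A \<otimes>\<^bsub>mat_ring n R\<^esub> B \<otimes>\<^bsub>mat_ring n R\<^esub> C = A \<otimes>\<^bsub>mat_ring n R\<^esub> (B \<otimes>\<^bsub>mat_ring n R\<^esub> C)"
  proof (rule mat_ring_eqI)
    fix i j assume ij: "i < n" "j < n"
    have "(A \<otimes>\<^bsub>mat_ring n R\<^esub> B \<otimes>\<^bsub>mat_ring n R\<^esub> C) $$ (i, j)
        = (\<Oplus>k\<in>{..<n}. (\<Oplus>l\<in>{..<n}. A $$ (i, l) \<otimes> B $$ (l, k)) \<otimes> C $$ (k, j))"
      using ij e by (subst mat_ring_mult_index) (auto intro!: finsum_cong' simp: mat_ring_mult_index)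
    also have "\<dots> = (\<Oplus>k\<in>{..<n}. \<Oplus>l\<in>{..<n}. A $$ (i, l) \<otimes> B $$ (l, k) \<otimes> C $$ (k, j))"
      using ij e by (intro finsum_cong' finsum_ldistr) (auto intro!: finsum_closed)
    also have "\<dots> = (\<Oplus>l\<in>{..<n}. \<Oplus>k\<in>{..<n}. A $$ (i, l) \<otimes> B $$ (l, k) \<otimes> C $$ (k, j))"
      using ij e by (intro finsum_finsum_swap) auto
    also have "\<dots> = (\<Oplus>l\<in>{..<n}. A $$ (i, l) \<otimes> (\<Oplus>k\<in>{..<n}. B $$ (l, k) \<otimes> C $$ (k, j)))"
      using ij e by (intro finsum_cong' refl) (auto simp: finsum_rdistr m_assoc intro!: finsum_closed finsum_cong')
    also have "\<dots> = (A \<otimes>\<^bsub>mat_ring n R\<^esub> (B \<otimes>\<^bsub>mat_ring n R\<^esub> C)) $$ (i, j)"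
      using ij e by (subst mat_ring_mult_index) (auto intro!: finsum_cong' simp: mat_ring_mult_index)
    finally show "(A \<otimes>\<^bsub>mat_ring n R\<^esub> B \<otimes>\<^bsub>mat_ring n R\<^esub> C) $$ (i, j) = (A \<otimes>\<^bsub>mat_ring n R\<^esub> (B \<otimes>\<^bsub>mat_ring n R\<^esub> C)) $$ (i, j)" .
  qed (use ABC m_closed in auto)
next
  fix A assume A: "A \<in> carrier (mat_ring n R)"
  note e = mat_ring_entry[OF A]
  have one: "\<one>\<^bsub>mat_ring n R\<^esub> \<in> carrier (mat_ring n R)" by (simp add: mat_ring_def)
  have cl: "B \<otimes>\<^bsub>mat_ring n R\<^esub> C \<in> carrier (mat_ring n R)"
    if "B \<in> carrier (mat_ring n R)" "C \<in> carrier (mat_ring n R)" for B C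
    using that unfolding mat_ring_carrier
    by (auto simp: mat_ring_mult_index intro!: finsum_closed) (simp add: mat_ring_def)
  show "\<one>\<^bsub>mat_ring n R\<^esub> \<otimes>\<^bsub>mat_ring n R\<^esub> A = A"
  proof (rule mat_ring_eqI[OF cl[OF one A] A])
    fix i j assume ij: "i < n" "j < n"
    have "(\<Oplus>k\<in>{..<n}. \<one>\<^bsub>mat_ring n R\<^esub> $$ (i, k) \<otimes> A $$ (k, j)) = \<one>\<^bsub>mat_ring n R\<^esub> $$ (i, i) \<otimes> A $$ (i, j)"
      using ij e by (intro finsum_delta) (auto simp: mat_ring_one_index)
    then show "(\<one>\<^bsub>mat_ring n R\<^esub> \<otimes>\<^bsub>mat_ring n R\<^esub> A) $$ (i, j) = A $$ (i, j)"
      using ij e by (simp add: mat_ring_mult_index mat_ring_one_index)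
  qed
  show "A \<otimes>\<^bsub>mat_ring n R\<^esub> \<one>\<^bsub>mat_ring n R\<^esub> = A"
  proof (rule mat_ring_eqI[OF cl[OF A one] A])
    fix i j assume ij: "i < n" "j < n"
    have "(\<Oplus>k\<in>{..<n}. A $$ (i, k) \<otimes> \<one>\<^bsub>mat_ring n R\<^esub> $$ (k, j)) = A $$ (i, j) \<otimes> \<one>\<^bsub>mat_ring n R\<^esub> $$ (j, j)"
      using ij e by (intro finsum_delta) (auto simp: mat_ring_one_index)
    then show "(A \<otimes>\<^bsub>mat_ring n R\<^esub> \<one>\<^bsub>mat_ring n R\<^esub>) $$ (i, j) = A $$ (i, j)"
      using ij e by (simp add: mat_ring_mult_index mat_ring_one_index)
  qed
qed

section \<open>Multiplicativity of the determinant\<close>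

definition perm_sign :: "('a, 'b) ring_scheme \<Rightarrow> (nat \<Rightarrow> nat) \<Rightarrow> 'a" where
  "perm_sign R p = (if evenperm p then \<one>\<^bsub>R\<^esub> else \<ominus>\<^bsub>R\<^esub> \<one>\<^bsub>R\<^esub>)"

text \<open>For \<open>\<phi>\<close> mapping indices below \<open>n\<close> to such indices, this
  is the determinant of the matrix whose row \<open>i\<close> is row \<open>\<phi> i\<close> of
  \<open>B\<close>; such determinants appear when the determinant of a product is expanded along the
  rows of the first factor.\<close>

definition row_det :: "nat \<Rightarrow> ('a, 'b) ring_scheme \<Rightarrow> 'a mat \<Rightarrow> (nat \<Rightarrow> nat) \<Rightarrow> 'a" where
  "row_det n R B \<phi> = (\<Oplus>\<^bsub>R\<^esub>p\<in>{p. p permutes {..<n}}.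
     perm_sign R p \<otimes>\<^bsub>R\<^esub> finprod R (\<lambda>i. B $$ (\<phi> i, p i)) {..<n})"

lemma mat_det_row_det: "mat_det n R B = row_det n R B (\<lambda>i. i)"
  by (simp add: mat_det_def row_det_def perm_sign_def)

lemma permutes_below: "p permutes {..<n} \<Longrightarrow> i < n \<Longrightarrow> p i < (n::nat)"
  using permutes_in_image by fastforce

context cring
begin

lemma perm_sign_closed [simp]: "perm_sign R p \<in> carrier R"
  by (simp add: perm_sign_def)

lemma perm_sign_comp:
  assumes "p permutes {..<n}" "q permutes {..<n}"
  shows "perm_sign R (p \<circ> q) = perm_sign R q \<otimes> perm_sign R p"
proof -
  have "permutation p" "permutation q"
    using assms permutes_imp_permutation[of "{..<n}"] by auto
  then show ?thesis by (auto simp: perm_sign_def evenperm_comp l_minus r_minus)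
qed

lemma row_prod_closed:
  assumes "B \<in> carrier (mat_ring n R)" "\<And>i. i < n \<Longrightarrow> \<phi> i < n" "p permutes {..<n}"
  shows "(\<lambda>i. B $$ (\<phi> i, p i)) \<in> {..<n} \<rightarrow> carrier R" "(\<Otimes>i\<in>{..<n}. B $$ (\<phi> i, p i)) \<in> carrier R"
proof -
  show cl: "(\<lambda>i. B $$ (\<phi> i, p i)) \<in> {..<n} \<rightarrow> carrier R"
    using assms permutes_below mat_ring_entry[OF assms(1)] by auto
  show "(\<Otimes>i\<in>{..<n}. B $$ (\<phi> i, p i)) \<in> carrier R" by (rule finprod_closed[OF cl])
qed

lemma row_det_closed:
  assumes "B \<in> carrier (mat_ring n R)" "\<And>i. i < n \<Longrightarrow> \<phi> i < n"
  shows "row_det n R B \<phi> \<in> carrier R"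
  unfolding row_det_def using row_prod_closed[OF assms] by (intro finsum_closed) auto

lemma mat_det_closed: "B \<in> carrier (mat_ring n R) \<Longrightarrow> mat_det n R B \<in> carrier R"
  unfolding mat_det_row_det by (rule row_det_closed)

text \<open>Substituting \<open>p \<circ> q\<close> for \<open>p\<close> in the Leibniz sum restores
  the order of the rows and leaves the sign of \<open>q\<close> as a factor.\<close>

lemma row_det_permutes:
  assumes B: "B \<in> carrier (mat_ring n R)" and q: "q permutes {..<n}"
  shows "row_det n R B q = perm_sign R q \<otimes> mat_det n R B"
proof -
  let ?P = "{p. p permutes {..<n}}"
  let ?f = "\<lambda>p. perm_sign R p \<otimes> (\<Otimes>i\<in>{..<n}. B $$ (q i, p i))"
  let ?g = "\<lambda>p. perm_sign R p \<otimes> (\<Otimes>i\<in>{..<n}. B $$ (i, p i))"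
  have f: "?f \<in> ?P \<rightarrow> carrier R" using row_prod_closed[OF B permutes_below[OF q]] by auto
  have g: "?g \<in> ?P \<rightarrow> carrier R" using row_prod_closed[OF B, of "\<lambda>i. i"] by auto
  have "row_det n R B q = (\<Oplus>p\<in>?P. ?f (p \<circ> q))"
    unfolding row_det_def by (rule finsum_permutations_compose_right[OF q f])
  also have "\<dots> = (\<Oplus>p\<in>?P. perm_sign R q \<otimes> ?g p)"
  proof (intro finsum_cong' refl)
    show "(\<lambda>p. perm_sign R q \<otimes> ?g p) \<in> ?P \<rightarrow> carrier R" using g by auto
    fix p assume "p \<in> ?P"
    then have p: "p permutes {..<n}" by simp
    have cl: "(\<lambda>i. B $$ (i, p i)) \<in> {..<n} \<rightarrow> carrier R" using row_prod_closed[OF B _ p] by simp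
    have "(\<Otimes>i\<in>{..<n}. B $$ (q i, (p \<circ> q) i)) = (\<Otimes>i\<in>{..<n}. B $$ (i, p i))"
      using finprod_permute[OF q cl] by (simp add: o_def)
    then show "?f (p \<circ> q) = perm_sign R q \<otimes> ?g p"
      using cl by (simp add: perm_sign_comp[OF p q] m_assoc finprod_closed)
  qed
  also have "\<dots> = perm_sign R q \<otimes> (\<Oplus>p\<in>?P. ?g p)"
    using g finite_permutations[of "{..<n}"] by (intro finsum_rdistr[symmetric]) auto
  finally show ?thesis by (simp add: mat_det_row_det row_det_def)
qed

text \<open>Composition with the transposition of \<open>a\<close> and \<open>b\<close> matches even
  with odd permutations without changing the product of entries, so the terms cancel in pairs. This
  argument is valid in characteristic 2 as well, where antisymmetry alone would not force the value
  zero.\<close>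

lemma row_det_repeated:
  assumes B: "B \<in> carrier (mat_ring n R)" and phi: "\<And>i. i < n \<Longrightarrow> \<phi> i < n"
    and ab: "a < n" "b < n" "a \<noteq> b" "\<phi> a = \<phi> b"
  shows "row_det n R B \<phi> = \<zero>"
proof -
  let ?P = "{p. p permutes {..<n}}"
  let ?t = "transpose a b"
  define f where "f p = (\<Otimes>i\<in>{..<n}. B $$ (\<phi> i, p i))" for p
  define E where "E = {p \<in> ?P. evenperm p}"
  define O' where "O' = {p \<in> ?P. \<not> evenperm p}"
  have fin: "finite E" "finite O'"
    using finite_permutations[of "{..<n}"] by (auto simp: E_def O'_def)
  have fc: "f p \<in> carrier R" if "p \<in> ?P" for p
    unfolding f_def using row_prod_closed[OF B phi] that by simp
  have fE: "f \<in> E \<rightarrow> carrier R" "f \<in> O' \<rightarrow> carrier R" using fc by (auto simp: E_def O'_def)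
  have t: "?t permutes {..<n}" using ab by (intro permutes_swap_id) auto
  have ft: "f (p \<circ> ?t) = f p" if "p \<in> ?P" for p
  proof -
    have p: "p permutes {..<n}" using that by simp
    have "f p = (\<Otimes>i\<in>{..<n}. ((\<lambda>i. B $$ (\<phi> i, p i)) \<circ> ?t) i)"
      unfolding f_def using finprod_permute[OF t row_prod_closed(1)[OF B phi p]] by (simp add: o_def)
    also have "((\<lambda>i. B $$ (\<phi> i, p i)) \<circ> ?t) = (\<lambda>i. B $$ (\<phi> i, (p \<circ> ?t) i))"
      using ab(4) by (auto simp: fun_eq_iff transpose_def)
    finally show ?thesis by (simp add: f_def)
  qed
  have perm: "permutation p" if "p \<in> ?P" for p
    using that permutes_imp_permutation[of "{..<n}" p] by simp
  have evt: "evenperm (p \<circ> ?t) \<longleftrightarrow> \<not> evenperm p" if "p \<in> ?P" for p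
    using evenperm_comp[OF perm[OF that] permutation_swap_id[of a b]] ab(3) by (simp add: evenperm_swap)
  have inP: "p \<circ> ?t \<in> ?P" if "p \<in> ?P" for p using permutes_compose[OF t] that by simp
  have invol: "p \<circ> ?t \<circ> ?t = p" for p :: "nat \<Rightarrow> nat" by (simp add: o_assoc[symmetric])
  have img: "(\<lambda>p. p \<circ> ?t) ` E = O'"
  proof (intro equalityI subsetI)
    fix p assume "p \<in> (\<lambda>p. p \<circ> ?t) ` E"
    then show "p \<in> O'" using inP evt by (auto simp: E_def O'_def)
  next
    fix p assume "p \<in> O'"
    then have "p \<circ> ?t \<in> E" using inP[of p] evt[of p] by (simp add: E_def O'_def)
    then show "p \<in> (\<lambda>p. p \<circ> ?t) ` E" using invol[of p] by (metis image_eqI)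
  qed
  have inj: "inj_on (\<lambda>p. p \<circ> ?t) E"
    by (rule inj_on_inverseI[of _ "\<lambda>p. p \<circ> ?t"]) (simp add: invol)
  have "finsum R f O' = (\<Oplus>p\<in>E. f (p \<circ> ?t))"
    unfolding img[symmetric] by (rule add.finprod_reindex[OF _ inj]) (use fE img in simp)
  also have "\<dots> = finsum R f E"
    using ft fE by (intro finsum_cong') (auto simp: E_def)
  finally have OE: "finsum R f O' = finsum R f E" .
  have split: "?P = E \<union> O'" "E \<inter> O' = {}" by (auto simp: E_def O'_def)
  have "row_det n R B \<phi> = (\<Oplus>p\<in>E. perm_sign R p \<otimes> f p) \<oplus> (\<Oplus>p\<in>O'. perm_sign R p \<otimes> f p)"
    unfolding row_det_def f_def[symmetric] split(1)
    using fE by (intro finsum_Un_disjoint fin split) auto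
  also have "(\<Oplus>p\<in>E. perm_sign R p \<otimes> f p) = finsum R f E"
    using fE fc by (intro finsum_cong') (auto simp: E_def perm_sign_def)
  also have "(\<Oplus>p\<in>O'. perm_sign R p \<otimes> f p) = (\<Oplus>p\<in>O'. (\<ominus> \<one>) \<otimes> f p)"
    using fE fc by (intro finsum_cong') (auto simp: O'_def perm_sign_def)
  also have "\<dots> = (\<ominus> \<one>) \<otimes> finsum R f O'"
    using fE fin by (intro finsum_rdistr[symmetric]) auto
  finally show ?thesis
    unfolding OE using finsum_closed[OF fE(1)] by (simp add: l_minus r_neg)
qed

text \<open>Expanding the entries of the product gives a sum over all maps \<open>\<phi>\<close> of
  a product of entries of \<open>A\<close> times \<open>row_det n R B \<phi>\<close>. Maps that are
  not injective contribute zero, and the permutations reassemble the Leibniz sum of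
  \<open>A\<close>.\<close>

lemma mat_det_mult:
  assumes A: "A \<in> carrier (mat_ring n R)" and B: "B \<in> carrier (mat_ring n R)"
  shows "mat_det n R (A \<otimes>\<^bsub>mat_ring n R\<^esub> B) = mat_det n R A \<otimes> mat_det n R B"
proof -
  let ?P = "{p. p permutes {..<n}}"
  let ?F = "{..<n} \<rightarrow>\<^sub>E {..<n}"
  define \<alpha> where "\<alpha> \<phi> = (\<Otimes>i\<in>{..<n}. A $$ (i, \<phi> i))" for \<phi> :: "nat \<Rightarrow> nat"
  define \<beta> where "\<beta> \<phi> p = (\<Otimes>i\<in>{..<n}. B $$ (\<phi> i, p i))" for \<phi> p :: "nat \<Rightarrow> nat"
  have finP: "finite ?P" by (simp add: finite_permutations)
  have finF: "finite ?F" by (simp add: finite_PiE)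
  have e: "A $$ (i, j) \<in> carrier R" "B $$ (i, j) \<in> carrier R" if "i < n" "j < n" for i j
    using that mat_ring_entry[OF A] mat_ring_entry[OF B] by auto
  have Fb: "\<phi> i < n" if "\<phi> \<in> ?F" "i < n" for \<phi> i using that by (auto simp: PiE_iff)
  have \<alpha>: "\<alpha> \<phi> \<in> carrier R" if "\<And>i. i < n \<Longrightarrow> \<phi> i < n" for \<phi>
    unfolding \<alpha>_def using e that by (intro finprod_closed) auto
  have \<beta>: "\<beta> \<phi> p \<in> carrier R" if "\<And>i. i < n \<Longrightarrow> \<phi> i < n" "p \<in> ?P" for \<phi> p
    unfolding \<beta>_def using row_prod_closed(2)[OF B, of \<phi> p] that by simp
  have prod: "(\<Otimes>i\<in>{..<n}. (A \<otimes>\<^bsub>mat_ring n R\<^esub> B) $$ (i, p i)) = (\<Oplus>\<phi>\<in>?F. \<alpha> \<phi> \<otimes> \<beta> \<phi> p)" if p: "p \<in> ?P" for p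
  proof -
    have pb: "p i < n" if "i < n" for i using permutes_below p that by simp
    have "(\<Otimes>i\<in>{..<n}. (A \<otimes>\<^bsub>mat_ring n R\<^esub> B) $$ (i, p i)) = (\<Otimes>i\<in>{..<n}. \<Oplus>k\<in>{..<n}. A $$ (i, k) \<otimes> B $$ (k, p i))"
      using e pb by (intro finprod_cong') (auto simp: mat_ring_mult_index intro!: finsum_closed)
    also have "\<dots> = (\<Oplus>\<phi>\<in>?F. \<Otimes>i\<in>{..<n}. A $$ (i, \<phi> i) \<otimes> B $$ (\<phi> i, p i))"
      using e pb by (intro finprod_finsum_distrib) auto
    also have "\<dots> = (\<Oplus>\<phi>\<in>?F. \<alpha> \<phi> \<otimes> \<beta> \<phi> p)"
    proof (intro finsum_cong' refl)
      show "(\<lambda>\<phi>. \<alpha> \<phi> \<otimes> \<beta> \<phi> p) \<in> ?F \<rightarrow> carrier R" using \<alpha> \<beta>[OF _ p] Fb by (intro Pi_I) auto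
      fix \<phi> assume "\<phi> \<in> ?F"
      then show "(\<Otimes>i\<in>{..<n}. A $$ (i, \<phi> i) \<otimes> B $$ (\<phi> i, p i)) = \<alpha> \<phi> \<otimes> \<beta> \<phi> p"
        unfolding \<alpha>_def \<beta>_def using e pb Fb by (intro finprod_multf) auto
    qed
    finally show ?thesis .
  qed
  have "mat_det n R (A \<otimes>\<^bsub>mat_ring n R\<^esub> B) = (\<Oplus>p\<in>?P. \<Oplus>\<phi>\<in>?F. \<alpha> \<phi> \<otimes> (perm_sign R p \<otimes> \<beta> \<phi> p))"
    unfolding mat_det_row_det row_det_def
  proof (intro finsum_cong' refl)
    show "(\<lambda>p. \<Oplus>\<phi>\<in>?F. \<alpha> \<phi> \<otimes> (perm_sign R p \<otimes> \<beta> \<phi> p)) \<in> ?P \<rightarrow> carrier R"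
      using \<alpha> \<beta> Fb by (intro Pi_I finsum_closed m_closed) auto
    fix p assume p: "p \<in> ?P"
    have "perm_sign R p \<otimes> (\<Oplus>\<phi>\<in>?F. \<alpha> \<phi> \<otimes> \<beta> \<phi> p) = (\<Oplus>\<phi>\<in>?F. perm_sign R p \<otimes> (\<alpha> \<phi> \<otimes> \<beta> \<phi> p))"
      using \<alpha> \<beta>[OF _ p] Fb finF by (intro finsum_rdistr) auto
    also have "\<dots> = (\<Oplus>\<phi>\<in>?F. \<alpha> \<phi> \<otimes> (perm_sign R p \<otimes> \<beta> \<phi> p))"
      using \<alpha> \<beta>[OF _ p] Fb by (intro finsum_cong') (auto simp: m_lcomm)
    finally show "perm_sign R p \<otimes> (\<Otimes>i\<in>{..<n}. (A \<otimes>\<^bsub>mat_ring n R\<^esub> B) $$ (i, p i)) = (\<Oplus>\<phi>\<in>?F. \<alpha> \<phi> \<otimes> (perm_sign R p \<otimes> \<beta> \<phi> p))"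
      unfolding prod[OF p] .
  qed
  also have "\<dots> = (\<Oplus>\<phi>\<in>?F. \<Oplus>p\<in>?P. \<alpha> \<phi> \<otimes> (perm_sign R p \<otimes> \<beta> \<phi> p))"
    using \<alpha> \<beta> Fb by (intro finsum_finsum_swap finP finF) auto
  also have "\<dots> = (\<Oplus>\<phi>\<in>?F. \<alpha> \<phi> \<otimes> row_det n R B \<phi>)"
  proof (intro finsum_cong' refl)
    show "(\<lambda>\<phi>. \<alpha> \<phi> \<otimes> row_det n R B \<phi>) \<in> ?F \<rightarrow> carrier R"
      using \<alpha> Fb row_det_closed[OF B] by (intro Pi_I m_closed) auto
    fix \<phi> assume "\<phi> \<in> ?F"
    then show "(\<Oplus>p\<in>?P. \<alpha> \<phi> \<otimes> (perm_sign R p \<otimes> \<beta> \<phi> p)) = \<alpha> \<phi> \<otimes> row_det n R B \<phi>"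
      unfolding row_det_def \<beta>_def[symmetric] using \<alpha> \<beta> Fb finP by (intro finsum_rdistr[symmetric]) auto
  qed
  \<comment> \<open>Elements of \<open>?F\<close> are \<open>undefined\<close> from \<open>n\<close>
    onwards while permutations are the identity there, so permutations enter through
    \<open>restrict\<close>.\<close>
  also have "\<dots> = (\<Oplus>\<phi>\<in>(\<lambda>q. restrict q {..<n}) ` ?P. \<alpha> \<phi> \<otimes> row_det n R B \<phi>)"
  proof (rule add.finprod_mono_neutral_cong_right[OF finF])
    show "(\<lambda>q. restrict q {..<n}) ` ?P \<subseteq> ?F"
      using permutes_below by (intro image_subsetI PiE_I) auto
    show "\<alpha> \<phi> \<otimes> row_det n R B \<phi> = \<zero>" if phi: "\<phi> \<in> ?F - (\<lambda>q. restrict q {..<n}) ` ?P" for \<phi>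
    proof -
      have "\<not> inj_on \<phi> {..<n}"
      proof
        assume inj: "inj_on \<phi> {..<n}"
        define q where "q i = (if i < n then \<phi> i else i)" for i
        have "\<phi> ` {..<n} = {..<n}" using phi Fb inj by (intro endo_inj_surj) auto
        then have "bij_betw q {..<n} {..<n}"
          using inj by (auto simp: bij_betw_def q_def inj_on_def)
        then have "q permutes {..<n}" by (intro bij_imp_permutes) (auto simp: q_def)
        moreover have "\<phi> = restrict q {..<n}"
          using phi by (auto simp: q_def fun_eq_iff PiE_iff extensional_def)
        ultimately show False using phi by blast
      qed
      then obtain a b where "a < n" "b < n" "a \<noteq> b" "\<phi> a = \<phi> b" by (auto simp: inj_on_def)
      then have "row_det n R B \<phi> = \<zero>" using row_det_repeated[OF B, of \<phi> a b] phi Fb by blast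
      then show ?thesis using \<alpha>[of \<phi>] phi Fb by simp
    qed
    show "(\<lambda>\<phi>. \<alpha> \<phi> \<otimes> row_det n R B \<phi>) \<in> ?F \<rightarrow> carrier R"
      using \<alpha> Fb row_det_closed[OF B] by (intro Pi_I m_closed) auto
  qed simp
  also have "\<dots> = (\<Oplus>q\<in>?P. \<alpha> (restrict q {..<n}) \<otimes> row_det n R B (restrict q {..<n}))"
  proof (rule add.finprod_reindex)
    show "(\<lambda>\<phi>. \<alpha> \<phi> \<otimes> row_det n R B \<phi>) \<in> (\<lambda>q. restrict q {..<n}) ` ?P \<rightarrow> carrier R"
    proof
      fix \<phi> assume "\<phi> \<in> (\<lambda>q. restrict q {..<n}) ` ?P"
      then have "\<phi> i < n" if "i < n" for i using that permutes_below by auto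
      then show "\<alpha> \<phi> \<otimes> row_det n R B \<phi> \<in> carrier R" using \<alpha> row_det_closed[OF B] by simp
    qed
    show "inj_on (\<lambda>q. restrict q {..<n}) ?P"
    proof (rule inj_onI)
      fix p q assume pq: "p \<in> ?P" "q \<in> ?P" "restrict p {..<n} = restrict q {..<n}"
      show "p = q"
      proof
        fix i show "p i = q i"
        proof (cases "i < n")
          case True
          then show ?thesis using fun_cong[OF pq(3), of i] by simp
        next
          case False
          then show ?thesis using pq(1,2) by (simp add: permutes_def)
        qed
      qed
    qed
  qed
  also have "\<dots> = (\<Oplus>q\<in>?P. perm_sign R q \<otimes> \<alpha> q \<otimes> mat_det n R B)"
  proof (intro finsum_cong' refl)
    show "(\<lambda>q. perm_sign R q \<otimes> \<alpha> q \<otimes> mat_det n R B) \<in> ?P \<rightarrow> carrier R"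
      using \<alpha> permutes_below mat_det_closed[OF B] by auto
    fix q assume "q \<in> ?P"
    then have q: "q permutes {..<n}" by simp
    have "\<alpha> (restrict q {..<n}) = \<alpha> q"
      unfolding \<alpha>_def using e permutes_below[OF q] by (intro finprod_cong') auto
    moreover have "row_det n R B (restrict q {..<n}) = row_det n R B q"
      unfolding row_det_def
    proof (intro finsum_cong' refl arg_cong2[of _ _ _ _ "(\<otimes>)"] finprod_cong')
      show "(\<lambda>p. perm_sign R p \<otimes> (\<Otimes>i\<in>{..<n}. B $$ (q i, p i))) \<in> ?P \<rightarrow> carrier R"
        using row_prod_closed(2)[OF B permutes_below[OF q]] by auto
      show "(\<lambda>i. B $$ (q i, p i)) \<in> {..<n} \<rightarrow> carrier R" if "p \<in> ?P" for p
        using row_prod_closed(1)[OF B permutes_below[OF q]] that by simp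
    qed simp
    ultimately show "\<alpha> (restrict q {..<n}) \<otimes> row_det n R B (restrict q {..<n}) = perm_sign R q \<otimes> \<alpha> q \<otimes> mat_det n R B"
      using row_det_permutes[OF B q] \<alpha>[of q] permutes_below[OF q] mat_det_closed[OF B] by (simp add: m_ac)
  qed
  also have "\<dots> = (\<Oplus>q\<in>?P. perm_sign R q \<otimes> \<alpha> q) \<otimes> mat_det n R B"
    using \<alpha> permutes_below mat_det_closed[OF B] finP by (intro finsum_ldistr[symmetric]) auto
  finally show ?thesis by (simp add: mat_det_row_det row_det_def \<alpha>_def)
qed

text \<open>A permutation other than the identity moves some index and so picks up an off-diagonal
  zero.\<close>

lemma mat_det_diagonal:
  assumes D: "D \<in> carrier (mat_ring n R)" and diag: "\<And>i j. i < n \<Longrightarrow> j < n \<Longrightarrow> i \<noteq> j \<Longrightarrow> D $$ (i, j) = \<zero>"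
  shows "mat_det n R D = (\<Otimes>i\<in>{..<n}. D $$ (i, i))"
proof -
  let ?P = "{p. p permutes {..<n}}"
  let ?f = "\<lambda>p. perm_sign R p \<otimes> (\<Otimes>i\<in>{..<n}. D $$ (i, p i))"
  have cl: "?f \<in> ?P \<rightarrow> carrier R" using row_prod_closed(2)[OF D, of "\<lambda>i. i"] by auto
  have zero: "?f p = \<zero>" if p: "p \<in> ?P" "p \<noteq> id" for p
  proof -
    obtain i where "p i \<noteq> i" using p(2) by (auto simp: fun_eq_iff)
    then have i: "i < n" using p(1) by (auto simp: permutes_def)
    have "(\<Otimes>i\<in>{..<n}. D $$ (i, p i)) = \<zero>"
    proof (rule finprod_zero)
      show "\<exists>a\<in>{..<n}. D $$ (a, p a) = \<zero>"
        using diag[OF i, of "p i"] i p(1) permutes_below[of p n i] \<open>p i \<noteq> i\<close> by auto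
      show "(\<lambda>i. D $$ (i, p i)) \<in> {..<n} \<rightarrow> carrier R"
        using row_prod_closed(1)[OF D, of "\<lambda>i. i"] p(1) by simp
    qed simp
    then show ?thesis by simp
  qed
  have "mat_det n R D = ?f id"
    unfolding mat_det_row_det row_det_def
    by (rule finsum_delta[OF _ _ cl zero]) (auto simp: finite_permutations permutes_id)
  moreover have "(\<Otimes>i\<in>{..<n}. D $$ (i, i)) \<in> carrier R"
    using mat_ring_entry[OF D] by (intro finprod_closed) auto
  ultimately show ?thesis by (simp add: perm_sign_def)
qed

lemma mat_det_one: "mat_det n R \<one>\<^bsub>mat_ring n R\<^esub> = \<one>"
proof -
  interpret M: monoid "mat_ring n R" by (rule mat_ring_monoid)
  have "(\<Otimes>i\<in>{..<n}. \<one>\<^bsub>mat_ring n R\<^esub> $$ (i, i)) = \<one>"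
    by (intro finprod_one_eqI) (simp add: mat_ring_one_index)
  then show ?thesis by (simp add: mat_det_diagonal mat_ring_one_index)
qed

lemma mat_det_conj:
  assumes A: "A \<in> carrier (mat_ring n R)" and P: "P \<in> Units (mat_ring n R)"
  shows "mat_det n R (inv\<^bsub>mat_ring n R\<^esub> P \<otimes>\<^bsub>mat_ring n R\<^esub> A \<otimes>\<^bsub>mat_ring n R\<^esub> P) = mat_det n R A"
proof -
  interpret M: monoid "mat_ring n R" by (rule mat_ring_monoid)
  note P' = M.Units_closed[OF P] M.Units_inv_closed[OF P]
  have inv: "mat_det n R (inv\<^bsub>mat_ring n R\<^esub> P) \<otimes> mat_det n R P = \<one>"
    using mat_det_mult[OF P'(2,1)] M.Units_l_inv[OF P] mat_det_one by simp
  have c: "mat_det n R P \<in> carrier R" "mat_det n R (inv\<^bsub>mat_ring n R\<^esub> P) \<in> carrier R" "mat_det n R A \<in> carrier R"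
    using P' A mat_det_closed by auto
  have "mat_det n R (inv\<^bsub>mat_ring n R\<^esub> P \<otimes>\<^bsub>mat_ring n R\<^esub> A \<otimes>\<^bsub>mat_ring n R\<^esub> P)
      = mat_det n R (inv\<^bsub>mat_ring n R\<^esub> P) \<otimes> mat_det n R A \<otimes> mat_det n R P"
    using P' A by (simp add: mat_det_mult)
  also have "\<dots> = (mat_det n R (inv\<^bsub>mat_ring n R\<^esub> P) \<otimes> mat_det n R P) \<otimes> mat_det n R A"
    using c by (simp add: m_ac)
  finally show ?thesis using inv c by simp
qed

end

text \<open>Serves two homomorphisms: the embedding of the base field, and evaluation of polynomial
  entries, which turns the characteristic polynomial into the determinant of a scalar matrix minus
  the given one.\<close>

lemma (in ring_hom_cring) hom_mat_det:
  assumes "\<And>i j. i < n \<Longrightarrow> j < n \<Longrightarrow> A $$ (i, j) \<in> carrier R"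
    and "\<And>i j. i < n \<Longrightarrow> j < n \<Longrightarrow> B $$ (i, j) = h (A $$ (i, j))"
  shows "h (mat_det n R A) = mat_det n S B"
proof -
  let ?P = "{p. p permutes {..<n}}"
  have cl: "(\<lambda>i. A $$ (i, p i)) \<in> {..<n} \<rightarrow> carrier R" if "p \<in> ?P" for p
    using assms(1) that permutes_below by auto
  have "h (mat_det n R A) = (\<Oplus>\<^bsub>S\<^esub>p\<in>?P. (h \<circ> (\<lambda>p. perm_sign R p \<otimes> (\<Otimes>i\<in>{..<n}. A $$ (i, p i)))) p)"
    unfolding mat_det_row_det row_det_def
    using R.finprod_closed[OF cl] by (subst hom_finsum) auto
  also have "\<dots> = mat_det n S B"
    unfolding mat_det_row_det row_det_def
  proof (intro S.finsum_cong' refl)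
    have Bc: "(\<lambda>i. B $$ (i, p i)) \<in> {..<n} \<rightarrow> carrier S" if "p \<in> ?P" for p
      using assms that permutes_below by auto
    show "(\<lambda>p. perm_sign S p \<otimes>\<^bsub>S\<^esub> (\<Otimes>\<^bsub>S\<^esub>i\<in>{..<n}. B $$ (i, p i))) \<in> ?P \<rightarrow> carrier S"
      using S.finprod_closed[OF Bc] by auto
    fix p assume p: "p \<in> ?P"
    have "h (perm_sign R p) = perm_sign S p" by (simp add: perm_sign_def)
    moreover have "h (\<Otimes>i\<in>{..<n}. A $$ (i, p i)) = (\<Otimes>\<^bsub>S\<^esub>i\<in>{..<n}. (h \<circ> (\<lambda>i. A $$ (i, p i))) i)"
      by (subst hom_finprod[OF cl[OF p]]) simp
    moreover have "\<dots> = (\<Otimes>\<^bsub>S\<^esub>i\<in>{..<n}. B $$ (i, p i))"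
      using assms p permutes_below Bc[OF p] by (intro S.finprod_cong') auto
    ultimately show "(h \<circ> (\<lambda>p. perm_sign R p \<otimes> (\<Otimes>i\<in>{..<n}. A $$ (i, p i)))) p = perm_sign S p \<otimes>\<^bsub>S\<^esub> (\<Otimes>\<^bsub>S\<^esub>i\<in>{..<n}. B $$ (i, p i))"
      using R.finprod_closed[OF cl[OF p]] by simp
  qed
  finally show ?thesis .
qed

section \<open>Eigenvalues of a diagonalisable matrix\<close>

lemma eval_map_ring_hom:
  assumes R: "field R" and L: "field L" and hom: "\<phi> \<in> Ring.ring_hom R L" and x: "x \<in> carrier L"
  shows "ring_hom_cring (poly_ring R) L (\<lambda>p. ring.eval L (map \<phi> p) x)"
proof -
  interpret R: field R by (rule R)
  interpret L: field L by (rule L)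
  interpret h: ring_hom_ring R L \<phi> by (rule ring_hom_ringI2[OF R.ring_axioms L.ring_axioms hom])
  interpret UP: domain "poly_ring R" by (rule R.univ_poly_is_domain[OF R.carrier_is_subring])
  have s: "set p \<subseteq> carrier R" "set (map \<phi> p) \<subseteq> carrier L" if "p \<in> carrier (poly_ring R)" for p
  proof -
    show "set p \<subseteq> carrier R" using that by (simp add: R.polynomial_incl univ_poly_carrier)
    then show "set (map \<phi> p) \<subseteq> carrier L" by auto
  qed
  have "(\<lambda>p. L.eval (map \<phi> p) x) \<in> Ring.ring_hom (poly_ring R) L"
  proof (rule ring_hom_memI)
    fix p q assume pq: "p \<in> carrier (poly_ring R)" "q \<in> carrier (poly_ring R)"
    note s' = s[OF pq(1)] s[OF pq(2)]
    show "L.eval (map \<phi> p) x \<in> carrier L" using s' x by (intro L.eval_in_carrier)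
    have "set (map \<phi> (R.poly_mult p q)) \<subseteq> carrier L" "set (map \<phi> (R.poly_add p q)) \<subseteq> carrier L"
      using R.poly_mult_in_carrier[OF s'(1,3)] R.poly_add_in_carrier[OF s'(1,3)] by auto
    \<comment> \<open>Images of products and sums are compared up to leading zeros, which evaluation
      ignores.\<close>
    note n = L.eval_normalize[OF this(1) x] L.eval_normalize[OF this(2) x]
    show "L.eval (map \<phi> (p \<otimes>\<^bsub>poly_ring R\<^esub> q)) x = L.eval (map \<phi> p) x \<otimes>\<^bsub>L\<^esub> L.eval (map \<phi> q) x"
      using n h.poly_mult_hom'[OF s'(1,3)] L.eval_poly_mult[OF s'(2,4) x] by (simp add: univ_poly_mult)
    show "L.eval (map \<phi> (p \<oplus>\<^bsub>poly_ring R\<^esub> q)) x = L.eval (map \<phi> p) x \<oplus>\<^bsub>L\<^esub> L.eval (map \<phi> q) x"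
      using n h.poly_add_hom'[OF s'(1,3)] L.eval_poly_add[OF s'(2,4) x] by (simp add: univ_poly_add)
  next
    show "L.eval (map \<phi> \<one>\<^bsub>poly_ring R\<^esub>) x = \<one>\<^bsub>L\<^esub>"
      using x by (simp add: univ_poly_one)
  qed
  then show ?thesis
    by (intro ring_hom_cring.intro ring_hom_cring_axioms.intro UP.cring_axioms L.cring_axioms)
qed

lemma (in ring) mat_mult_diagonal_index:
  assumes "P \<in> carrier (mat_ring n R)" "D \<in> carrier (mat_ring n R)"
    and "\<And>i j. i < n \<Longrightarrow> j < n \<Longrightarrow> i \<noteq> j \<Longrightarrow> D $$ (i, j) = \<zero>" "i < n" "j < n"
  shows "(P \<otimes>\<^bsub>mat_ring n R\<^esub> D) $$ (i, j) = P $$ (i, j) \<otimes> D $$ (j, j)"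
proof -
  have "(\<Oplus>k\<in>{..<n}. P $$ (i, k) \<otimes> D $$ (k, j)) = P $$ (i, j) \<otimes> D $$ (j, j)"
    using assms mat_ring_entry[OF assms(1)] mat_ring_entry[OF assms(2)] by (intro finsum_delta) auto
  then show ?thesis using assms by (simp add: mat_ring_mult_index)
qed

lemma map_mat_ring_hom:
  assumes "ring_hom_ring R S h"
  shows "A \<in> carrier (mat_ring n R) \<Longrightarrow> map_mat h A \<in> carrier (mat_ring n S)"
    and "A \<in> carrier (mat_ring n R) \<Longrightarrow> B \<in> carrier (mat_ring n R) \<Longrightarrow>
      map_mat h (A \<otimes>\<^bsub>mat_ring n R\<^esub> B) = map_mat h A \<otimes>\<^bsub>mat_ring n S\<^esub> map_mat h B"
    and "A \<in> carrier (mat_ring n R) \<Longrightarrow> B \<in> carrier (mat_ring n R) \<Longrightarrow>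
      map_mat h (A \<oplus>\<^bsub>mat_ring n R\<^esub> B) = map_mat h A \<oplus>\<^bsub>mat_ring n S\<^esub> map_mat h B"
    and "map_mat h \<one>\<^bsub>mat_ring n R\<^esub> = \<one>\<^bsub>mat_ring n S\<^esub>"
    and "A \<in> carrier (mat_ring n R) \<Longrightarrow> map_mat h (A [^]\<^bsub>mat_ring n R\<^esub> (k::nat)) = map_mat h A [^]\<^bsub>mat_ring n S\<^esub> k"
proof -
  interpret h: ring_hom_ring R S h by (rule assms)
  interpret WR: monoid "mat_ring n R" by (rule h.R.mat_ring_monoid)
  interpret MS: monoid "mat_ring n S" by (rule h.S.mat_ring_monoid)
  show cl: "map_mat h A \<in> carrier (mat_ring n S)" if "A \<in> carrier (mat_ring n R)" for A
    using that by (auto simp: mat_ring_carrier)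
  show mult: "map_mat h (A \<otimes>\<^bsub>mat_ring n R\<^esub> B) = map_mat h A \<otimes>\<^bsub>mat_ring n S\<^esub> map_mat h B"
    if A: "A \<in> carrier (mat_ring n R)" and B: "B \<in> carrier (mat_ring n R)" for A B
  proof (rule mat_ring_eqI[OF cl MS.m_closed[OF cl cl]])
    fix i j assume ij: "i < n" "j < n"
    have dim: "dim_row A = n" "dim_col A = n" "dim_row B = n" "dim_col B = n"
       "dim_row (A \<otimes>\<^bsub>mat_ring n R\<^esub> B) = n" "dim_col (A \<otimes>\<^bsub>mat_ring n R\<^esub> B) = n"
      using A B WR.m_closed[OF A B] by (auto simp: mat_ring_carrier)
    note e = mat_ring_entry[OF A] mat_ring_entry[OF B]
    have "h (\<Oplus>\<^bsub>R\<^esub>k\<in>{..<n}. A $$ (i, k) \<otimes>\<^bsub>R\<^esub> B $$ (k, j)) = (\<Oplus>\<^bsub>S\<^esub>k\<in>{..<n}. (h \<circ> (\<lambda>k. A $$ (i, k) \<otimes>\<^bsub>R\<^esub> B $$ (k, j))) k)"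
      using ij e by (subst h.hom_finsum) auto
    also have "\<dots> = (\<Oplus>\<^bsub>S\<^esub>k\<in>{..<n}. map_mat h A $$ (i, k) \<otimes>\<^bsub>S\<^esub> map_mat h B $$ (k, j))"
      using ij e dim by (intro h.S.finsum_cong') auto
    finally show "map_mat h (A \<otimes>\<^bsub>mat_ring n R\<^esub> B) $$ (i, j) = (map_mat h A \<otimes>\<^bsub>mat_ring n S\<^esub> map_mat h B) $$ (i, j)"
      using ij dim by (simp add: mat_ring_mult_index)
  qed (use A B in auto)
  show "map_mat h (A \<oplus>\<^bsub>mat_ring n R\<^esub> B) = map_mat h A \<oplus>\<^bsub>mat_ring n S\<^esub> map_mat h B"
    if "A \<in> carrier (mat_ring n R)" "B \<in> carrier (mat_ring n R)" for A B
    using that by (intro eq_matI) (auto simp: mat_ring_def)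
  show one: "map_mat h \<one>\<^bsub>mat_ring n R\<^esub> = \<one>\<^bsub>mat_ring n S\<^esub>"
    by (intro eq_matI) (auto simp: mat_ring_def)
  show "map_mat h (A [^]\<^bsub>mat_ring n R\<^esub> k) = map_mat h A [^]\<^bsub>mat_ring n S\<^esub> k" if "A \<in> carrier (mat_ring n R)" for A and k :: nat
    using that by (induction k) (simp_all add: one mult)
qed

lemma (in cring) finsum_minus_mult:
  assumes "finite K" "a \<in> K \<rightarrow> carrier R" "b \<in> K \<rightarrow> carrier R" "c \<in> K \<rightarrow> carrier R"
  shows "(\<Oplus>k\<in>K. (a k \<ominus> b k) \<otimes> c k) = (\<Oplus>k\<in>K. a k \<otimes> c k) \<ominus> (\<Oplus>k\<in>K. b k \<otimes> c k)"
proof -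
  have "(\<Oplus>k\<in>K. (a k \<ominus> b k) \<otimes> c k) = (\<Oplus>k\<in>K. a k \<otimes> c k \<oplus> (\<ominus> \<one>) \<otimes> (b k \<otimes> c k))"
    using assms by (intro finsum_cong') (auto simp: a_minus_def l_distr l_minus Pi_iff)
  also have "\<dots> = (\<Oplus>k\<in>K. a k \<otimes> c k) \<oplus> (\<Oplus>k\<in>K. (\<ominus> \<one>) \<otimes> (b k \<otimes> c k))"
    using assms by (intro finsum_addf) (auto simp: Pi_iff)
  also have "(\<Oplus>k\<in>K. (\<ominus> \<one>) \<otimes> (b k \<otimes> c k)) = (\<ominus> \<one>) \<otimes> (\<Oplus>k\<in>K. b k \<otimes> c k)"
    using assms by (intro finsum_rdistr[symmetric]) (auto simp: Pi_iff)
  also have "\<dots> = \<ominus> (\<Oplus>k\<in>K. b k \<otimes> c k)"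
    using assms finsum_closed[of "\<lambda>k. b k \<otimes> c k" K] by (simp add: l_minus Pi_iff)
  finally show ?thesis by (simp add: a_minus_def)
qed

text \<open>Everything follows from \<open>A' P = P D\<close> with \<open>D\<close> diagonal: column
  \<open>j\<close> of \<open>P\<close> is a nonzero eigenvector for \<open>lam j\<close>. The
  statement on powers is an equivalence because it must identify the order of \<open>A\<close>; for
  sums of powers one direction suffices for an upper bound on the energy.\<close>

lemma obtain_eigenvalues:
  assumes R: "field R" and L: "field L" and hom: "\<phi> \<in> Ring.ring_hom R L"
    and A: "A \<in> carrier (mat_ring n R)" and diag: "mat_diagonalisable n L (map_mat \<phi> A)"
  obtains lam where "\<And>i. i < n \<Longrightarrow> lam i \<in> carrier L"
    and "\<And>k::nat. A [^]\<^bsub>mat_ring n R\<^esub> k = \<one>\<^bsub>mat_ring n R\<^esub> \<longleftrightarrow> (\<forall>i<n. lam i [^]\<^bsub>L\<^esub> k = \<one>\<^bsub>L\<^esub>)"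
    and "\<And>(a::nat) (b::nat) (c::nat) (d::nat) i.
       A [^]\<^bsub>mat_ring n R\<^esub> a \<oplus>\<^bsub>mat_ring n R\<^esub> A [^]\<^bsub>mat_ring n R\<^esub> b = A [^]\<^bsub>mat_ring n R\<^esub> c \<oplus>\<^bsub>mat_ring n R\<^esub> A [^]\<^bsub>mat_ring n R\<^esub> d
       \<Longrightarrow> i < n \<Longrightarrow> lam i [^]\<^bsub>L\<^esub> a \<oplus>\<^bsub>L\<^esub> lam i [^]\<^bsub>L\<^esub> b = lam i [^]\<^bsub>L\<^esub> c \<oplus>\<^bsub>L\<^esub> lam i [^]\<^bsub>L\<^esub> d"
    and "\<phi> (mat_det n R A) = finprod L lam {..<n}"
    and "\<And>i. i < n \<Longrightarrow> ring.eval L (map \<phi> (mat_char_poly n R A)) (lam i) = \<zero>\<^bsub>L\<^esub>"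
proof -
  interpret R: field R by (rule R)
  interpret L: field L by (rule L)
  interpret h: ring_hom_ring R L \<phi> by (rule ring_hom_ringI2[OF R.ring_axioms L.ring_axioms hom])
  interpret hc: ring_hom_cring R L \<phi>
    by (intro ring_hom_cring.intro ring_hom_cring_axioms.intro R.cring_axioms L.cring_axioms hom)
  interpret WR: monoid "mat_ring n R" by (rule R.mat_ring_monoid)
  interpret WL: monoid "mat_ring n L" by (rule L.mat_ring_monoid)
  note map_hom = map_mat_ring_hom[OF h.ring_hom_ring_axioms]
  define A' where "A' = map_mat \<phi> A"
  have A': "A' \<in> carrier (mat_ring n L)" unfolding A'_def by (rule map_hom(1)[OF A])
  have dimA: "dim_row A = n" "dim_col A = n" using A by (auto simp: mat_ring_carrier)
  have A'_entry: "A' $$ (i, j) = \<phi> (A $$ (i, j))" if "i < n" "j < n" for i j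
    using that dimA by (simp add: A'_def)
  obtain P where P: "P \<in> Units (mat_ring n L)"
    and Poff: "\<And>i j. i < n \<Longrightarrow> j < n \<Longrightarrow> i \<noteq> j \<Longrightarrow>
      (inv\<^bsub>mat_ring n L\<^esub> P \<otimes>\<^bsub>mat_ring n L\<^esub> A' \<otimes>\<^bsub>mat_ring n L\<^esub> P) $$ (i, j) = \<zero>\<^bsub>L\<^esub>"
    using diag unfolding mat_diagonalisable_def A'_def Let_def GL_def units_of_carrier by blast
  define D where "D = inv\<^bsub>mat_ring n L\<^esub> P \<otimes>\<^bsub>mat_ring n L\<^esub> A' \<otimes>\<^bsub>mat_ring n L\<^esub> P"
  define lam where "lam i = D $$ (i, i)" for i
  note Pc = WL.Units_closed[OF P] and Pi = WL.Units_inv_closed[OF P]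
  have D: "D \<in> carrier (mat_ring n L)" unfolding D_def using Pc Pi A' by simp
  have Doff: "D $$ (i, j) = \<zero>\<^bsub>L\<^esub>" if "i < n" "j < n" "i \<noteq> j" for i j using Poff that by (simp add: D_def)
  have PD: "A' \<otimes>\<^bsub>mat_ring n L\<^esub> P = P \<otimes>\<^bsub>mat_ring n L\<^esub> D"
  proof -
    have "P \<otimes>\<^bsub>mat_ring n L\<^esub> D = (P \<otimes>\<^bsub>mat_ring n L\<^esub> inv\<^bsub>mat_ring n L\<^esub> P) \<otimes>\<^bsub>mat_ring n L\<^esub> (A' \<otimes>\<^bsub>mat_ring n L\<^esub> P)"
      unfolding D_def using Pc Pi A' by (simp only: WL.m_assoc WL.m_closed)
    then show ?thesis using Pc A' WL.Units_r_inv[OF P] by simp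
  qed
  have lam: "lam i \<in> carrier L" if "i < n" for i using mat_ring_entry[OF D] that by (simp add: lam_def)
  note Pe = mat_ring_entry[OF Pc]
  have PDe: "(P \<otimes>\<^bsub>mat_ring n L\<^esub> D) $$ (i, j) = P $$ (i, j) \<otimes>\<^bsub>L\<^esub> lam j" if "i < n" "j < n" for i j
    unfolding lam_def by (rule L.mat_mult_diagonal_index[OF Pc D Doff that])
  \<comment> \<open>The identity \<open>A' ^ k P = P D ^ k\<close>, read entry by entry.\<close>
  have pow: "(A' [^]\<^bsub>mat_ring n L\<^esub> k \<otimes>\<^bsub>mat_ring n L\<^esub> P) $$ (i, j) = P $$ (i, j) \<otimes>\<^bsub>L\<^esub> lam j [^]\<^bsub>L\<^esub> k"
    if ij: "i < n" "j < n" for i j and k :: nat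
  proof (induction k)
    case 0
    then show ?case using Pc Pe[OF ij] by simp
  next
    case (Suc k)
    have "A' [^]\<^bsub>mat_ring n L\<^esub> Suc k \<otimes>\<^bsub>mat_ring n L\<^esub> P = A' [^]\<^bsub>mat_ring n L\<^esub> k \<otimes>\<^bsub>mat_ring n L\<^esub> (A' \<otimes>\<^bsub>mat_ring n L\<^esub> P)"
      using A' Pc by (simp add: WL.m_assoc)
    also have "\<dots> = (A' [^]\<^bsub>mat_ring n L\<^esub> k \<otimes>\<^bsub>mat_ring n L\<^esub> P) \<otimes>\<^bsub>mat_ring n L\<^esub> D"
      unfolding PD using A' Pc D by (simp add: WL.m_assoc)
    finally have "(A' [^]\<^bsub>mat_ring n L\<^esub> Suc k \<otimes>\<^bsub>mat_ring n L\<^esub> P) $$ (i, j)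
        = (A' [^]\<^bsub>mat_ring n L\<^esub> k \<otimes>\<^bsub>mat_ring n L\<^esub> P) $$ (i, j) \<otimes>\<^bsub>L\<^esub> lam j"
      using A' Pc unfolding lam_def by (simp add: L.mat_mult_diagonal_index[OF _ D Doff ij])
    then show ?case using Suc Pe[OF ij] lam[OF ij(2)] by (simp add: L.m_assoc)
  qed
  \<comment> \<open>An invertible matrix has no zero column. This allows cancellation of an entry of
    column \<open>j\<close> in equations that hold throughout that column.\<close>
  have col: "\<exists>i<n. P $$ (i, j) \<noteq> \<zero>\<^bsub>L\<^esub>" if j: "j < n" for j
  proof (rule ccontr)
    assume "\<not> ?thesis"
    then have z: "P $$ (k, j) = \<zero>\<^bsub>L\<^esub>" if "k < n" for k using that by blast
    have "(inv\<^bsub>mat_ring n L\<^esub> P \<otimes>\<^bsub>mat_ring n L\<^esub> P) $$ (j, j) = (\<Oplus>\<^bsub>L\<^esub>k\<in>{..<n}. (inv\<^bsub>mat_ring n L\<^esub> P) $$ (j, k) \<otimes>\<^bsub>L\<^esub> P $$ (k, j))"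
      using j by (simp add: mat_ring_mult_index)
    also have "\<dots> = \<zero>\<^bsub>L\<^esub>" using z mat_ring_entry[OF Pi] j by (intro L.finsum_zero') auto
    finally show False using WL.Units_l_inv[OF P] j by (simp add: mat_ring_one_index)
  qed
  have cancel: "u = v" if uv: "j < n" "u \<in> carrier L" "v \<in> carrier L"
    "\<And>i. i < n \<Longrightarrow> P $$ (i, j) \<otimes>\<^bsub>L\<^esub> u = P $$ (i, j) \<otimes>\<^bsub>L\<^esub> v" for j u v
  proof -
    obtain i where i: "i < n" "P $$ (i, j) \<noteq> \<zero>\<^bsub>L\<^esub>" using col[OF uv(1)] by blast
    then show ?thesis using uv(4)[OF i(1)] uv(1-3) Pe[of i j] by (simp add: L.m_lcancel)
  qed
  \<comment> \<open>A homomorphism of fields is injective, so matrix identities over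
    \<open>L\<close> descend to \<open>R\<close>.\<close>
  have inj: "inj_on \<phi> (carrier R)" using non_trivial_field_hom_is_inj[OF hom R L] .
  have one_iff: "A [^]\<^bsub>mat_ring n R\<^esub> k = \<one>\<^bsub>mat_ring n R\<^esub> \<longleftrightarrow> (\<forall>i<n. lam i [^]\<^bsub>L\<^esub> k = \<one>\<^bsub>L\<^esub>)" for k :: nat
  proof
    assume "A [^]\<^bsub>mat_ring n R\<^esub> k = \<one>\<^bsub>mat_ring n R\<^esub>"
    then have k: "A' [^]\<^bsub>mat_ring n L\<^esub> k = \<one>\<^bsub>mat_ring n L\<^esub>"
      using map_hom(4) map_hom(5)[OF A, of k] by (simp add: A'_def)
    show "\<forall>i<n. lam i [^]\<^bsub>L\<^esub> k = \<one>\<^bsub>L\<^esub>"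
    proof (intro allI impI)
      fix j assume j: "j < n"
      have "P $$ (i, j) \<otimes>\<^bsub>L\<^esub> lam j [^]\<^bsub>L\<^esub> k = P $$ (i, j) \<otimes>\<^bsub>L\<^esub> \<one>\<^bsub>L\<^esub>" if "i < n" for i
        using pow[OF that j, of k] k Pc Pe[OF that j] by simp
      then show "lam j [^]\<^bsub>L\<^esub> k = \<one>\<^bsub>L\<^esub>" using cancel[OF j] lam[OF j] by simp
    qed
  next
    assume l: "\<forall>i<n. lam i [^]\<^bsub>L\<^esub> k = \<one>\<^bsub>L\<^esub>"
    have Ak: "A' [^]\<^bsub>mat_ring n L\<^esub> k \<in> carrier (mat_ring n L)" using A' by simp
    have "A' [^]\<^bsub>mat_ring n L\<^esub> k \<otimes>\<^bsub>mat_ring n L\<^esub> P = P"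
      using A' Pc l Pe by (intro mat_ring_eqI[of _ n L]) (auto simp: pow)
    then have "A' [^]\<^bsub>mat_ring n L\<^esub> k \<otimes>\<^bsub>mat_ring n L\<^esub> (P \<otimes>\<^bsub>mat_ring n L\<^esub> inv\<^bsub>mat_ring n L\<^esub> P) = P \<otimes>\<^bsub>mat_ring n L\<^esub> inv\<^bsub>mat_ring n L\<^esub> P"
      using Ak Pc Pi by (simp only: flip: WL.m_assoc)
    then have "map_mat \<phi> (A [^]\<^bsub>mat_ring n R\<^esub> k) = map_mat \<phi> \<one>\<^bsub>mat_ring n R\<^esub>"
      using Ak WL.Units_r_inv[OF P] map_hom(4) map_hom(5)[OF A, of k] by (simp add: A'_def)
    moreover have c: "A [^]\<^bsub>mat_ring n R\<^esub> k \<in> carrier (mat_ring n R)" "\<one>\<^bsub>mat_ring n R\<^esub> \<in> carrier (mat_ring n R)"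
      using A by auto
    ultimately have eq: "\<phi> ((A [^]\<^bsub>mat_ring n R\<^esub> k) $$ (i, j)) = \<phi> (\<one>\<^bsub>mat_ring n R\<^esub> $$ (i, j))" if "i < n" "j < n" for i j
      using that c by (metis carrier_matD index_map_mat(1) mat_ring_carrier)
    show "A [^]\<^bsub>mat_ring n R\<^esub> k = \<one>\<^bsub>mat_ring n R\<^esub>"
    proof (rule mat_ring_eqI[OF c])
      fix i j assume ij: "i < n" "j < n"
      show "(A [^]\<^bsub>mat_ring n R\<^esub> k) $$ (i, j) = \<one>\<^bsub>mat_ring n R\<^esub> $$ (i, j)"
        by (rule inj_onD[OF inj eq[OF ij] mat_ring_entry[OF c(1) ij] mat_ring_entry[OF c(2) ij]])
    qed
  qed
  have energy: "lam j [^]\<^bsub>L\<^esub> a \<oplus>\<^bsub>L\<^esub> lam j [^]\<^bsub>L\<^esub> b = lam j [^]\<^bsub>L\<^esub> c \<oplus>\<^bsub>L\<^esub> lam j [^]\<^bsub>L\<^esub> d"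
    if eq: "A [^]\<^bsub>mat_ring n R\<^esub> a \<oplus>\<^bsub>mat_ring n R\<^esub> A [^]\<^bsub>mat_ring n R\<^esub> b = A [^]\<^bsub>mat_ring n R\<^esub> c \<oplus>\<^bsub>mat_ring n R\<^esub> A [^]\<^bsub>mat_ring n R\<^esub> d"
      and j: "j < n" for a b c d :: nat and j
  proof (rule cancel[OF j])
    fix i assume i: "i < n"
    have col_sum: "((A' [^]\<^bsub>mat_ring n L\<^esub> x \<oplus>\<^bsub>mat_ring n L\<^esub> A' [^]\<^bsub>mat_ring n L\<^esub> y) \<otimes>\<^bsub>mat_ring n L\<^esub> P) $$ (i, j)
        = P $$ (i, j) \<otimes>\<^bsub>L\<^esub> (lam j [^]\<^bsub>L\<^esub> x \<oplus>\<^bsub>L\<^esub> lam j [^]\<^bsub>L\<^esub> y)" for x y :: nat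
    proof -
      have e: "(A' [^]\<^bsub>mat_ring n L\<^esub> z) $$ (i, k) \<in> carrier L" if "k < n" for k and z :: nat
        using mat_ring_entry[of "A' [^]\<^bsub>mat_ring n L\<^esub> z" n L i k] i that A' by simp
      have "((A' [^]\<^bsub>mat_ring n L\<^esub> x \<oplus>\<^bsub>mat_ring n L\<^esub> A' [^]\<^bsub>mat_ring n L\<^esub> y) \<otimes>\<^bsub>mat_ring n L\<^esub> P) $$ (i, j)
        = (\<Oplus>\<^bsub>L\<^esub>k\<in>{..<n}. (A' [^]\<^bsub>mat_ring n L\<^esub> x) $$ (i, k) \<otimes>\<^bsub>L\<^esub> P $$ (k, j) \<oplus>\<^bsub>L\<^esub> (A' [^]\<^bsub>mat_ring n L\<^esub> y) $$ (i, k) \<otimes>\<^bsub>L\<^esub> P $$ (k, j))"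
        unfolding mat_ring_mult_index[OF i j] using i j e Pe
        by (intro L.finsum_cong') (auto simp: mat_ring_add_index L.l_distr)
      also have "\<dots> = (A' [^]\<^bsub>mat_ring n L\<^esub> x \<otimes>\<^bsub>mat_ring n L\<^esub> P) $$ (i, j) \<oplus>\<^bsub>L\<^esub> (A' [^]\<^bsub>mat_ring n L\<^esub> y \<otimes>\<^bsub>mat_ring n L\<^esub> P) $$ (i, j)"
        unfolding mat_ring_mult_index[OF i j] using i j e Pe by (intro L.finsum_addf) auto
      also have "\<dots> = P $$ (i, j) \<otimes>\<^bsub>L\<^esub> (lam j [^]\<^bsub>L\<^esub> x \<oplus>\<^bsub>L\<^esub> lam j [^]\<^bsub>L\<^esub> y)"
        using pow[OF i j] Pe[OF i j] lam[OF j] by (simp add: L.r_distr)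
      finally show ?thesis .
    qed
    have "map_mat \<phi> (A [^]\<^bsub>mat_ring n R\<^esub> x \<oplus>\<^bsub>mat_ring n R\<^esub> A [^]\<^bsub>mat_ring n R\<^esub> y) = A' [^]\<^bsub>mat_ring n L\<^esub> x \<oplus>\<^bsub>mat_ring n L\<^esub> A' [^]\<^bsub>mat_ring n L\<^esub> y" for x y :: nat
      using map_hom(3)[of "A [^]\<^bsub>mat_ring n R\<^esub> x" n "A [^]\<^bsub>mat_ring n R\<^esub> y"] map_hom(5)[OF A] A by (simp add: A'_def)
    then have "A' [^]\<^bsub>mat_ring n L\<^esub> a \<oplus>\<^bsub>mat_ring n L\<^esub> A' [^]\<^bsub>mat_ring n L\<^esub> b = A' [^]\<^bsub>mat_ring n L\<^esub> c \<oplus>\<^bsub>mat_ring n L\<^esub> A' [^]\<^bsub>mat_ring n L\<^esub> d"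
      using eq by metis
    then show "P $$ (i, j) \<otimes>\<^bsub>L\<^esub> (lam j [^]\<^bsub>L\<^esub> a \<oplus>\<^bsub>L\<^esub> lam j [^]\<^bsub>L\<^esub> b) = P $$ (i, j) \<otimes>\<^bsub>L\<^esub> (lam j [^]\<^bsub>L\<^esub> c \<oplus>\<^bsub>L\<^esub> lam j [^]\<^bsub>L\<^esub> d)"
      using col_sum[of a b] col_sum[of c d] by simp
  qed (use lam[OF j] in auto)
  have "\<phi> (mat_det n R A) = mat_det n L A'"
    using mat_ring_entry[OF A] A'_entry by (intro hc.hom_mat_det)
  also have "\<dots> = mat_det n L D" unfolding D_def by (rule L.mat_det_conj[OF A' P, symmetric])
  also have "\<dots> = finprod L lam {..<n}"
    unfolding lam_def by (rule L.mat_det_diagonal[OF D Doff])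
  finally have det: "\<phi> (mat_det n R A) = finprod L lam {..<n}" .
  have root: "L.eval (map \<phi> (mat_char_poly n R A)) (lam m) = \<zero>\<^bsub>L\<^esub>" if m: "m < n" for m
  proof -
    define x where "x = lam m"
    have x: "x \<in> carrier L" using lam[OF m] by (simp add: x_def)
    interpret E: ring_hom_cring "poly_ring R" L "\<lambda>p. L.eval (map \<phi> p) x"
      by (rule eval_map_ring_hom[OF R L hom x])
    \<comment> \<open>\<open>Q\<close> is \<open>x I - A'\<close> and \<open>F\<close> is
      \<open>x I - D\<close>. They are conjugate by \<open>P\<close>, so their determinants agree,
      and that of \<open>F\<close> contains the factor \<open>x - lam m\<close>, which is
      zero.\<close>
    define Q where "Q = mat n n (\<lambda>(i, j). (if i = j then x else \<zero>\<^bsub>L\<^esub>) \<ominus>\<^bsub>L\<^esub> A' $$ (i, j))"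
    define F where "F = mat n n (\<lambda>(i, j). if i = j then x \<ominus>\<^bsub>L\<^esub> lam j else \<zero>\<^bsub>L\<^esub>)"
    note A'e = mat_ring_entry[OF A']
    have Q: "Q \<in> carrier (mat_ring n L)" using x A'e by (auto simp: Q_def mat_ring_carrier)
    have F: "F \<in> carrier (mat_ring n L)" using x lam by (auto simp: F_def mat_ring_carrier)
    have Foff: "F $$ (i, j) = \<zero>\<^bsub>L\<^esub>" if "i < n" "j < n" "i \<noteq> j" for i j using that by (simp add: F_def)
    have QP: "Q \<otimes>\<^bsub>mat_ring n L\<^esub> P = P \<otimes>\<^bsub>mat_ring n L\<^esub> F"
    proof (rule mat_ring_eqI[OF WL.m_closed[OF Q Pc] WL.m_closed[OF Pc F]])
      fix i j assume ij: "i < n" "j < n"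
      have "(Q \<otimes>\<^bsub>mat_ring n L\<^esub> P) $$ (i, j) = (\<Oplus>\<^bsub>L\<^esub>k\<in>{..<n}. ((if i = k then x else \<zero>\<^bsub>L\<^esub>) \<ominus>\<^bsub>L\<^esub> A' $$ (i, k)) \<otimes>\<^bsub>L\<^esub> P $$ (k, j))"
        unfolding mat_ring_mult_index[OF ij] using ij x A'e Pe by (intro L.finsum_cong') (auto simp: Q_def)
      also have "\<dots> = (\<Oplus>\<^bsub>L\<^esub>k\<in>{..<n}. (if i = k then x else \<zero>\<^bsub>L\<^esub>) \<otimes>\<^bsub>L\<^esub> P $$ (k, j)) \<ominus>\<^bsub>L\<^esub> (A' \<otimes>\<^bsub>mat_ring n L\<^esub> P) $$ (i, j)"
        unfolding mat_ring_mult_index[OF ij] using ij x A'e Pe by (intro L.finsum_minus_mult) auto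
      also have "(\<Oplus>\<^bsub>L\<^esub>k\<in>{..<n}. (if i = k then x else \<zero>\<^bsub>L\<^esub>) \<otimes>\<^bsub>L\<^esub> P $$ (k, j)) = (if i = i then x else \<zero>\<^bsub>L\<^esub>) \<otimes>\<^bsub>L\<^esub> P $$ (i, j)"
        using ij x Pe by (intro L.finsum_delta) auto
      also have "(A' \<otimes>\<^bsub>mat_ring n L\<^esub> P) $$ (i, j) = P $$ (i, j) \<otimes>\<^bsub>L\<^esub> lam j" unfolding PD by (rule PDe[OF ij])
      also have "(if i = i then x else \<zero>\<^bsub>L\<^esub>) \<otimes>\<^bsub>L\<^esub> P $$ (i, j) \<ominus>\<^bsub>L\<^esub> P $$ (i, j) \<otimes>\<^bsub>L\<^esub> lam j = P $$ (i, j) \<otimes>\<^bsub>L\<^esub> (x \<ominus>\<^bsub>L\<^esub> lam j)"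
        using x Pe[OF ij] lam[OF ij(2)] by (simp add: a_minus_def L.r_distr L.r_minus L.l_minus L.m_comm)
      also have "\<dots> = (P \<otimes>\<^bsub>mat_ring n L\<^esub> F) $$ (i, j)"
        using ij by (simp add: L.mat_mult_diagonal_index[OF Pc F Foff ij]) (simp add: F_def)
      finally show "(Q \<otimes>\<^bsub>mat_ring n L\<^esub> P) $$ (i, j) = (P \<otimes>\<^bsub>mat_ring n L\<^esub> F) $$ (i, j)" .
    qed
    have "inv\<^bsub>mat_ring n L\<^esub> P \<otimes>\<^bsub>mat_ring n L\<^esub> Q \<otimes>\<^bsub>mat_ring n L\<^esub> P = (inv\<^bsub>mat_ring n L\<^esub> P \<otimes>\<^bsub>mat_ring n L\<^esub> P) \<otimes>\<^bsub>mat_ring n L\<^esub> F"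
      using QP Q F Pc Pi by (simp only: WL.m_assoc WL.m_closed)
    then have "inv\<^bsub>mat_ring n L\<^esub> P \<otimes>\<^bsub>mat_ring n L\<^esub> Q \<otimes>\<^bsub>mat_ring n L\<^esub> P = F"
      using WL.Units_l_inv[OF P] F by simp
    then have "mat_det n L Q = mat_det n L F" using L.mat_det_conj[OF Q P] by simp
    also have "\<dots> = (\<Otimes>\<^bsub>L\<^esub>i\<in>{..<n}. F $$ (i, i))" by (rule L.mat_det_diagonal[OF F Foff])
    also have "\<dots> = \<zero>\<^bsub>L\<^esub>"
    proof (rule L.finprod_zero)
      show "\<exists>i\<in>{..<n}. F $$ (i, i) = \<zero>\<^bsub>L\<^esub>"
        using m x by (intro bexI[of _ m]) (auto simp: F_def x_def)
      show "(\<lambda>i. F $$ (i, i)) \<in> {..<n} \<rightarrow> carrier L" using mat_ring_entry[OF F] by auto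
    qed simp
    finally have Q0: "mat_det n L Q = \<zero>\<^bsub>L\<^esub>" .
    have const: "R.poly_of_const a \<in> carrier (poly_ring R)" "L.eval (map \<phi> (R.poly_of_const a)) x = \<phi> a"
      if "a \<in> carrier R" for a
      using that x by (auto simp: R.poly_of_const_def univ_poly_carrier[symmetric] polynomial_def)
    have X: "X\<^bsub>R\<^esub> \<in> carrier (poly_ring R)" "L.eval (map \<phi> X\<^bsub>R\<^esub>) x = x"
      using R.var_closed(1)[OF R.carrier_is_subring] x by (auto simp: var_def)
    have "L.eval (map \<phi> (mat_char_poly n R A)) x = mat_det n L Q"
      unfolding mat_char_poly_def
    proof (rule E.hom_mat_det)
      fix i j assume ij: "i < n" "j < n"
      have a: "A $$ (i, j) \<in> carrier R" using mat_ring_entry[OF A] ij by simp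
      let ?e = "(if i = j then X\<^bsub>R\<^esub> else \<zero>\<^bsub>poly_ring R\<^esub>) \<ominus>\<^bsub>poly_ring R\<^esub> R.poly_of_const (A $$ (i, j))"
      show "mat n n (\<lambda>(i, j). (if i = j then X\<^bsub>R\<^esub> else \<zero>\<^bsub>poly_ring R\<^esub>) \<ominus>\<^bsub>poly_ring R\<^esub> R.poly_of_const (A $$ (i, j))) $$ (i, j)
           \<in> carrier (poly_ring R)"
        using ij X const[OF a] by simp
      have "L.eval (map \<phi> ?e) x = (if i = j then x else \<zero>\<^bsub>L\<^esub>) \<ominus>\<^bsub>L\<^esub> \<phi> (A $$ (i, j))"
        using X const[OF a] E.hom_zero by (simp add: a_minus_def)
      then show "Q $$ (i, j) = L.eval (map \<phi> (mat n n (\<lambda>(i, j). (if i = j then X\<^bsub>R\<^esub> else \<zero>\<^bsub>poly_ring R\<^esub>) \<ominus>\<^bsub>poly_ring R\<^esub> R.poly_of_const (A $$ (i, j))) $$ (i, j))) x"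
        using ij A'_entry by (simp add: Q_def)
    qed
    then show ?thesis using Q0 by (simp add: x_def)
  qed
  show thesis by (rule that[of lam, OF lam one_iff energy det root])
qed

section \<open>Irreducible characteristic polynomials\<close>

text \<open>The polynomials vanishing at \<open>x\<close> form a principal ideal with a generator
  \<open>g\<close> that is not a unit. As \<open>f = q g\<close> is irreducible, \<open>q\<close> is
  a unit, so \<open>g\<close> vanishes at \<open>y\<close> together with \<open>f\<close>, and so
  does every multiple of \<open>g\<close>.\<close>

lemma irreducible_common_root:
  assumes R: "field R" and L: "field L" and hom: "\<phi> \<in> Ring.ring_hom R L"
    and f: "f \<in> carrier (poly_ring R)" "pirreducible\<^bsub>R\<^esub> (carrier R) f"
    and x: "x \<in> carrier L" "ring.eval L (map \<phi> f) x = \<zero>\<^bsub>L\<^esub>"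
    and y: "y \<in> carrier L" "ring.eval L (map \<phi> f) y = \<zero>\<^bsub>L\<^esub>"
    and p: "p \<in> carrier (poly_ring R)" "ring.eval L (map \<phi> p) x = \<zero>\<^bsub>L\<^esub>"
  shows "ring.eval L (map \<phi> p) y = \<zero>\<^bsub>L\<^esub>"
proof -
  interpret R: field R by (rule R)
  interpret L: field L by (rule L)
  interpret UP: domain "poly_ring R" by (rule R.univ_poly_is_domain[OF R.carrier_is_subring])
  define ex where "ex p = L.eval (map \<phi> p) x" for p
  define ey where "ey p = L.eval (map \<phi> p) y" for p
  interpret X: ring_hom_cring "poly_ring R" L ex
    unfolding ex_def by (rule eval_map_ring_hom[OF R L hom x(1)])
  interpret Y: ring_hom_cring "poly_ring R" L ey
    unfolding ey_def by (rule eval_map_ring_hom[OF R L hom y(1)])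
  interpret Xr: ring_hom_ring "poly_ring R" L ex
    by (rule ring_hom_ringI2[OF UP.ring_axioms L.ring_axioms X.homh])
  define I where "I = a_kernel (poly_ring R) L ex"
  have mem: "z \<in> I \<longleftrightarrow> z \<in> carrier (poly_ring R) \<and> ex z = \<zero>\<^bsub>L\<^esub>" for z
    unfolding I_def a_kernel_def' by simp
  have I: "ideal I (poly_ring R)" unfolding I_def by (rule X.ring.kernel_is_ideal)
  have fI: "f \<in> I" using f x by (simp add: mem ex_def)
  \<comment> \<open>The generator is obtained for nonzero ideals; the zero polynomial is the empty
    list.\<close>
  then have "I \<noteq> {[]}" using R.pirreducibleE(1)[OF R.carrier_is_subring f] by auto
  then obtain g where g: "g \<in> carrier (poly_ring R)" "I = PIdl\<^bsub>poly_ring R\<^esub> g"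
    using R.exists_unique_gen[OF R.carrier_is_subfield I] by blast
  have gI: "ex g = \<zero>\<^bsub>L\<^esub>"
    using UP.cgenideal_self[OF g(1)] g(2) mem by blast
  have gen: "\<exists>q\<in>carrier (poly_ring R). z = q \<otimes>\<^bsub>poly_ring R\<^esub> g" if "z \<in> I" for z
    using that unfolding g(2) cgenideal_def by blast
  have g_nonunit: "g \<notin> Units (poly_ring R)"
  proof
    assume u: "g \<in> Units (poly_ring R)"
    then have c: "inv\<^bsub>poly_ring R\<^esub> g \<in> carrier (poly_ring R)" by (rule UP.Units_inv_closed)
    have "ex (inv\<^bsub>poly_ring R\<^esub> g \<otimes>\<^bsub>poly_ring R\<^esub> g) = \<zero>\<^bsub>L\<^esub>"
      using X.hom_mult[OF c g(1)] gI X.hom_closed[OF c] by simp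
    then show False using UP.Units_l_inv[OF u] X.hom_one by simp
  qed
  obtain q where q: "q \<in> carrier (poly_ring R)" "f = q \<otimes>\<^bsub>poly_ring R\<^esub> g" using gen[OF fI] by blast
  then have u: "q \<in> Units (poly_ring R)"
    using R.pirreducibleE(3)[OF R.carrier_is_subring f q(1) g(1)] g_nonunit by blast
  have c: "inv\<^bsub>poly_ring R\<^esub> q \<in> carrier (poly_ring R)" using u by (rule UP.Units_inv_closed)
  have "g = inv\<^bsub>poly_ring R\<^esub> q \<otimes>\<^bsub>poly_ring R\<^esub> f"
    unfolding q(2) using UP.m_assoc[OF c q(1) g(1)] UP.Units_l_inv[OF u] g(1) by simp
  moreover have "ey f = \<zero>\<^bsub>L\<^esub>" using y by (simp add: ey_def)
  ultimately have gy: "ey g = \<zero>\<^bsub>L\<^esub>" using Y.hom_mult[OF c f(1)] Y.hom_closed[OF c] by simp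
  obtain s where s: "s \<in> carrier (poly_ring R)" "p = s \<otimes>\<^bsub>poly_ring R\<^esub> g"
    using gen[of p] p by (auto simp: mem ex_def)
  then show ?thesis using Y.hom_mult[OF s(1) g(1)] gy Y.hom_closed[OF s(1)] by (simp add: ey_def)
qed

text \<open>The case of \<open>X ^ k - 1\<close> in \<open>irreducible_common_root\<close>. It
  forces all roots of an irreducible characteristic polynomial to have the same order.\<close>

lemma irreducible_roots_same_power:
  assumes R: "field R" and L: "field L" and hom: "\<phi> \<in> Ring.ring_hom R L"
    and f: "f \<in> carrier (poly_ring R)" "pirreducible\<^bsub>R\<^esub> (carrier R) f"
    and x: "x \<in> carrier L" "ring.eval L (map \<phi> f) x = \<zero>\<^bsub>L\<^esub>"
    and y: "y \<in> carrier L" "ring.eval L (map \<phi> f) y = \<zero>\<^bsub>L\<^esub>"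
    and pow: "x [^]\<^bsub>L\<^esub> (k::nat) = \<one>\<^bsub>L\<^esub>"
  shows "y [^]\<^bsub>L\<^esub> k = \<one>\<^bsub>L\<^esub>"
proof -
  interpret R: field R by (rule R)
  interpret L: field L by (rule L)
  interpret UP: domain "poly_ring R" by (rule R.univ_poly_is_domain[OF R.carrier_is_subring])
  have X: "X\<^bsub>R\<^esub> \<in> carrier (poly_ring R)" by (rule R.var_closed(1)[OF R.carrier_is_subring])
  interpret h: ring_hom_ring R L \<phi> by (rule ring_hom_ringI2[OF R.ring_axioms L.ring_axioms hom])
  define p where "p = X\<^bsub>R\<^esub> [^]\<^bsub>poly_ring R\<^esub> k \<ominus>\<^bsub>poly_ring R\<^esub> \<one>\<^bsub>poly_ring R\<^esub>"
  have p: "p \<in> carrier (poly_ring R)" using X by (simp add: p_def)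
  have ev: "L.eval (map \<phi> p) z = z [^]\<^bsub>L\<^esub> k \<ominus>\<^bsub>L\<^esub> \<one>\<^bsub>L\<^esub>" if z: "z \<in> carrier L" for z
  proof -
    interpret Z: ring_hom_cring "poly_ring R" L "\<lambda>p. L.eval (map \<phi> p) z"
      by (rule eval_map_ring_hom[OF R L hom z])
    interpret Zr: ring_hom_ring "poly_ring R" L "\<lambda>p. L.eval (map \<phi> p) z"
      by (rule ring_hom_ringI2[OF UP.ring_axioms L.ring_axioms Z.homh])
    have "L.eval (map \<phi> X\<^bsub>R\<^esub>) z = z" using z by (simp add: var_def)
    then have "L.eval (map \<phi> (X\<^bsub>R\<^esub> [^]\<^bsub>poly_ring R\<^esub> k)) z = z [^]\<^bsub>L\<^esub> k"
      using Z.ring.hom_nat_pow[OF X, of k] by simp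
    then show ?thesis
      unfolding p_def a_minus_def using X Z.hom_add Z.hom_a_inv Z.hom_one by simp
  qed
  have "L.eval (map \<phi> p) x = \<zero>\<^bsub>L\<^esub>" using ev[OF x(1)] pow by simp
  then have "L.eval (map \<phi> p) y = \<zero>\<^bsub>L\<^esub>"
    by (rule irreducible_common_root[OF R L hom f x y p])
  then show ?thesis using ev[OF y(1)] y(1) by simp
qed

lemma mat_char_poly_closed:
  assumes R: "field R" and A: "A \<in> carrier (mat_ring n R)"
  shows "mat_char_poly n R A \<in> carrier (poly_ring R)"
proof -
  interpret R: field R by (rule R)
  interpret UP: domain "poly_ring R" by (rule R.univ_poly_is_domain[OF R.carrier_is_subring])
  have X: "X\<^bsub>R\<^esub> \<in> carrier (poly_ring R)" by (rule R.var_closed(1)[OF R.carrier_is_subring])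
  have const: "R.poly_of_const a \<in> carrier (poly_ring R)" if "a \<in> carrier R" for a
    using that by (auto simp: R.poly_of_const_def univ_poly_carrier[symmetric] polynomial_def)
  show ?thesis
    unfolding mat_char_poly_def using X const mat_ring_entry[OF A]
    by (intro UP.mat_det_closed) (auto simp: mat_ring_carrier)
qed

section \<open>From quadruples of exponents to pairs\<close>

text \<open>A quadruple is sent to \<open>x1\<close> and the differences \<open>x2 - x1\<close>,
  \<open>x3 - x1\<close> modulo \<open>N\<close>. This is injective because the equations determine
  \<open>lam i ^ x4\<close> for every \<open>i < n\<close>, hence \<open>x4\<close> modulo
  \<open>N\<close>. All eigenvalues enter into injectivity; only those in \<open>S\<close> are kept
  in the condition on pairs.\<close>

lemma (in field) card_energy_le:
  assumes lam: "\<And>i. i < n \<Longrightarrow> lam i \<in> carrier (mult_of R)" and N: "N > 0"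
    and powN: "\<And>k::nat. (\<forall>i<n. lam i [^] k = \<one>) \<longleftrightarrow> N dvd k" and S: "S \<subseteq> {..<n}"
  shows "card {(x1, x2, x3, x4). {x1, x2, x3, x4} \<subseteq> {1..N} \<and>
            (\<forall>i<n. lam i [^] (x1::nat) \<oplus> lam i [^] (x2::nat) = lam i [^] (x3::nat) \<oplus> lam i [^] (x4::nat))}
     \<le> N * card {(y, z). y < N \<and> z < N \<and> (\<exists>w::nat. \<forall>i\<in>S. \<one> \<oplus> lam i [^] y = lam i [^] z \<oplus> lam i [^] w)}"
    (is "card ?E \<le> N * card ?W")
proof -
  interpret M: comm_group "mult_of R" by (rule comm_group_mult_of)
  have lamc: "lam i \<in> carrier R" "lam i \<noteq> \<zero>" if "i < n" for i using lam[OF that] by auto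
  have lamp: "lam i [^] (k::nat) \<in> carrier R" "lam i [^] k \<noteq> \<zero>" if "i < n" for i k
    using mult_of.nat_pow_closed[OF lam[OF that], of k] by (auto simp: nat_pow_mult_of)
  have lamN: "lam i [^] N = \<one>" if "i < n" for i using powN[of N] that by simp
  have pmod: "lam i [^] (k mod N) = lam i [^] k" if i: "i < n" for i and k :: nat
  proof -
    have "lam i [^] k = lam i [^] (N * (k div N)) \<otimes> lam i [^] (k mod N)"
      using lamc[OF i] by (simp add: nat_pow_mult)
    also have "lam i [^] (N * (k div N)) = \<one>"
      using lamc[OF i] lamN[OF i] by (simp flip: nat_pow_pow)
    finally show ?thesis using lamc[OF i] by simp
  qed
  \<comment> \<open>The difference \<open>y - x\<close> modulo \<open>N\<close>, written without
    truncated subtraction going wrong as long as \<open>x \<le> N\<close>.\<close>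
  define u where "u x y = (y + (N - x)) mod N" for x y :: nat
  have uN: "u x y < N" for x y using N by (simp add: u_def)
  have u: "lam i [^] x \<otimes> lam i [^] u x y = lam i [^] y" if "i < n" "x \<le> N" for i x y
  proof -
    have "lam i [^] x \<otimes> lam i [^] u x y = lam i [^] (x + (y + (N - x)))"
      unfolding u_def pmod[OF that(1)] using lamc[OF that(1)] by (simp add: nat_pow_mult)
    also have "x + (y + (N - x)) = y + N" using that by simp
    finally show ?thesis using lamc[OF that(1)] lamN[OF that(1)] by (simp flip: nat_pow_mult)
  qed
  \<comment> \<open>The range from 1 to \<open>N\<close> contains exactly one representative of each
    residue class.\<close>
  have u_inj: "y = y'" if "u x y = u x y'" "y \<in> {1..N}" "y' \<in> {1..N}" for x y y'
  proof -
    have "int N dvd int y - int y'"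
      using that(1) unfolding u_def by (metis add_diff_cancel_right mod_eq_dvd_iff of_nat_add zmod_int)
    then have "\<bar>int N\<bar> \<le> \<bar>int y - int y'\<bar>" if "y \<noteq> y'"
      using that by (intro dvd_imp_le_int) auto
    then show ?thesis using that(2,3) by fastforce
  qed
  define F where "F = (\<lambda>(x1, x2, x3, x4 :: nat). (x1, u x1 x2, u x1 x3))"
  have sub: "F ` ?E \<subseteq> {1..N} \<times> ?W"
  proof
    fix v assume "v \<in> F ` ?E"
    then obtain e where e: "e \<in> ?E" "v = F e" by blast
    obtain x1 x2 x3 x4 where e_eq: "e = (x1, x2, x3, x4)" by (cases e) auto
    have v: "v = (x1, u x1 x2, u x1 x3)" and x: "x1 \<in> {1..N}"
      and eq: "\<And>i. i < n \<Longrightarrow> lam i [^] x1 \<oplus> lam i [^] x2 = lam i [^] x3 \<oplus> lam i [^] x4"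
      using e unfolding e_eq by (simp_all add: F_def)
    have "\<one> \<oplus> lam i [^] u x1 x2 = lam i [^] u x1 x3 \<oplus> lam i [^] u x1 x4" if i: "i < n" for i
    proof -
      have "lam i [^] x1 \<otimes> (\<one> \<oplus> lam i [^] u x1 x2) = lam i [^] x1 \<otimes> (lam i [^] u x1 x3 \<oplus> lam i [^] u x1 x4)"
        using u[OF i, of x1] x eq[OF i] lamp[OF i] by (simp add: r_distr)
      then show ?thesis using m_lcancel lamp[OF i] by simp
    qed
    then have "\<forall>i\<in>S. \<one> \<oplus> lam i [^] u x1 x2 = lam i [^] u x1 x3 \<oplus> lam i [^] u x1 x4" using S by auto
    then show "v \<in> {1..N} \<times> ?W" using v x uN by blast
  qed
  have inj: "inj_on F ?E"
  proof (rule inj_onI)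
    fix v v' assume vE: "v \<in> ?E" "v' \<in> ?E" "F v = F v'"
    obtain x1 x2 x3 x4 where v: "v = (x1, x2, x3, x4)" by (cases v) auto
    obtain x1' x2' x3' x4' where v': "v' = (x1', x2', x3', x4')" by (cases v') auto
    have b: "x2 \<in> {1..N}" "x3 \<in> {1..N}" "x4 \<in> {1..N}" "x2' \<in> {1..N}" "x3' \<in> {1..N}" "x4' \<in> {1..N}"
      using vE v v' by auto
    have F: "x1 = x1'" "u x1 x2 = u x1 x2'" "u x1 x3 = u x1 x3'" using vE(3) by (auto simp: v v' F_def)
    have 23: "x2 = x2'" "x3 = x3'" using u_inj F b by blast+
    have "lam i [^] x4 = lam i [^] x4'" if i: "i < n" for i
    proof -
      have "lam i [^] x3 \<oplus> lam i [^] x4 = lam i [^] x3 \<oplus> lam i [^] x4'"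
        using vE(1,2) i unfolding v v' F(1)[symmetric] 23[symmetric] by auto
      then show ?thesis using lamp[OF i] by simp
    qed
    then have "lam i [^] u x4 x4' = \<one>" if "i < n" for i
    proof -
      have "lam i [^] x4 \<otimes> lam i [^] u x4 x4' = lam i [^] x4 \<otimes> \<one>"
        using u[OF that, of x4 x4'] b lamp[OF that] \<open>\<And>i. i < n \<Longrightarrow> lam i [^] x4 = lam i [^] x4'\<close>[OF that] by simp
      then show ?thesis by (subst (asm) m_lcancel) (use lamp[OF that] in auto)
    qed
    then have "N dvd u x4 x4'" using powN by blast
    moreover have "u x4 x4 = 0" using b by (simp add: u_def)
    ultimately have "u x4 x4 = u x4 x4'" using uN[of x4 x4'] by (auto dest: dvd_imp_le)
    then have "x4 = x4'" using u_inj b by blast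
    then show "v = v'" using v v' F(1) 23 by simp
  qed
  have "finite ({1..N} \<times> ?W)"
    by (intro finite_cartesian_product finite_subset[of ?W "{..<N} \<times> {..<N}"]) auto
  then have "card ?E \<le> card ({1..N} \<times> ?W)" by (rule card_inj_on_le[OF inj sub])
  then show ?thesis by (simp add: card_cartesian_product)
qed

section \<open>Choosing a set of eigenvalues\<close>

text \<open>\<open>y\<close>, \<open>z\<close> and \<open>w\<close> stand for the exponents after
  division by \<open>A ^ x1\<close>. For \<open>S = {}\<close> every pair below \<open>N\<close>
  qualifies, and this case provides the trivial bound.\<close>

definition eigen_pairs :: "('a, 'b) ring_scheme \<Rightarrow> (nat \<Rightarrow> 'a) \<Rightarrow> nat \<Rightarrow> nat set \<Rightarrow> (nat \<times> nat) set" where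
  "eigen_pairs R lam N S = {(y, z). y < N \<and> z < N \<and>
     (\<exists>w::nat. \<forall>i\<in>S. \<one>\<^bsub>R\<^esub> \<oplus>\<^bsub>R\<^esub> lam i [^]\<^bsub>R\<^esub> y = lam i [^]\<^bsub>R\<^esub> z \<oplus>\<^bsub>R\<^esub> lam i [^]\<^bsub>R\<^esub> w)}"

lemma card_eigen_pairs_trivial: "card (eigen_pairs R lam N S) \<le> N ^ 2"
proof -
  have "card (eigen_pairs R lam N S) \<le> card ({..<N} \<times> {..<N})"
    by (intro card_mono) (auto simp: eigen_pairs_def)
  then show ?thesis by (simp add: card_cartesian_product power2_eq_square)
qed

text \<open>In logarithms: \<open>T\<close>, \<open>u\<close> and \<open>l\<close> stand for \<open>\<tau>\<close>, \<open>t\<close> and the product of the discarded orders, \<open>s\<close> for the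
  saving, and \<open>q\<close> of the \<open>n\<close> eigenvalues are kept.\<close>

lemma exponent_bookkeeping:
  fixes q n u l s T :: real
  assumes q: "2 \<le> q" "q \<le> n" and u: "0 \<le> u" and s: "0 \<le> s" and l: "l \<le> (n - q) * s"
    and T: "T = n * (n - 1) * s + n ^ 2 * u"
  shows "u + l - (T - l) / q \<le> - s"
proof -
  \<comment> \<open>Multiplied by \<open>q\<close>, the claim reads
    \<open>q u + (q + 1) l + q s \<le> T\<close>. The coefficient of \<open>s\<close> is then at
    most \<open>q (n - q) + n\<close>, and \<open>q (n - q) \<le> n (n - 2)\<close> because
    \<open>2 \<le> q \<le> n\<close>.\<close>
  have "q * u \<le> n ^ 2 * u" using q u by (intro mult_right_mono) (auto simp: power2_eq_square intro: order_trans[OF q(2)])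
  moreover have "q * (n - q) \<le> n * (n - 2)" using q by (intro mult_mono) auto
  then have "((q + 1) * (n - q) + q) * s \<le> (n * (n - 1)) * s"
    using s by (intro mult_right_mono) (auto simp: algebra_simps)
  moreover have "(q + 1) * l \<le> (q + 1) * ((n - q) * s)" using q l by (intro mult_left_mono) auto
  ultimately have "q * u + (q + 1) * l + q * s \<le> T" unfolding T by (simp add: algebra_simps)
  then have "(u + l + s) * q \<le> T - l" by (simp add: algebra_simps)
  then have "u + l + s \<le> (T - l) / q" using q by (simp add: pos_le_divide_eq)
  then show ?thesis by simp
qed

text \<open>All orders equal \<open>N\<close>, so the least common multiple is \<open>N\<close> too.
  The sum of reciprocals \<open>n / N\<close> is absorbed because
  \<open>N ^ (-1) \<le> t N ^ (-1/n)\<close>, whence the constant \<open>n + 4 n\<close>.\<close>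

lemma (in field) card_eigen_pairs_irreducible:
  assumes n: "n > 0" and lam: "\<And>i. i < n \<Longrightarrow> lam i \<in> carrier (mult_of R)" and N: "N > 0"
    and ord: "\<And>i. i < n \<Longrightarrow> group.ord (mult_of R) (lam i) = N"
    and t: "t = group.ord (mult_of R) (finprod R lam {..<n})" "t > 0"
  shows "real (card (eigen_pairs R lam N {..<n})) \<le> 5 * real n * (real N ^ 2 * (real t * real N powr (- 1 / real n)))"
proof -
  interpret M: comm_group "mult_of R" by (rule comm_group_mult_of)
  have pw: "lam i [^] N = \<one>" if "i \<in> {..<n}" for i
    using M.pow_ord_eq_1[OF lam, of i] ord[of i] that by (simp add: nat_pow_mult_of)
  have r: "N = Lcm ((\<lambda>i. M.ord (lam i)) ` {..<n})"
  proof -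
    have "(\<lambda>i. M.ord (lam i)) ` {..<n} = {N}" using ord n by auto
    then show ?thesis by simp
  qed
  have "real (card (eigen_pairs R lam N {..<n})) \<le> real N ^ 2 * ((\<Sum>i\<in>{..<n}. 1 / real (M.ord (lam i)))
          + 4 * real (card {..<n}) * real t * real N powr (- 1 / real (card {..<n})))"
    unfolding eigen_pairs_def
    using n lam pw by (intro card_pairs_bound[OF _ _ _ N _ r t(1)]) auto
  also have "\<dots> \<le> real N ^ 2 * (real n * (real t * real N powr (- 1 / real n)) + 4 * real n * real t * real N powr (- 1 / real n))"
  proof (intro mult_left_mono add_mono)
    have "1 / real N = real N powr (-1)" using N by (simp add: powr_minus_divide)
    also have "\<dots> \<le> real N powr (- 1 / real n)" using N n by (intro powr_mono) (auto simp: field_simps)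
    also have "\<dots> \<le> real t * real N powr (- 1 / real n)" using t(2) by (simp add: mult_le_cancel_right1)
    finally have "real n * (1 / real N) \<le> real n * (real t * real N powr (- 1 / real n))"
      by (intro mult_left_mono) auto
    then show "(\<Sum>i\<in>{..<n}. 1 / real (M.ord (lam i))) \<le> real n * (real t * real N powr (- 1 / real n))"
      using ord by simp
  qed auto
  finally show ?thesis by (simp add: algebra_simps)
qed

text \<open>With \<open>s = -ln \<kappa>\<close>, the eigenvalues of order less than \<open>exp s\<close> are discarded. At least two remain: otherwise
  \<open>N\<close>, which divides the product of all the orders, would be too small.\<close>

lemma (in field) card_eigen_pairs_general:
  assumes n: "n \<ge> 2" and lam: "\<And>i. i < n \<Longrightarrow> lam i \<in> carrier (mult_of R)" and N: "N > 0"
    and powN: "\<And>k::nat. (\<forall>i<n. lam i [^] k = \<one>) \<longleftrightarrow> N dvd k"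
    and t: "t = group.ord (mult_of R) (finprod R lam {..<n})" "t > 0"
    and \<kappa>: "\<kappa> = real t powr (real n / (real n - 1)) * real N powr (- 1 / (real n * (real n - 1)))"
  obtains S where "S \<subseteq> {..<n}" "real (card (eigen_pairs R lam N S)) \<le> 5 * real n * (real N ^ 2 * \<kappa>)"
proof -
  interpret M: comm_group "mult_of R" by (rule comm_group_mult_of)
  have lamc: "lam i \<in> carrier R" "lam i \<noteq> \<zero>" if "i < n" for i using lam[OF that] by auto
  have lamN: "lam i [^] N = \<one>" if "i < n" for i using powN[of N] that by simp
  define o' where "o' i = M.ord (lam i)" for i
  have oN: "o' i dvd N" if "i < n" for i
    unfolding o'_def using M.pow_eq_id[OF lam[OF that], of N] lamN[OF that] by (simp add: nat_pow_mult_of)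
  have o0: "o' i > 0" if "i < n" for i using oN[OF that] N by (auto intro: Nat.gr0I)
  have opow: "lam i [^] k = \<one> \<longleftrightarrow> o' i dvd k" if "i < n" for i and k :: nat
    unfolding o'_def using M.pow_eq_id[OF lam[OF that], of k] by (simp add: nat_pow_mult_of)
  have \<kappa>0: "\<kappa> > 0" unfolding \<kappa> using t N by simp
  define s where "s = - ln \<kappa>"
  have \<kappa>s: "\<kappa> = exp (- s)" using \<kappa>0 by (simp add: s_def)
  define T u where "T = ln (real N)" and "u = ln (real t)"
  have u0: "u \<ge> 0" using t(2) by (simp add: u_def)
  have s_eq: "s = T / (real n * (real n - 1)) - real n / (real n - 1) * u"
    unfolding s_def \<kappa> T_def u_def using t N by (simp add: ln_mult ln_powr)
  \<comment> \<open>The definition of \<open>\<kappa>\<close> solved for \<open>ln N\<close>, in the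
    shape that \<open>exponent_bookkeeping\<close> expects.\<close>
  have T: "T = real n * (real n - 1) * s + real n ^ 2 * u"
  proof -
    have nz: "real n \<noteq> 0" "real n - 1 \<noteq> 0" using n by auto
    have "real n * (real n - 1) * s = real n * (real n - 1) * (T / (real n * (real n - 1))) - real n * (real n - 1) * (real n / (real n - 1) * u)"
      unfolding s_eq by (rule right_diff_distrib)
    also have "real n * (real n - 1) * (T / (real n * (real n - 1))) = T" using nz by simp
    also have "real n * (real n - 1) * (real n / (real n - 1) * u) = real n ^ 2 * u"
      using nz by (simp add: power2_eq_square del: right_diff_distrib left_diff_distrib)
    finally show ?thesis by simp
  qed
  show thesis
  proof (cases "s \<le> 0")
    \<comment> \<open>No saving is claimed here, since \<open>\<kappa> \<ge> 1\<close>, so the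
      trivial bound from the empty set of eigenvalues is enough.\<close>
    case True
    then have "\<kappa> \<ge> 1" by (simp add: \<kappa>s)
    have "real (card (eigen_pairs R lam N {})) \<le> real N ^ 2"
      using card_eigen_pairs_trivial[of R lam N "{}"] by (simp flip: of_nat_power)
    also have "\<dots> \<le> 5 * real n * (real N ^ 2 * \<kappa>)"
    proof -
      have "real N ^ 2 * 1 \<le> real N ^ 2 * \<kappa>" using \<open>\<kappa> \<ge> 1\<close> by (intro mult_left_mono) auto
      moreover have "1 * (real N ^ 2 * \<kappa>) \<le> 5 * real n * (real N ^ 2 * \<kappa>)"
        using n \<kappa>0 by (intro mult_right_mono) auto
      ultimately show ?thesis by simp
    qed
    finally show thesis using that[of "{}"] by simp
  next
    case False
    then have s0: "s > 0" by simp
    define B where "B = {i. i < n \<and> real (o' i) < exp s}"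
    define S where "S = {..<n} - B"
    have fin: "finite B" "finite S" by (auto simp: B_def S_def)
    have BS: "B \<subseteq> {..<n}" "S \<subseteq> {..<n}" "B \<union> S = {..<n}" "B \<inter> S = {}" by (auto simp: B_def S_def)
    have cards: "card B + card S = n"
      using card_Un_disjoint[OF fin BS(4)] BS(3) by simp
    \<comment> \<open>\<open>L\<close> is a common multiple of the discarded orders: the power
      \<open>L\<close> kills every discarded eigenvalue, at a cost of at most
      \<open>card B * s\<close> in logarithms.\<close>
    define L where "L = (\<Prod>i\<in>B. o' i)"
    define l where "l = ln (real L)"
    have L0: "L > 0" unfolding L_def using o0 BS by (intro prod_pos) auto
    have l_eq: "l = (\<Sum>i\<in>B. ln (real (o' i)))"
      unfolding l_def L_def using o0 BS fin by (subst of_nat_prod, subst ln_prod) (auto simp: subset_iff)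
    have lno: "ln (real (o' i)) < s" if "i \<in> B" for i
    proof -
      have "real (o' i) < exp s" "real (o' i) > 0" using that o0 by (auto simp: B_def)
      then show ?thesis by (metis ln_exp ln_less_cancel_iff exp_gt_zero)
    qed
    have l_le: "l \<le> real (card B) * s"
      unfolding l_eq using sum_bounded_above[of B "\<lambda>i. ln (real (o' i))" s] lno by (simp add: less_imp_le)
    have l_less: "l < real (card B) * s" if "B \<noteq> {}"
      unfolding l_eq using sum_strict_mono[OF fin(1) that, of "\<lambda>i. ln (real (o' i))" "\<lambda>_. s"] lno by simp
    have LB: "lam i [^] (L * k) = \<one>" if "i \<in> B" for i k
    proof -
      have "o' i dvd L" unfolding L_def using fin that by (intro dvd_prodI)
      then show ?thesis using opow[of i] that BS by (auto simp: subset_iff)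
    qed
    define r where "r = Lcm ((\<lambda>i. M.ord (lam i)) ` S)"
    have rS: "lam i [^] (r * k) = \<one>" if "i \<in> S" for i k
    proof -
      have "o' i dvd r" unfolding r_def o'_def using that by simp
      then show ?thesis using opow[of i] that BS by (auto simp: subset_iff)
    qed
    have rN: "r dvd N" unfolding r_def using oN BS by (intro Lcm_least) (auto simp: o'_def)
    then have r0: "r > 0" using N by (auto intro: Nat.gr0I)
    have "lam i [^] (r * L) = \<one>" if "i < n" for i
    proof (cases "i \<in> B")
      case True
      then show ?thesis using LB[of i r] by (simp add: mult.commute)
    next
      case False
      then show ?thesis using rS[of i L] that by (simp add: S_def)
    qed
    \<comment> \<open>Kept eigenvalues are killed by \<open>r\<close>, discarded ones by
      \<open>L\<close>; hence \<open>r\<close> cannot be smaller than \<open>N / L\<close>.\<close>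
    then have "N dvd r * L" using powN by blast
    then have "N \<le> r * L" using r0 L0 by (intro dvd_imp_le) auto
    then have "T \<le> ln (real (r * L))" 
      unfolding T_def using N r0 L0 by (subst ln_le_cancel_iff) (simp_all flip: of_nat_mult)
    then have Tr: "T \<le> ln (real r) + l" using r0 L0 by (simp add: ln_mult l_def)
    define t' where "t' = M.ord (finprod R lam S)"
    have F: "lam \<in> B \<rightarrow> carrier R" "lam \<in> S \<rightarrow> carrier R" "lam \<in> {..<n} \<rightarrow> carrier R"
      using lamc BS by (auto simp: subset_iff)
    have split: "finprod R lam {..<n} = finprod R lam B \<otimes> finprod R lam S"
      using finprod_Un_disjoint[OF fin BS(4) F(1,2)] BS(3) by simp
    have pS: "finprod R lam S \<in> carrier R" "finprod R lam B \<in> carrier R" "finprod R lam {..<n} \<in> carrier R"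
      using F finprod_closed by auto
    have pSN: "finprod R lam S [^] N = \<one>"
      unfolding finprod_nat_pow[OF F(2), symmetric] using lamN BS by (intro finprod_one_eqI) auto
    have pS': "finprod R lam S \<in> carrier (mult_of R)" using pS pSN N by (auto simp: nat_pow_zero)
    have pN: "finprod R lam {..<n} [^] N = \<one>"
      unfolding finprod_nat_pow[OF F(3), symmetric] using lamN by (intro finprod_one_eqI) auto
    have p': "finprod R lam {..<n} \<in> carrier (mult_of R)" using pS pN N by (auto simp: nat_pow_zero)
    \<comment> \<open>The full product is killed by \<open>t\<close> and its discarded part by
      \<open>L\<close>, so the kept part is killed by \<open>t * L\<close>. Thus discarding raises
      the order \<open>t\<close> by a factor of at most \<open>L\<close>.\<close>
    have "finprod R lam S [^] (t * L) = \<one>"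
    proof -
      have "finprod R lam {..<n} [^] t = \<one>"
        using M.pow_ord_eq_1[OF p'] t(1) by (simp add: nat_pow_mult_of)
      then have "finprod R lam {..<n} [^] (t * L) = \<one>" using pS by (simp flip: nat_pow_pow)
      moreover have "finprod R lam B [^] (t * L) = \<one>"
        unfolding finprod_nat_pow[OF F(1), symmetric] using LB[of _ t]
        by (intro finprod_one_eqI) (auto simp: mult.commute)
      ultimately show ?thesis using pS unfolding split by (simp add: nat_pow_distrib)
    qed
    then have "t' dvd t * L" unfolding t'_def using M.pow_eq_id[OF pS', of "t * L"] by (simp add: nat_pow_mult_of)
    then have t'_le: "t' \<le> t * L" and t'0: "t' > 0" using t L0 by (auto intro: dvd_imp_le Nat.gr0I)
    have lnt': "ln (real t') \<le> u + l"
    proof -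
      have "ln (real t') \<le> ln (real (t * L))"
        using t'_le t'0 t(2) L0 by (subst ln_le_cancel_iff) (simp_all flip: of_nat_mult)
      then show ?thesis using t L0 by (simp add: ln_mult u_def l_def)
    qed
    have n_s: "real n * s \<le> real n * (real n - 1) * s"
      using n s0 by (simp add: mult_le_cancel_right)
    have n2u: "u \<le> real n ^ 2 * u" using n u0 by (simp add: mult_le_cancel_right1 one_le_power)
    have card2: "card S \<ge> 2"
    proof (rule ccontr)
      assume "\<not> card S \<ge> 2"
      then consider "card S = 0" | "card S = 1" by linarith
      then show False
      proof cases
        case 1
        \<comment> \<open>With nothing kept, \<open>r = 1\<close> and
          \<open>T \<le> l < n s\<close>, contradicting the formula for \<open>T\<close>.\<close>
        then have Se: "S = {}" using fin by simp
        then have "r = 1" by (simp add: r_def)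
        moreover have "B \<noteq> {}" "card B = n" using 1 cards n by auto
        ultimately have "T < real n * s" using Tr l_less by simp
        then show False using T n_s n2u u0 by linarith
      next
        case 2
        then obtain j where j: "S = {j}" by (rule card_1_singletonE)
        then have jn: "j < n" using BS by auto
        \<comment> \<open>With a single eigenvalue kept, \<open>r\<close> and \<open>t'\<close> are
          both its order, so \<open>ln r\<close> is bounded by \<open>u + l\<close> as well, giving
          \<open>T \<le> u + 2 l\<close>, which is too small since
          \<open>l < (n - 1) s\<close>.\<close>
        have tr: "t' = r" unfolding t'_def r_def j using lamc[OF jn] by simp
        then have "T \<le> u + 2 * l" using Tr lnt' unfolding tr by linarith
        moreover have "B \<noteq> {}" "real (card B) = real n - 1" using 2 cards n by auto
        ultimately have "T < u + 2 * ((real n - 1) * s)" using l_less by simp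
        moreover have "2 * ((real n - 1) * s) \<le> real n * ((real n - 1) * s)"
          using n s0 by (intro mult_right_mono) auto
        ultimately show False using T n2u by (simp add: mult.assoc)
      qed
    qed
    then have Sne: "S \<noteq> {}" by auto
    define q where "q = real (card S)"
    have q: "2 \<le> q" "q \<le> real n" "real (card B) = real n - q"
      using card2 cards by (auto simp: q_def)
    have "real t' * real r powr (- 1 / q) = exp (ln (real t') - ln (real r) / q)"
      using t'0 r0 by (simp add: powr_def exp_diff exp_minus field_simps)
    also have "\<dots> \<le> exp (- s)"
    proof -
      have "(T - l) / q \<le> ln (real r) / q" using Tr q by (intro divide_right_mono) auto
      moreover have "u + l - (T - l) / q \<le> - s"
        using exponent_bookkeeping[of q "real n" u s l T] q u0 s0 l_le T by simp
      ultimately have "ln (real t') - ln (real r) / q \<le> - s" using lnt' by linarith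
      then show ?thesis by simp
    qed
    finally have main: "real t' * real r powr (- 1 / q) \<le> \<kappa>" by (simp add: \<kappa>s)
    \<comment> \<open>Kept eigenvalues have order at least \<open>exp s\<close>, the reciprocal of
      \<open>\<kappa>\<close>. This controls the exceptional \<open>z\<close>, while
      \<open>main\<close> controls the generic ones.\<close>
    have inv: "1 / real (o' i) \<le> \<kappa>" if "i \<in> S" for i
    proof -
      have "exp s \<le> real (o' i)" using that by (auto simp: S_def B_def)
      then have "1 / real (o' i) \<le> 1 / exp s" by (intro divide_left_mono) (auto intro: mult_pos_pos less_le_trans[OF exp_gt_zero])
      then show ?thesis by (simp add: \<kappa>s exp_minus inverse_eq_divide)
    qed
    have "real (card (eigen_pairs R lam N S)) \<le> real N ^ 2 * ((\<Sum>i\<in>S. 1 / real (M.ord (lam i)))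
          + 4 * real (card S) * real t' * real r powr (- 1 / real (card S)))"
      unfolding eigen_pairs_def
      using lam lamN BS by (intro card_pairs_bound[OF fin(2) Sne _ N _ r_def t'_def]) (auto simp: subset_iff)
    also have "\<dots> \<le> real N ^ 2 * (q * \<kappa> + 4 * q * \<kappa>)"
    proof (intro mult_left_mono add_mono)
      show "(\<Sum>i\<in>S. 1 / real (M.ord (lam i))) \<le> q * \<kappa>"
        unfolding q_def using inv by (intro sum_bounded_above) (auto simp: o'_def)
      show "4 * real (card S) * real t' * real r powr (- 1 / real (card S)) \<le> 4 * q * \<kappa>"
        using main q mult_left_mono[OF main, of "4 * q"] by (simp add: q_def mult.assoc)
    qed simp
    also have "\<dots> = 5 * q * (real N ^ 2 * \<kappa>)" by (simp add: algebra_simps)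
    also have "\<dots> \<le> 5 * real n * (real N ^ 2 * \<kappa>)"
      using q \<kappa>0 by (intro mult_right_mono) auto
    finally show thesis using that[OF BS(2)] by simp
  qed
qed

section \<open>Energy bounds\<close>

lemma group_ord_eqI:
  assumes "group G" "group H" "x \<in> carrier G" "y \<in> carrier H"
    and "\<And>k::nat. x [^]\<^bsub>G\<^esub> k = \<one>\<^bsub>G\<^esub> \<longleftrightarrow> y [^]\<^bsub>H\<^esub> k = \<one>\<^bsub>H\<^esub>"
  shows "group.ord G x = group.ord H y"
proof (rule dvd_antisym)
  interpret G: group G by fact
  interpret H: group H by fact
  show "G.ord x dvd H.ord y" using assms(3-5) G.pow_eq_id H.pow_ord_eq_1 by blast
  show "H.ord y dvd G.ord x" using assms(3-5) H.pow_eq_id G.pow_ord_eq_1 by blast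
qed

text \<open>The second term of the minimum is the first raised to the power
  \<open>n / (n - 1)\<close>. So it is the smaller one when the first is below 1; otherwise the
  first term is at least 1 and the trivial bound \<open>\<tau> ^ 3\<close> takes over. Hence only
  the second bound has to be supplied.\<close>

lemma min_exponent_bound:
  fixes c t \<tau> E n :: real
  assumes n: "n \<ge> 2" and t: "t \<ge> 1" and \<tau>: "\<tau> \<ge> 1" and c: "c \<ge> 1" and E: "E \<le> \<tau> ^ 3"
    and main: "E \<le> c * (\<tau> ^ 3 * (t powr (n / (n - 1)) * \<tau> powr (- 1 / (n * (n - 1)))))"
  shows "E \<le> c * (\<tau> ^ 3 * min (t * \<tau> powr (- 1 / n ^ 2)) (t powr (n / (n - 1)) * \<tau> powr (- 1 / (n * (n - 1)))))"
proof -
  define \<kappa>1 where "\<kappa>1 = t * \<tau> powr (- 1 / n ^ 2)"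
  define \<kappa>2 where "\<kappa>2 = t powr (n / (n - 1)) * \<tau> powr (- 1 / (n * (n - 1)))"
  have "E \<le> c * (\<tau> ^ 3 * \<kappa>1)"
  proof (cases "\<kappa>1 \<ge> 1")
    case True
    have "\<tau> ^ 3 * 1 \<le> \<tau> ^ 3 * \<kappa>1" using True \<tau> by (intro mult_left_mono) auto
    also have "1 * (\<tau> ^ 3 * \<kappa>1) \<le> c * (\<tau> ^ 3 * \<kappa>1)" using c True \<tau> by (intro mult_right_mono) auto
    finally show ?thesis using E by simp
  next
    case False
    have pos: "\<kappa>1 > 0" "\<kappa>2 > 0" using t \<tau> by (auto simp: \<kappa>1_def \<kappa>2_def)
    have l1: "ln \<kappa>1 = ln t - ln \<tau> / n ^ 2"
      using t \<tau> by (simp add: \<kappa>1_def ln_mult ln_powr)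
    have l2: "ln \<kappa>2 = n / (n - 1) * ln t - ln \<tau> / (n * (n - 1))"
      using t \<tau> by (simp add: \<kappa>2_def ln_mult ln_powr)
    have nz: "n \<noteq> 0" "n - 1 \<noteq> 0" using n by auto
    have "ln \<kappa>2 = n / (n - 1) * ln \<kappa>1"
      unfolding l1 l2 using nz by (simp add: right_diff_distrib power2_eq_square) (simp add: algebra_simps)
    also have "\<dots> \<le> 1 * ln \<kappa>1"
      using False pos n by (intro mult_right_mono_neg) (auto simp: field_simps)
    finally have "\<kappa>2 \<le> \<kappa>1" using pos by simp
    then have "c * (\<tau> ^ 3 * \<kappa>2) \<le> c * (\<tau> ^ 3 * \<kappa>1)" using c \<tau> by (intro mult_left_mono) auto
    then show ?thesis using main unfolding \<kappa>2_def by linarith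
  qed
  then show ?thesis using main unfolding \<kappa>1_def min_def by simp
qed

text \<open>A matrix solution gives simultaneous solutions for all eigenvalues, to which
  \<open>card_energy_le\<close> applies.\<close>

lemma energy_le_eigen_pairs:
  assumes L: "field L" and N: "mat_order n R A > 0"
    and lam: "\<And>i. i < n \<Longrightarrow> lam i \<in> carrier (mult_of L)"
    and powN: "\<And>k::nat. (\<forall>i<n. lam i [^]\<^bsub>L\<^esub> k = \<one>\<^bsub>L\<^esub>) \<longleftrightarrow> mat_order n R A dvd k"
    and eq: "\<And>(a::nat) (b::nat) (c::nat) (d::nat) i.
       A [^]\<^bsub>mat_ring n R\<^esub> a \<oplus>\<^bsub>mat_ring n R\<^esub> A [^]\<^bsub>mat_ring n R\<^esub> b = A [^]\<^bsub>mat_ring n R\<^esub> c \<oplus>\<^bsub>mat_ring n R\<^esub> A [^]\<^bsub>mat_ring n R\<^esub> d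
       \<Longrightarrow> i < n \<Longrightarrow> lam i [^]\<^bsub>L\<^esub> a \<oplus>\<^bsub>L\<^esub> lam i [^]\<^bsub>L\<^esub> b = lam i [^]\<^bsub>L\<^esub> c \<oplus>\<^bsub>L\<^esub> lam i [^]\<^bsub>L\<^esub> d"
    and S: "S \<subseteq> {..<n}"
  shows "energy n R A \<le> mat_order n R A * card (eigen_pairs L lam (mat_order n R A) S)"
proof -
  interpret L: field L by (rule L)
  define N where "N = mat_order n R A"
  define E where "E = {(x1, x2, x3, x4). {x1, x2, x3, x4} \<subseteq> {1..N} \<and>
       (\<forall>i<n. lam i [^]\<^bsub>L\<^esub> (x1::nat) \<oplus>\<^bsub>L\<^esub> lam i [^]\<^bsub>L\<^esub> (x2::nat) = lam i [^]\<^bsub>L\<^esub> (x3::nat) \<oplus>\<^bsub>L\<^esub> lam i [^]\<^bsub>L\<^esub> (x4::nat))}"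
  have "E \<subseteq> {1..N} \<times> {1..N} \<times> {1..N} \<times> {1..N}" unfolding E_def by auto
  then have fin: "finite E" by (rule finite_subset) simp
  have "energy n R A \<le> card E"
    unfolding energy_def N_def[symmetric]
  proof (rule card_mono[OF fin], rule subsetI)
    fix v assume v: "v \<in> {(x1, x2, x3, x4). {x1, x2, x3, x4} \<subseteq> {1..N} \<and>
       A [^]\<^bsub>mat_ring n R\<^esub> (x1::nat) \<oplus>\<^bsub>mat_ring n R\<^esub> A [^]\<^bsub>mat_ring n R\<^esub> (x2::nat)
       = A [^]\<^bsub>mat_ring n R\<^esub> (x3::nat) \<oplus>\<^bsub>mat_ring n R\<^esub> A [^]\<^bsub>mat_ring n R\<^esub> (x4::nat)}"
    obtain x1 x2 x3 x4 where "v = (x1, x2, x3, x4)" by (cases v) auto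
    then show "v \<in> E" using v eq unfolding E_def by blast
  qed
  also have "card E \<le> N * card (eigen_pairs L lam N S)"
    unfolding E_def eigen_pairs_def using N powN
    by (intro L.card_energy_le lam S) (auto simp: N_def)
  finally show ?thesis by (simp add: N_def)
qed

lemma energy_bounds:
  fixes R :: "'a ring"
  assumes n: "n \<ge> 2" and R: "field R" and finR: "finite (carrier R)"
    and A: "A \<in> carrier (GL n R)" and diag: "diagonalisable_over_closure n R A"
    and \<tau>0: "mat_order n R A > 0"
  defines "\<tau> \<equiv> real (mat_order n R A)" and "t \<equiv> real (det_order n R A)" and "E \<equiv> real (energy n R A)"
  shows "E \<le> 5 * real n * (\<tau> ^ 3 *
                min (t * \<tau> powr (- 1 / real n ^ 2))
                    (t powr (real n / (real n - 1)) * \<tau> powr (- 1 / (real n * (real n - 1)))))"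
    and "pirreducible\<^bsub>R\<^esub> (carrier R) (mat_char_poly n R A) \<Longrightarrow> E \<le> 5 * real n * (t * \<tau> powr (3 - 1 / real n))"
proof -
  interpret R: field R by (rule R)
  define L where "L = R.alg_closure"
  interpret L: field L
    unfolding L_def using R.alg_closureE(1) by (simp add: algebraic_closure_def)
  have L: "field L" by (rule L.field_axioms)
  have hom: "R.indexed_const \<in> Ring.ring_hom R L" unfolding L_def by (rule R.alg_closureE(2))
  interpret h: ring_hom_ring R L R.indexed_const by (rule ring_hom_ringI2[OF R.ring_axioms L.ring_axioms hom])
  interpret W: monoid "mat_ring n R" by (rule R.mat_ring_monoid)
  interpret MR: comm_group "mult_of R" by (rule R.comm_group_mult_of)
  interpret HL: comm_group "mult_of L" by (rule L.comm_group_mult_of)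
  have AU: "A \<in> Units (mat_ring n R)" using A by (simp add: GL_def units_of_carrier)
  then have Ac: "A \<in> carrier (mat_ring n R)" by (rule W.Units_closed)
  have diag': "mat_diagonalisable n L (map_mat R.indexed_const A)"
    using diag by (simp add: diagonalisable_over_closure_def L_def)
  obtain lam where lamc: "\<And>i. i < n \<Longrightarrow> lam i \<in> carrier L"
    and one: "\<And>k::nat. A [^]\<^bsub>mat_ring n R\<^esub> k = \<one>\<^bsub>mat_ring n R\<^esub> \<longleftrightarrow> (\<forall>i<n. lam i [^]\<^bsub>L\<^esub> k = \<one>\<^bsub>L\<^esub>)"
    and eq: "\<And>(a::nat) (b::nat) (c::nat) (d::nat) i.
       A [^]\<^bsub>mat_ring n R\<^esub> a \<oplus>\<^bsub>mat_ring n R\<^esub> A [^]\<^bsub>mat_ring n R\<^esub> b = A [^]\<^bsub>mat_ring n R\<^esub> c \<oplus>\<^bsub>mat_ring n R\<^esub> A [^]\<^bsub>mat_ring n R\<^esub> d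
       \<Longrightarrow> i < n \<Longrightarrow> lam i [^]\<^bsub>L\<^esub> a \<oplus>\<^bsub>L\<^esub> lam i [^]\<^bsub>L\<^esub> b = lam i [^]\<^bsub>L\<^esub> c \<oplus>\<^bsub>L\<^esub> lam i [^]\<^bsub>L\<^esub> d"
    and det: "R.indexed_const (mat_det n R A) = finprod L lam {..<n}"
    and root: "\<And>i. i < n \<Longrightarrow> L.eval (map R.indexed_const (mat_char_poly n R A)) (lam i) = \<zero>\<^bsub>L\<^esub>"
    using obtain_eigenvalues[OF R L hom Ac diag'] by blast
  define N where "N = mat_order n R A"
  have N0: "N > 0" using \<tau>0 by (simp add: N_def)
  have powN: "(\<forall>i<n. lam i [^]\<^bsub>L\<^esub> k = \<one>\<^bsub>L\<^esub>) \<longleftrightarrow> N dvd k" for k :: nat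
  proof -
    interpret G: group "GL n R" unfolding GL_def by (rule W.units_group)
    show ?thesis
      unfolding one[symmetric] N_def mat_order_def G.pow_eq_id[OF A, symmetric]
      by (simp add: GL_def units_of_one W.units_of_pow[OF AU])
  qed
  have lamN: "lam i [^]\<^bsub>L\<^esub> N = \<one>\<^bsub>L\<^esub>" if "i < n" for i using powN[of N] that by simp
  \<comment> \<open>An eigenvalue is nonzero because its power \<open>N\<close> is 1 with
    \<open>N > 0\<close>.\<close>
  have lam: "lam i \<in> carrier (mult_of L)" if "i < n" for i
    using lamc[OF that] lamN[OF that] N0 by (auto simp: L.nat_pow_zero)
  define p where "p = finprod L lam {..<n}"
  have lamF: "lam \<in> {..<n} \<rightarrow> carrier L" using lamc by auto
  have pc: "p \<in> carrier L" unfolding p_def by (rule L.finprod_closed[OF lamF])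
  have "p [^]\<^bsub>L\<^esub> N = \<one>\<^bsub>L\<^esub>"
    unfolding p_def L.finprod_nat_pow[OF lamF, symmetric] using lamN by (intro L.finprod_one_eqI) auto
  then have p: "p \<in> carrier (mult_of L)" using pc N0 by (auto simp: L.nat_pow_zero)
  define \<delta> where "\<delta> = mat_det n R A"
  have dc: "\<delta> \<in> carrier R" unfolding \<delta>_def by (rule R.mat_det_closed[OF Ac])
  have dp: "R.indexed_const \<delta> = p" using det by (simp add: \<delta>_def p_def)
  have d: "\<delta> \<in> carrier (mult_of R)" using dc dp p by auto
  have inj: "inj_on R.indexed_const (carrier R)" by (rule R.indexed_const_inj_on)
  \<comment> \<open>The embedding into the closure is injective, so the order of the determinant may
    be computed there as the order of the product of the eigenvalues.\<close>
  have "\<delta> [^]\<^bsub>R\<^esub> k = \<one>\<^bsub>R\<^esub> \<longleftrightarrow> p [^]\<^bsub>L\<^esub> k = \<one>\<^bsub>L\<^esub>" for k :: nat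
  proof -
    have "R.indexed_const (\<delta> [^]\<^bsub>R\<^esub> k) = p [^]\<^bsub>L\<^esub> k"
      using h.hom_nat_pow[OF dc, of k] dp by simp
    moreover have "R.indexed_const (\<delta> [^]\<^bsub>R\<^esub> k) = R.indexed_const \<one>\<^bsub>R\<^esub> \<longleftrightarrow> \<delta> [^]\<^bsub>R\<^esub> k = \<one>\<^bsub>R\<^esub>"
      using dc by (intro inj_on_eq_iff[OF inj]) auto
    moreover have "R.indexed_const \<one>\<^bsub>R\<^esub> = \<one>\<^bsub>L\<^esub>"
      by (rule ring_hom_one[OF hom])
    ultimately show ?thesis by metis
  qed
  then have "MR.ord \<delta> = HL.ord p"
    by (intro group_ord_eqI MR.group_axioms HL.group_axioms d p) (simp add: nat_pow_mult_of)
  then have t_eq: "det_order n R A = HL.ord p" by (simp add: det_order_def \<delta>_def)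
  have t0: "det_order n R A > 0"
    using MR.ord_ge_1[OF _ d] finR by (simp add: det_order_def \<delta>_def)
  have E_le: "E \<le> \<tau> * real (card (eigen_pairs L lam N S))" if "S \<subseteq> {..<n}" for S
    using energy_le_eigen_pairs[OF L \<tau>0 lam powN[unfolded N_def] eq that]
    unfolding E_def \<tau>_def N_def by (simp flip: of_nat_mult)
  have cube: "E \<le> \<tau> ^ 3"
  proof -
    have "E \<le> \<tau> * real (card (eigen_pairs L lam N {}))" by (rule E_le) simp
    also have "\<dots> \<le> \<tau> * real (N ^ 2)"
      by (intro mult_left_mono of_nat_mono card_eigen_pairs_trivial) (simp add: \<tau>_def)
    finally show ?thesis by (simp add: \<tau>_def N_def power3_eq_cube power2_eq_square)
  qed
  obtain S where S: "S \<subseteq> {..<n}" "real (card (eigen_pairs L lam N S)) \<le> 5 * real n * (real N ^ 2 *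
      (t powr (real n / (real n - 1)) * real N powr (- 1 / (real n * (real n - 1)))))"
    using L.card_eigen_pairs_general[OF n lam N0 powN _ t0 refl] t_eq unfolding t_def p_def by blast
  have "E \<le> \<tau> * (5 * real n * (real N ^ 2 * (t powr (real n / (real n - 1)) * real N powr (- 1 / (real n * (real n - 1))))))"
    using E_le[OF S(1)] mult_left_mono[OF S(2), of \<tau>] by (simp add: \<tau>_def)
  also have "\<dots> = 5 * real n * (\<tau> ^ 3 * (t powr (real n / (real n - 1)) * \<tau> powr (- 1 / (real n * (real n - 1)))))"
    by (simp add: \<tau>_def N_def power3_eq_cube power2_eq_square)
  finally show "E \<le> 5 * real n * (\<tau> ^ 3 *
                min (t * \<tau> powr (- 1 / real n ^ 2))
                    (t powr (real n / (real n - 1)) * \<tau> powr (- 1 / (real n * (real n - 1)))))"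
    using n t0 \<tau>0 cube by (intro min_exponent_bound) (auto simp: t_def \<tau>_def Suc_le_eq)
  assume irr: "pirreducible\<^bsub>R\<^esub> (carrier R) (mat_char_poly n R A)"
  \<comment> \<open>By irreducibility, an exponent killing one eigenvalue kills all of them, hence
    kills \<open>A\<close>, and is therefore a multiple of \<open>N\<close>.\<close>
  have ord: "HL.ord (lam i) = N" if i: "i < n" for i
  proof (rule dvd_antisym)
    show "HL.ord (lam i) dvd N"
      using HL.pow_eq_id[OF lam[OF i], of N] lamN[OF i] by (simp add: nat_pow_mult_of)
    have "lam i [^]\<^bsub>L\<^esub> HL.ord (lam i) = \<one>\<^bsub>L\<^esub>"
      using HL.pow_ord_eq_1[OF lam[OF i]] by (simp add: nat_pow_mult_of)
    then have "lam j [^]\<^bsub>L\<^esub> HL.ord (lam i) = \<one>\<^bsub>L\<^esub>" if "j < n" for j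
      using irreducible_roots_same_power[OF R L hom mat_char_poly_closed[OF R Ac] irr
        lamc[OF i] root[OF i] lamc[OF that] root[OF that]] by blast
    then show "N dvd HL.ord (lam i)" using powN by blast
  qed
  have "E \<le> \<tau> * real (card (eigen_pairs L lam N {..<n}))" by (rule E_le) simp
  also have "\<dots> \<le> \<tau> * (5 * real n * (real N ^ 2 * (t * real N powr (- 1 / real n))))"
    unfolding t_def using n t0 t_eq
    by (intro mult_left_mono L.card_eigen_pairs_irreducible lam N0 ord) (auto simp: p_def \<tau>_def)
  also have "\<dots> = 5 * real n * (t * (\<tau> powr 3 * \<tau> powr (- 1 / real n)))"
    using N0 by (simp add: \<tau>_def N_def power3_eq_cube power2_eq_square powr_numeral)
  also have "\<tau> powr 3 * \<tau> powr (- 1 / real n) = \<tau> powr (3 - 1 / real n)"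
    by (simp flip: powr_add)
  finally show "E \<le> 5 * real n * (t * \<tau> powr (3 - 1 / real n))" .
qed

theorem theorem2p1:
  fixes n :: nat
  assumes "n \<ge> 2"
  shows "\<exists>c::real. c > 0 \<and>
    (\<forall>(R :: 'a ring) A.
       field R \<longrightarrow> finite (carrier R) \<longrightarrow>
       A \<in> carrier (GL n R) \<longrightarrow> diagonalisable_over_closure n R A \<longrightarrow>
       (let \<tau> = real (mat_order n R A); t = real (det_order n R A); E = real (energy n R A) in
          E \<le> c * (\<tau> ^ 3 *
                min (t * \<tau> powr (- 1 / real n ^ 2))
                    (t powr (real n / (real n - 1)) * \<tau> powr (- 1 / (real n * (real n - 1))))) \<and>
          (pirreducible\<^bsub>R\<^esub> (carrier R) (mat_char_poly n R A) \<longrightarrow>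
             E \<le> c * (t * \<tau> powr (3 - 1 / real n)))))"
\<comment> \<open>The constant \<open>5 n\<close> collects at most \<open>n\<close> from the
  exceptional \<open>z\<close> and at most \<open>4 n\<close> from the remaining ones.\<close>
proof (intro exI[of _ "5 * real n"] conjI allI impI)
  show "5 * real n > 0" using assms by simp
  fix R :: "'a ring" and A
  assume *: "field R" "finite (carrier R)" "A \<in> carrier (GL n R)" "diagonalisable_over_closure n R A"
  show "let \<tau> = real (mat_order n R A); t = real (det_order n R A); E = real (energy n R A) in
          E \<le> 5 * real n * (\<tau> ^ 3 *
                min (t * \<tau> powr (- 1 / real n ^ 2))
                    (t powr (real n / (real n - 1)) * \<tau> powr (- 1 / (real n * (real n - 1))))) \<and>
          (pirreducible\<^bsub>R\<^esub> (carrier R) (mat_char_poly n R A) \<longrightarrow>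
             E \<le> 5 * real n * (t * \<tau> powr (3 - 1 / real n)))"
  proof (cases "mat_order n R A = 0")
    \<comment> \<open>\<open>group.ord\<close> takes the default value 0 for infinite order. The
      exponent range from 1 to 0 is then empty and the energy is 0, so both bounds hold.\<close>
    case True
    have "energy n R A = card ({} :: (nat \<times> nat \<times> nat \<times> nat) set)"
      unfolding energy_def True by (rule arg_cong[of _ _ card]) auto
    then show ?thesis using True by (simp add: Let_def)
  next
    case False
    then show ?thesis using energy_bounds[OF assms *] unfolding Let_def by blast
  qed
qed

end
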